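(* Consider the generalized equation $0\in\Phi x=Fx+Tx$ under the standing assumptions (A1)--(A4) of the context, and assume $L\rho<1$. Let $\hat L>L$ be such that $\hat L\rho<1$, and let $\bar\beta:=\frac{\lambda(4-\hat L\lambda)-4\rho}{4(1-\rho\hat L)}$ and $\Lambda:=\frac{\hat L-L}{L\hat L}$. Let $\{(x^k,y^k,z^k)\}$ be generated by the VFOSA$_+$ iteration (see context) using an estimator $\widetilde F^k$ of $Fx^k$ satisfying the $\mathbf{VR}(\Delta_k;\kappa_k,\Theta_k,\sigma_k)$ property (see context). Assume that $$2\rho\le\lambda<\tfrac{2(1+\sqrt{1-\hat L\rho})}{\hat L},\quad 0<\mu<\tfrac23,\quad r\ge 2+\tfrac1\mu,\quad \nu:=\tfrac\mu2,\quad 0<\beta\le\tfrac{(2-\mu)\bar\beta}{2+\mu},\quad t_k:=\mu(k+r),\quad \eta_k:=\tfrac{2\beta(t_k-1)}{t_k-\nu},$$ and that there are $\Gamma_k>0$ such that for all $k\ge0$: $\kappa_k\ge 1-\frac{\Gamma_{k-1}t_{k-2}(t_{k-2}-1)}{\Gamma_kt_{k-1}(t_{k-1}-1)}+\frac{5\beta}{\mu\Gamma_k}$ and $\Gamma_k\Theta_k\le2\Lambda$. Assume also that $$B_\infty:=\frac{\Lambda}{\beta}\sum_{k=0}^\infty t_{k-1}(t_{k-1}-1)\frac{\sigma_k^2}{\Theta_k}<+\infty.$$ For $x^\star\in\mathrm{zer}(\Phi)$ let $\Psi_0^2:=\mu^2r^2\,\mathbb{E}[\|G_\lambda x^0\|^2]+\frac{2r-1}{4\beta^2(\mu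 r-1)}\|x^0-x^\star\|^2$ and $E_0^2:=\frac{\mu r^2(\Gamma_0\mu+\beta)}{2\beta}\sigma_0^2$. Then for all $k\ge0$, $$\mathbb{E}[\|G_\lambda x^k\|^2]\le\frac{2(\Psi_0^2+E_0^2+B_\infty)}{\mu^2(k+r-1)^2}.$$ In addition, $$\sum_{k=0}^\infty(k+1)\mathbb{E}[\|G_\lambda x^k\|^2]<+\infty,\quad \sum_{k=0}^\infty(k+1)^2\,\mathbb{E}[\|\widetilde F^k-Fx^k\|^2]<+\infty,\quad \sum_{k=0}^\infty(k+1)\mathbb{E}[\|x^{k+1}-x^k\|^2]<+\infty,$$ and $$\lim_{k\to\infty}k^2\,\mathbb{E}[\|x^{k+1}-x^k\|^2]=0,\qquad \lim_{k\to\infty}k^2\,\mathbb{E}[\|G_\lambda x^k\|^2]=0.$$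
   Context: Problem: $F:\mathbb{R}^p\to\mathbb{R}^p$ is single-valued, $T:\mathbb{R}^p\rightrightarrows2^{\mathbb{R}^p}$ is possibly multi-valued, $\Phi:=F+T$, $\mathrm{dom}(\Phi)=\{x:\Phi x\ne\emptyset\}$, $\mathrm{zer}(\Phi):=\{x:0\in\Phi x\}$. There are two settings: the finite-sum setting $Fx=\frac1n\sum_{i=1}^nF_ix$, and the expectation setting $Fx=\mathbb{E}_\xi[\mathbf F(x,\xi)]$ for a random variable $\xi$. (In the finite-sum setting, $\mathbf F(x,\xi)$ means $F_ix$ with $i$ uniform on $\{1,\dots,n\}$.) Standing assumptions. (A1) $\mathrm{zer}(\Phi)\neq\emptyset$. (A2) In the expectation setting there is $\sigma\ge0$ with $\mathbb{E}_\xi[\|\mathbf F(x,\xi)-Fx\|^2]\le\sigma^2$ for all $x\in\mathrm{dom}(F)$. (A3) $T$ is maximally $\rho$-co-hypomonotone for some $\rho\ge0$: $\langle u-v,x-y\rangle\ge-\rho\|u-v\|^2$ for all $(x,u),(y,v)$ in the graph of $T$, and the graph is not properly contained in that of another such operator. (A4) There is $L>0$ such that for all $x,y\in\mathrm{dom}(F)$: in the finite-sum setting, $\langle Fx-Fy,x-y\rangle\ge\frac1{nL}\sum_{i=1}^n\|F_ix-F_iy\|^2$; in the expectation setting, $\langle Fx-Fy,x-y\rangle\ge\frac1L\mathbb{E}_\xi[\|\mathbf F(x,\xi)-\mathbf F(y,\xi)\|^2]$. Operators: for $\lambda>0$, $J_{\lambda T}x:=\{w:x\in w+\lambda Tw\}$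 is the resolvent of $\lambda T$, and $G_\lambda x:=\frac1\lambda\big(x-J_{\lambda T}(x-\lambda Fx)\big)$ is the forward-backward splitting residual. VFOSA$_+$ iteration: given $x^0\in\mathrm{dom}(\Phi)$, $z^0:=x^0$, for $k\ge0$: $y^k:=\frac{t_k-1}{t_k}x^k+\frac1{t_k}z^k$; $x^{k+1}:=y^k-\eta_k\widetilde G_\lambda^k$; $z^{k+1}:=z^k+\nu(x^{k+1}-y^k)$, where $\widetilde G_\lambda^k:=\frac1\lambda\big(x^k-J_{\lambda T}(x^k-\lambda\widetilde F^k)\big)$ and $\widetilde F^k$ is a stochastic estimator of $Fx^k$. The formula $t_k=\mu(k+r)$ is used for all integers $k\ge-2$. $\mathcal F_k$ is the $\sigma$-algebra generated by all the randomness of the algorithm up to the current iterates $x^0,\dots,x^k$ (the samples drawn at iteration $k$ to build $\widetilde F^k$ are not included), and $\mathbb{E}_k[\cdot]=\mathbb{E}[\cdot\mid\mathcal F_k]$. $\mathbf{VR}(\Delta_k;\kappa_k,\Theta_k,\sigma_k)$ property: there are parameters $\kappa_k\in(0,1]$, $\Theta_k\ge0$, $\sigma_k\ge0$ and random quantities $\Delta_k\ge0$ such that almost surely for all $k\ge0$: $\mathbb{E}_k[\|\widetilde F^k-Fx^k\|^2]\le\mathbb{E}_k[\Delta_k]$ and $\mathbb{E}_k[\Delta_k]\le(1-\kappa_k)\Delta_{k-1}+\Theta_k\bar{\mathcal E}_k+\sigma_k^2$, where $\bar{\mathcal E}_k:=\mathbb{E}_\xi[\|\mathbf F(x^k,\xi)-\mathbf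 F(x^{k-1},\xi)\|^2]$ (i.e. $\frac1n\sum_i\|F_ix^k-F_ix^{k-1}\|^2$ in the finite-sum setting), $x^{-1}:=x^0$, $\Delta_{-1}:=0$. Whenever $\Theta_k$ appears in a denominator it is taken positive. *)

theory Defs
  imports "HOL-Analysis.Analysis" "HOL-Probability.Probability"
begin

section \<open>Set-valued operators\<close>

definition graph_op :: "('v \<Rightarrow> 'v set) \<Rightarrow> ('v \<times> 'v) set" where
  "graph_op T = {(x, u). u \<in> T x}"

definition dom_op :: "('v \<Rightarrow> 'v set) \<Rightarrow> 'v set" where
  "dom_op T = {x. T x \<noteq> {}}"

definition zer_op :: "('v::zero \<Rightarrow> 'v set) \<Rightarrow> 'v set" where
  "zer_op T = {x. 0 \<in> T x}"

definition sum_op :: "('v::plus \<Rightarrow> 'v) \<Rightarrow> ('v \<Rightarrow> 'v set) \<Rightarrow> 'v \<Rightarrow> 'v set" where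
  "sum_op F T x = {F x + u | u. u \<in> T x}"

definition co_hypomonotone :: "real \<Rightarrow> ('v::real_inner \<Rightarrow> 'v set) \<Rightarrow> bool" where
  "co_hypomonotone \<rho> T \<longleftrightarrow>
     (\<forall>(x, u) \<in> graph_op T. \<forall>(y, v) \<in> graph_op T.
        inner (u - v) (x - y) \<ge> - \<rho> * (norm (u - v))\<^sup>2)"

definition maximally_co_hypomonotone :: "real \<Rightarrow> ('v::real_inner \<Rightarrow> 'v set) \<Rightarrow> bool" where
  "maximally_co_hypomonotone \<rho> T \<longleftrightarrow>
     co_hypomonotone \<rho> T \<and>
     \<not> (\<exists>S. co_hypomonotone \<rho> S \<and> graph_op T \<subset> graph_op S)"

definition resolvent :: "real \<Rightarrow> ('v::real_vector \<Rightarrow> 'v set) \<Rightarrow> 'v \<Rightarrow> 'v set" where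
  "resolvent l T x = {w. \<exists>u \<in> T w. x = w + l *\<^sub>R u}"

text \<open>
  The resolvent of a maximally \<open>\<rho>\<close>-co-hypomonotone operator is single-valued and everywhere
  defined for \<open>l > \<rho>\<close>, so \<^const>\<open>the_elem\<close> selects its value.  The second vector argument \<open>v\<close> is
  the forward direction: \<open>F x\<close> for the exact residual, an estimate of it in the algorithm.
\<close>

definition fb_step :: "real \<Rightarrow> ('v::real_vector \<Rightarrow> 'v set) \<Rightarrow> 'v \<Rightarrow> 'v \<Rightarrow> 'v" where
  "fb_step l T x v = (1 / l) *\<^sub>R (x - the_elem (resolvent l T (x - l *\<^sub>R v)))"

definition fb_residual ::
    "real \<Rightarrow> ('v::real_vector \<Rightarrow> 'v) \<Rightarrow> ('v \<Rightarrow> 'v set) \<Rightarrow> 'v \<Rightarrow> 'v" where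
  "fb_residual l F T x = fb_step l T x (F x)"


section \<open>The single-valued operator: finite-sum and expectation settings\<close>

text \<open>
  \<open>Finite_Sum n Fi\<close> is the family \<open>Fi 1, \<dots>, Fi n\<close>.  In \<open>Expectation P bF\<close> the measure \<open>P\<close> is the
  law of the random variable \<open>\<xi>\<close> and \<open>bF x \<xi>\<close> is the stochastic oracle.
\<close>

datatype ('v, 's) setting =
    Finite_Sum nat "nat \<Rightarrow> 'v \<Rightarrow> 'v"
  | Expectation "'s measure" "'v \<Rightarrow> 's \<Rightarrow> 'v"

primrec mean_op :: "('v::euclidean_space, 's) setting \<Rightarrow> 'v \<Rightarrow> 'v" where
  "mean_op (Finite_Sum n Fi) x = (1 / real n) *\<^sub>R (\<Sum>i=1..n. Fi i x)"
| "mean_op (Expectation P bF) x = (\<integral>\<xi>. bF x \<xi> \<partial>P)"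

primrec mean_sq_diff :: "('v::euclidean_space, 's) setting \<Rightarrow> 'v \<Rightarrow> 'v \<Rightarrow> real" where
  "mean_sq_diff (Finite_Sum n Fi) x y = (1 / real n) * (\<Sum>i=1..n. (norm (Fi i x - Fi i y))\<^sup>2)"
| "mean_sq_diff (Expectation P bF) x y = (\<integral>\<xi>. (norm (bF x \<xi> - bF y \<xi>))\<^sup>2 \<partial>P)"

text \<open>
  The uniform variance bound is imposed in the expectation setting only; with it, the integral
  in \<^const>\<open>mean_sq_diff\<close> is always that of an integrable function.
\<close>

primrec admissible_setting :: "('v::euclidean_space, 's) setting \<Rightarrow> bool" where
  "admissible_setting (Finite_Sum n Fi) \<longleftrightarrow> n \<ge> 1"
| "admissible_setting (Expectation P bF) \<longleftrightarrow>
     prob_space P \<and>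
     (\<forall>x. integrable P (bF x)) \<and>
     (\<exists>\<sigma>\<ge>0. \<forall>x.
        integrable P (\<lambda>\<xi>. (norm (bF x \<xi> - mean_op (Expectation P bF) x))\<^sup>2) \<and>
        (\<integral>\<xi>. (norm (bF x \<xi> - mean_op (Expectation P bF) x))\<^sup>2 \<partial>P) \<le> \<sigma>\<^sup>2)"

definition mean_co_coercive :: "real \<Rightarrow> ('v::euclidean_space, 's) setting \<Rightarrow> bool" where
  "mean_co_coercive L Q \<longleftrightarrow>
     (\<forall>x y. inner (mean_op Q x - mean_op Q y) (x - y) \<ge> (1 / L) * mean_sq_diff Q x y)"


section \<open>The stochastic iteration\<close>

text \<open>
  \<open>\<zeta> j\<close> is the randomness drawn at iteration \<open>j\<close>, with values in the measurable space \<open>N j\<close>.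
  The starting point is deterministic, so everything determining \<open>x\<^sup>0, \<dots>, x\<^sup>k\<close> is generated by
  \<open>\<zeta> 0, \<dots>, \<zeta> (k - 1)\<close>.
\<close>

definition history ::
    "'a measure \<Rightarrow> (nat \<Rightarrow> 'b measure) \<Rightarrow> (nat \<Rightarrow> 'a \<Rightarrow> 'b) \<Rightarrow> nat \<Rightarrow> 'a measure" where
  "history M N \<zeta> k =
     sigma (space M) (\<Union>j\<in>{..<k}. {\<zeta> j -` A \<inter> space M | A. A \<in> sets (N j)})"

definition VFOSA_plus ::
    "'a measure \<Rightarrow> real \<Rightarrow> ('v::euclidean_space \<Rightarrow> 'v set) \<Rightarrow> (int \<Rightarrow> real) \<Rightarrow> (nat \<Rightarrow> real) \<Rightarrow> real \<Rightarrow>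
     (nat \<Rightarrow> 'a \<Rightarrow> 'v) \<Rightarrow> 'v \<Rightarrow> (nat \<Rightarrow> 'a \<Rightarrow> 'v) \<Rightarrow> (nat \<Rightarrow> 'a \<Rightarrow> 'v) \<Rightarrow> (nat \<Rightarrow> 'a \<Rightarrow> 'v) \<Rightarrow> bool" where
  "VFOSA_plus M l T t \<eta> \<nu> Ft x0 x y z \<longleftrightarrow>
     (\<forall>\<omega>\<in>space M.
        x 0 \<omega> = x0 \<and> z 0 \<omega> = x0 \<and>
        (\<forall>k. y k \<omega> = ((t (int k) - 1) / t (int k)) *\<^sub>R x k \<omega> + (1 / t (int k)) *\<^sub>R z k \<omega> \<and>
             x (Suc k) \<omega> = y k \<omega> - \<eta> k *\<^sub>R fb_step l T (x k \<omega>) (Ft k \<omega>) \<and>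
             z (Suc k) \<omega> = z k \<omega> + \<nu> *\<^sub>R (x (Suc k) \<omega> - y k \<omega>)))"

text \<open>
  The conventions \<open>x\<^sup>-\<^sup>1 = x\<^sup>0\<close> and \<open>\<Delta>\<^sub>-\<^sub>1 = 0\<close> appear as the truncated subtraction in
  \<open>x (k - 1)\<close> and as the case distinction on \<open>k = 0\<close>.  The conditional expectations are those of
  nonnegative, a priori not integrable random variables.
\<close>

definition VR_property ::
    "'a measure \<Rightarrow> (nat \<Rightarrow> 'a measure) \<Rightarrow> ('v::euclidean_space, 's) setting \<Rightarrow>
     (nat \<Rightarrow> 'a \<Rightarrow> 'v) \<Rightarrow> (nat \<Rightarrow> 'a \<Rightarrow> 'v) \<Rightarrow>
     (nat \<Rightarrow> 'a \<Rightarrow> real) \<Rightarrow> (nat \<Rightarrow> real) \<Rightarrow> (nat \<Rightarrow> real) \<Rightarrow> (nat \<Rightarrow> real) \<Rightarrow> bool" where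
  "VR_property M \<F> Q x Ft \<Delta> \<kappa> \<Theta> \<sigma> \<longleftrightarrow>
     (\<forall>k. 0 < \<kappa> k \<and> \<kappa> k \<le> 1 \<and> 0 \<le> \<Theta> k \<and> 0 \<le> \<sigma> k) \<and>
     (\<forall>k. \<Delta> k \<in> borel_measurable M) \<and>
     (AE \<omega> in M. \<forall>k.
        0 \<le> \<Delta> k \<omega> \<and>
        nn_cond_exp M (\<F> k) (\<lambda>\<omega>. ennreal ((norm (Ft k \<omega> - mean_op Q (x k \<omega>)))\<^sup>2)) \<omega>
          \<le> nn_cond_exp M (\<F> k) (\<lambda>\<omega>. ennreal (\<Delta> k \<omega>)) \<omega> \<and>
        nn_cond_exp M (\<F> k) (\<lambda>\<omega>. ennreal (\<Delta> k \<omega>)) \<omega>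
          \<le> ennreal ((1 - \<kappa> k) * (if k = 0 then 0 else \<Delta> (k - 1) \<omega>)
                     + \<Theta> k * mean_sq_diff Q (x k \<omega>) (x (k - 1) \<omega>) + (\<sigma> k)\<^sup>2))"

end

theory Submission
  imports Defs
begin

text \<open>
Let \<open>G\<close> be the forward-backward residual with step \<open>\<lambda>\<close> (called \<open>lam\<close> below), and abbreviate
\<open>g\<^sub>k = G x\<^sup>k\<close>, \<open>p\<^sub>k = z\<^sup>k - x\<^sup>k\<close>, and \<open>e\<^sub>k\<close> for the difference between the stochastic residual that the
algorithm uses and \<open>g\<^sub>k\<close>.

\<^bold>\<open>Geometry.\<close>  For \<open>\<lambda> > \<rho>\<close> the resolvent of \<open>\<lambda>T\<close> is defined everywhere (a Minty theorem,
\<open>resolvent_nonempty\<close>), and for \<open>\<lambda> \<ge> 2\<rho>\<close> it is nonexpansive.  Hence \<open>e\<^sub>k\<close> is at most the error of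
the estimator of \<open>F x\<^sup>k\<close>.  Combining the co-hypomonotonicity of \<open>T\<close> with the co-coercivity of \<open>F\<close>, of
which a part proportional to \<open>\<Lambda>\<close> is kept aside, gives (\<open>fb_residual_co_coercive\<close>)
\<open>\<langle>G x - G y, x - y\<rangle> \<ge> \<beta>bar |G x - G y|\<^sup>2 + \<Lambda> L \<langle>F x - F y, x - y\<rangle>\<close>,
and \<open>L \<langle>F x - F y, x - y\<rangle>\<close> dominates the mean squared difference that drives the variance reduction.

\<^bold>\<open>Potential.\<close>  The step sizes \<open>\<eta>\<^sub>k\<close> are chosen such that the displacement has two expressions,
\<open>x\<^sup>k\<^sup>+\<^sup>1 - x\<^sup>k = p\<^sub>k / t\<^sub>k - \<eta>\<^sub>k (g\<^sub>k + e\<^sub>k) = p\<^sub>k\<^sub>+\<^sub>1 / (t\<^sub>k - 1) - 2 \<beta> (g\<^sub>k + e\<^sub>k)\<close>.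
Inserting the first one in the product with \<open>g\<^sub>k\<close> and the second one in the product with \<open>g\<^sub>k\<^sub>+\<^sub>1\<close>, the
co-coercivity inequality between \<open>x\<^sup>k\<^sup>+\<^sup>1\<close> and \<open>x\<^sup>k\<close>, multiplied by \<open>t\<^sub>k (t\<^sub>k - 1)\<close>, nearly telescopes
in \<open>\<beta> t\<^sub>k\<^sub>-\<^sub>1 (t\<^sub>k\<^sub>-\<^sub>1 - 1) |g\<^sub>k|\<^sup>2 - t\<^sub>k\<^sub>-\<^sub>1 \<langle>g\<^sub>k, p\<^sub>k\<rangle>\<close>.  What is left over are terms in
\<open>|g\<^sub>k|\<^sup>2\<close>, whose balance is favourable for \<open>\<mu> < 2/3\<close>, and a multiple of \<open>\<langle>g\<^sub>k, p\<^sub>k\<rangle>\<close>.  Multiples of \<open>|p\<^sub>k|\<^sup>2\<close> and \<open>|z\<^sup>k - x\<^sup>\<star>|\<^sup>2\<close> are added whose increments cancel the latter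
exactly.  The resulting \<open>potential\<close> decreases (\<open>potential_step\<close>) up to a multiple of
\<open>t\<^sub>k (t\<^sub>k - 1) |e\<^sub>k|\<^sup>2\<close>, with dissipation of order \<open>k |g\<^sub>k|\<^sup>2 + |p\<^sub>k|\<^sup>2 / k\<close> and a gain from \<open>\<Lambda>\<close>.  The
weight of \<open>|z\<^sup>k - x\<^sup>\<star>|\<^sup>2\<close> is large enough for the potential to dominate
\<open>\<beta> t\<^sub>k\<^sub>-\<^sub>1\<^sup>2 |g\<^sub>k|\<^sup>2 / 2\<close> (\<open>potential_lower_bound\<close>).

\<^bold>\<open>Noise.\<close>  In expectation the potential is augmented by \<open>\<Gamma>\<^sub>k t\<^sub>k\<^sub>-\<^sub>1 (t\<^sub>k\<^sub>-\<^sub>1 - 1) / 2\<close> times the mean of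
\<open>\<Delta>\<^sub>k\<close>.  The lower bound on \<open>\<kappa>\<^sub>k\<close> makes this term pay for the \<open>|e\<^sub>k|\<^sup>2\<close> term, and
\<open>\<Gamma>\<^sub>k \<Theta>\<^sub>k \<le> 2 \<Lambda>\<close> lets the gain from \<open>\<Lambda>\<close> pay for the growth of \<open>\<Delta>\<^sub>k\<close>; only the summable terms with
\<open>\<sigma>\<^sub>k\<close> remain (\<open>energy_step\<close>).  So the energy is bounded, which is the \<open>O(1/k\<^sup>2)\<close> rate, and the
dissipation is summable.

\<^bold>\<open>Limits.\<close>  Given the summability, both \<open>E |p\<^sub>k|\<^sup>2\<close> and the mean of the telescoping quantity above are
decreasing up to summable perturbations, hence convergent.  Divided by \<open>k\<close> they are summable, so
their limits vanish (\<open>little_o_rates\<close>), and so do those of \<open>k\<^sup>2 E |g\<^sub>k|\<^sup>2\<close> and \<open>k\<^sup>2 E |x\<^sup>k\<^sup>+\<^sup>1 - x\<^sup>k|\<^sup>2\<close>.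
\<close>

section \<open>Resolvents of co-hypomonotone operators\<close>

text \<open>
A finite-dimensional form of the extension property of monotone operators.  The expressions
\<open>\<langle>u - v, x - c u - w\<rangle>\<close> are concave quadratics in \<open>u\<close> with a common leading part, so their minimax problem
is a convex one: over the convex hull of the points \<open>(w, v, \<langle>v, w\<rangle>)\<close> minimise the maximal value over \<open>u\<close>
of the corresponding quadratic, which is \<open>h\<close> below.  The optimality condition of the minimiser says that the
maximising \<open>u\<close> makes every one of the expressions at least \<open>h\<close>, and monotonicity makes \<open>h\<close>
nonnegative on the hull.
\<close>

lemma minty_finite:
  fixes S :: "('v::euclidean_space \<times> 'v) set" and x :: 'v
  assumes fin: "finite S" and c: "c > 0"
    and mono: "\<And>w v w' v'. (w, v) \<in> S \<Longrightarrow> (w', v') \<in> S \<Longrightarrow> inner (v - v') (w - w') \<ge> 0"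
  shows "\<exists>u. \<forall>(w, v) \<in> S. inner (u - v) (x - c *\<^sub>R u - w) \<ge> 0"
proof (cases "S = {}")
  case True then show ?thesis by simp
next
  case False
  define \<psi> :: "'v \<times> 'v \<Rightarrow> 'v \<times> 'v \<times> real" where "\<psi> = (\<lambda>(w, v). (w, v, inner v w))"
  define K where "K = convex hull (\<psi> ` S)"
  define b :: "'v \<times> 'v \<times> real \<Rightarrow> 'v" where "b = (\<lambda>(w, v, a). x - w + c *\<^sub>R v)"
  define h :: "'v \<times> 'v \<times> real \<Rightarrow> real" where
    "h = (\<lambda>q. (norm (b q))\<^sup>2 / (4 * c) - inner (fst (snd q)) x + snd (snd q))"
  have K_compact: "compact K"
    unfolding K_def using fin by (intro finite_imp_compact_convex_hull) auto
  have K_ne: "K \<noteq> {}" using False by (simp add: K_def)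
  have "continuous_on K h"
    unfolding h_def b_def case_prod_unfold by (intro continuous_intros) (use c in auto)
  from continuous_attains_inf[OF K_compact K_ne this]
  obtain q where q: "q \<in> K" and q_min: "\<And>q'. q' \<in> K \<Longrightarrow> h q \<le> h q'" by blast
  obtain w v a where q_eq: "q = (w, v, a)" by (cases q)
  \<comment> \<open>For lifted points, monotonicity is an affine inequality in each of the two arguments; it
      extends from \<open>\<psi> ` S\<close> to the hull in one argument at a time.\<close>
  have K_half: "K \<subseteq> {(w', v', a'). inner v' w0 + inner w' v0 - a' \<le> d}"
    if "\<And>w' v'. (w', v') \<in> S \<Longrightarrow> inner v' w0 + inner w' v0 - inner v' w' \<le> d" for w0 v0 d
  proof -
    have "{(w', v', a'). inner v' w0 + inner w' v0 - a' \<le> d} =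
          {y. inner (v0, w0, - 1 :: real) y \<le> d}"
      by (auto simp: inner_commute algebra_simps)
    then have "convex {(w', v', a'). inner v' w0 + inner w' v0 - a' \<le> d}"
      by (simp only: convex_halfspace_le)
    then show ?thesis
      unfolding K_def by (intro hull_minimal) (auto simp: \<psi>_def that)
  qed
  have "K \<subseteq> {(w', v', a'). inner v' w0 + inner w' v0 - a' \<le> inner v0 w0}" if "(w0, v0) \<in> S" for w0 v0
    by (rule K_half) (use mono[OF _ that] in \<open>auto simp: inner_diff algebra_simps inner_commute\<close>)
  then have "inner v w0 + inner w v0 - a \<le> inner v0 w0" if "(w0, v0) \<in> S" for w0 v0
    using q q_eq that by auto
  then have "K \<subseteq> {(w', v', a'). inner v' w + inner w' v - a' \<le> a}"
    by (intro K_half) (force simp: inner_commute algebra_simps)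
  then have a_ge: "inner v w \<le> a" using q q_eq by (auto simp: inner_commute)
  define u where "u = (1 / (2 * c)) *\<^sub>R b q"
  have b_u: "b q = (2 * c) *\<^sub>R u" using c by (simp add: u_def)
  have h_q: "h q = c * (norm u)\<^sup>2 - inner v x + a"
    unfolding h_def b_u by (simp add: q_eq power_mult_distrib power2_eq_square field_simps)
  have "0 \<le> c * (norm (u - v))\<^sup>2" using c by simp
  also have "\<dots> = c * (norm u)\<^sup>2 - inner v (b q) + c * (norm v)\<^sup>2"
    unfolding b_u by (simp add: power2_norm_eq_inner inner_diff algebra_simps inner_commute)
  also have "\<dots> = c * (norm u)\<^sup>2 - inner v x + inner v w"
    by (simp add: b_def q_eq power2_norm_eq_inner inner_diff inner_add algebra_simps)
  finally have h_nonneg: "h q \<ge> 0" using a_ge h_q by linarith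
  have "inner (u - v') (x - c *\<^sub>R u - w') \<ge> 0" if S: "(w', v') \<in> S" for w' v'
  proof -
    define q' where "q' = \<psi> (w', v')"
    define lin where "lin = inner u (b q' - b q) - inner (v' - v) x + (inner v' w' - a)"
    have q': "q' \<in> K" using S by (auto simp: K_def q'_def intro: hull_inc)
    \<comment> \<open>\<open>lin\<close> is the derivative of \<open>h\<close> at the minimiser in the direction of \<open>q'\<close>.\<close>
    have lin_s: "0 \<le> lin + s * ((norm (b q' - b q))\<^sup>2 / (4 * c))" if s: "0 < s" "s \<le> 1" for s
    proof -
      have "(1 - s) *\<^sub>R q + s *\<^sub>R q' \<in> K"
        using s q q' by (auto simp: K_def intro!: convexD_alt)
      moreover have bs: "b ((1 - s) *\<^sub>R q + s *\<^sub>R q') = b q + s *\<^sub>R (b q' - b q)"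
        by (simp add: b_def q_eq q'_def \<psi>_def algebra_simps)
      ultimately have "h q \<le> h ((1 - s) *\<^sub>R q + s *\<^sub>R q')" using q_min by blast
      also have "\<dots> = (norm (b q + s *\<^sub>R (b q' - b q)))\<^sup>2 / (4 * c)
          - inner (v + s *\<^sub>R (v' - v)) x + (a + s * (inner v' w' - a))"
        unfolding h_def bs by (simp add: q_eq q'_def \<psi>_def algebra_simps)
      also have "(norm (b q + s *\<^sub>R (b q' - b q)))\<^sup>2 =
          (norm (b q))\<^sup>2 + 2 * s * inner (b q) (b q' - b q) + s\<^sup>2 * (norm (b q' - b q))\<^sup>2"
        unfolding power2_norm_eq_inner
        by (simp add: inner_add inner_diff algebra_simps inner_commute power2_eq_square)
      also have "inner (b q) (b q' - b q) = 2 * c * inner u (b q' - b q)"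
        unfolding b_u by simp
      also have "((norm (b q))\<^sup>2 + 2 * s * (2 * c * inner u (b q' - b q))
            + s\<^sup>2 * (norm (b q' - b q))\<^sup>2) / (4 * c) =
          (norm (b q))\<^sup>2 / (4 * c) + s * inner u (b q' - b q)
            + s * (s * ((norm (b q' - b q))\<^sup>2 / (4 * c)))"
        using c by (simp add: field_simps power2_eq_square)
      finally have "h q \<le> h q + s * (lin + s * ((norm (b q' - b q))\<^sup>2 / (4 * c)))"
        by (simp add: h_def lin_def q_eq inner_add_left distrib_left right_diff_distrib)
      then show ?thesis using s by (simp add: zero_le_mult_iff)
    qed
    have "((\<lambda>s. lin + s * ((norm (b q' - b q))\<^sup>2 / (4 * c)))
        \<longlongrightarrow> lin + 0 * ((norm (b q' - b q))\<^sup>2 / (4 * c))) (at_right 0)"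
      by (intro tendsto_intros)
    then have "0 \<le> lin + 0 * ((norm (b q' - b q))\<^sup>2 / (4 * c))"
    proof (rule tendsto_lowerbound)
      show "\<forall>\<^sub>F s in at_right 0. 0 \<le> lin + s * ((norm (b q' - b q))\<^sup>2 / (4 * c))"
        unfolding eventually_at_right_field
      proof (intro exI[of _ 1] conjI allI impI)
        fix s :: real assume "0 < s" "s < 1"
        then show "0 \<le> lin + s * ((norm (b q' - b q))\<^sup>2 / (4 * c))" by (intro lin_s) auto
      qed simp
    qed simp
    then have "lin \<ge> 0" by simp
    moreover have "inner (u - v') (x - c *\<^sub>R u - w') - lin = h q"
    proof -
      have "inner u (b q') = inner u x - inner u w' + c * inner u v'"
        by (simp add: b_def q'_def \<psi>_def inner_diff inner_add)
      moreover have "inner u (b q) = 2 * c * (norm u)\<^sup>2"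
        unfolding b_u by (simp add: power2_norm_eq_inner)
      ultimately show ?thesis
        unfolding h_q lin_def
        by (simp add: inner_diff algebra_simps inner_commute power2_norm_eq_inner)
    qed
    ultimately show ?thesis using h_nonneg by linarith
  qed
  then show ?thesis by blast
qed

text \<open>
The solution sets for single pairs are balls, so compactness passes from finite subsets to the whole graph.
\<close>

lemma minty_extension:
  fixes A :: "('v::euclidean_space \<times> 'v) set" and x :: 'v
  assumes c: "c > 0"
    and mono: "\<And>w v w' v'. (w, v) \<in> A \<Longrightarrow> (w', v') \<in> A \<Longrightarrow> inner (v - v') (w - w') \<ge> 0"
  shows "\<exists>u. \<forall>(w, v) \<in> A. inner (u - v) (x - c *\<^sub>R u - w) \<ge> 0"
proof (cases "A = {}")
  case False
  then obtain w0 v0 where wv0: "(w0, v0) \<in> A" by auto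
  define C :: "'v \<times> 'v \<Rightarrow> 'v set" where
    "C = (\<lambda>(w, v). {u. inner (u - v) (x - c *\<^sub>R u - w) \<ge> 0})"
  have C_closed: "closed (C q)" for q
    unfolding C_def case_prod_unfold by (intro closed_Collect_le continuous_intros)
  have "C (w0, v0) \<subseteq> cball v0 (norm (x - w0 - c *\<^sub>R v0) / c)"
  proof
    fix u assume "u \<in> C (w0, v0)"
    then have "0 \<le> inner (u - v0) (x - c *\<^sub>R u - w0)" by (simp add: C_def)
    also have "x - c *\<^sub>R u - w0 = (x - w0 - c *\<^sub>R v0) - c *\<^sub>R (u - v0)"
      by (simp add: algebra_simps)
    finally have "c * (norm (u - v0))\<^sup>2 \<le> inner (u - v0) (x - w0 - c *\<^sub>R v0)"
      by (simp add: inner_diff_right power2_norm_eq_inner)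
    also have "\<dots> \<le> norm (u - v0) * norm (x - w0 - c *\<^sub>R v0)" by (rule norm_cauchy_schwarz)
    finally have "c * norm (u - v0) \<le> norm (x - w0 - c *\<^sub>R v0) \<or> norm (u - v0) = 0"
      by (auto simp: power2_eq_square)
    then show "u \<in> cball v0 (norm (x - w0 - c *\<^sub>R v0) / c)"
      using c by (auto simp: dist_norm norm_minus_commute field_simps)
  qed
  then have C0: "compact (C (w0, v0))"
    using C_closed by (meson bounded_cball bounded_subset compact_eq_bounded_closed)
  have "C (w0, v0) \<inter> \<Inter> (C ` A) \<noteq> {}"
  proof (rule compact_imp_fip[OF C0])
    fix \<D> assume D: "finite \<D>" "\<D> \<subseteq> C ` A"
    then obtain B where B: "B \<subseteq> A" "finite B" "\<D> = C ` B" by (meson finite_subset_image)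
    have "\<exists>u. \<forall>(w, v) \<in> insert (w0, v0) B. inner (u - v) (x - c *\<^sub>R u - w) \<ge> 0"
      using B wv0 by (intro minty_finite c) (auto intro!: mono)
    then show "C (w0, v0) \<inter> \<Inter> \<D> \<noteq> {}" unfolding B C_def by fastforce
  qed (use C_closed in auto)
  then show ?thesis unfolding C_def by fastforce
qed simp

text \<open>
The set of pairs \<open>(w + \<rho> v, v)\<close> with \<open>v \<in> T w\<close> is monotone, and a resolvent value of \<open>T\<close> with parameter \<open>l\<close>
is one of this set with parameter \<open>l - \<rho>\<close>.  The point found by \<open>minty_extension\<close> can be added to
the graph of \<open>T\<close> without losing co-hypomonotonicity, so by maximality it is already there.
\<close>

lemma resolvent_nonempty:
  fixes T :: "'v::euclidean_space \<Rightarrow> 'v set"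
  assumes T: "maximally_co_hypomonotone \<rho> T" and l: "\<rho> < l"
  shows "resolvent l T a \<noteq> {}"
proof -
  define A where "A = (\<lambda>(w, v). (w + \<rho> *\<^sub>R v, v)) ` graph_op T"
  have co: "co_hypomonotone \<rho> T" using T by (simp add: maximally_co_hypomonotone_def)
  have "inner (v - v') (w - w') \<ge> 0" if wv: "(w, v) \<in> A" and wv': "(w', v') \<in> A" for w v w' v'
  proof -
    obtain w1 w1' where "w = w1 + \<rho> *\<^sub>R v" "(w1, v) \<in> graph_op T"
        "w' = w1' + \<rho> *\<^sub>R v'" "(w1', v') \<in> graph_op T"
      using wv wv' unfolding A_def by auto
    moreover from this have "- \<rho> * (norm (v - v'))\<^sup>2 \<le> inner (v - v') (w1 - w1')"
      using co unfolding co_hypomonotone_def by blast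
    ultimately show ?thesis
      by (simp add: power2_norm_eq_inner inner_diff inner_add algebra_simps inner_commute)
  qed
  then obtain u where u: "\<And>w v. (w, v) \<in> A \<Longrightarrow> inner (u - v) (a - (l - \<rho>) *\<^sub>R u - w) \<ge> 0"
    using minty_extension[of "l - \<rho>" A a] l by fastforce
  define w0 where "w0 = a - l *\<^sub>R u"
  have rel: "inner (u - v) (w0 - w) \<ge> - \<rho> * (norm (u - v))\<^sup>2" if "v \<in> T w" for w v
  proof -
    have "(w + \<rho> *\<^sub>R v, v) \<in> A" using that by (force simp: A_def graph_op_def)
    from u[OF this] show ?thesis
      by (simp add: w0_def power2_norm_eq_inner inner_diff inner_add algebra_simps inner_commute)
  qed
  have rel': "inner (v - u) (w - w0) \<ge> - \<rho> * (norm (v - u))\<^sup>2" if "v \<in> T w" for w v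
    using rel[OF that] by (simp add: inner_diff norm_minus_commute algebra_simps)
  define S where "S = (\<lambda>w. if w = w0 then insert u (T w) else T w)"
  have S_iff: "v \<in> S w \<longleftrightarrow> v \<in> T w \<or> (w = w0 \<and> v = u)" for w v by (auto simp: S_def)
  have "co_hypomonotone \<rho> S"
    using co rel rel' unfolding co_hypomonotone_def graph_op_def by (auto simp: S_iff)
  moreover have "graph_op T \<subseteq> graph_op S" by (auto simp: graph_op_def S_def)
  ultimately have "graph_op S = graph_op T"
    using T unfolding maximally_co_hypomonotone_def by blast
  moreover have "(w0, u) \<in> graph_op S" by (simp add: graph_op_def S_def)
  ultimately have "u \<in> T w0" by (simp add: graph_op_def)
  then have "w0 \<in> resolvent l T a" unfolding resolvent_def w0_def by force
  then show ?thesis by blast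
qed

lemma resolvent_nonexpansive:
  assumes co: "co_hypomonotone \<rho> T" and l: "0 < l" "2 * \<rho> \<le> l"
    and w: "w \<in> resolvent l T a" and w': "w' \<in> resolvent l T a'"
  shows "norm (w - w') \<le> norm (a - a')"
proof -
  obtain u u' where u: "u \<in> T w" "a = w + l *\<^sub>R u" and u': "u' \<in> T w'" "a' = w' + l *\<^sub>R u'"
    using w w' unfolding resolvent_def by auto
  have mono: "- \<rho> * (norm (u - u'))\<^sup>2 \<le> inner (u - u') (w - w')"
    using co u u' unfolding co_hypomonotone_def graph_op_def by blast
  have "(norm (a - a'))\<^sup>2 =
      (norm (w - w'))\<^sup>2 + l\<^sup>2 * (norm (u - u'))\<^sup>2 + 2 * l * inner (u - u') (w - w')"
    unfolding u u' power2_norm_eq_inner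
    by (simp add: inner_diff inner_add algebra_simps inner_commute power2_eq_square)
  moreover have "2 * l * (- \<rho> * (norm (u - u'))\<^sup>2) \<le> 2 * l * inner (u - u') (w - w')"
    using l mono by (intro mult_left_mono) auto
  moreover have "l * (2 * \<rho>) * (norm (u - u'))\<^sup>2 \<le> l * l * (norm (u - u'))\<^sup>2"
    using l by (intro mult_right_mono mult_left_mono) auto
  ultimately have "(norm (w - w'))\<^sup>2 \<le> (norm (a - a'))\<^sup>2"
    by (simp add: power2_eq_square algebra_simps)
  then show ?thesis by simp
qed

lemma resolvent_singleton:
  fixes T :: "'v::euclidean_space \<Rightarrow> 'v set"
  assumes T: "maximally_co_hypomonotone \<rho> T" and l: "0 < l" "\<rho> < l" "2 * \<rho> \<le> l"
  shows "resolvent l T a = {the_elem (resolvent l T a)}"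
proof -
  obtain w where w: "w \<in> resolvent l T a" using resolvent_nonempty[OF T l(2)] by blast
  have "w' = w" if "w' \<in> resolvent l T a" for w'
    using resolvent_nonexpansive[OF _ l(1,3) that w] T
    by (simp add: maximally_co_hypomonotone_def)
  then have "resolvent l T a = {w}" using w by blast
  then show ?thesis by simp
qed

section \<open>Co-coercivity of the forward-backward residual\<close>

lemma norm_add3_sq_le:
  fixes a b c :: "'v::real_normed_vector"
  shows "(norm (a + b + c))\<^sup>2 \<le> 3 * (norm a)\<^sup>2 + 3 * (norm b)\<^sup>2 + 3 * (norm c)\<^sup>2"
proof -
  have "norm (a + b + c) \<le> norm a + norm b + norm c" by norm
  then have "(norm (a + b + c))\<^sup>2 \<le> (norm a + norm b + norm c)\<^sup>2" by (intro power_mono) auto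
  moreover have "0 \<le> (norm a - norm b)\<^sup>2 + (norm a - norm c)\<^sup>2 + (norm b - norm c)\<^sup>2" by simp
  ultimately show ?thesis by (simp add: power2_eq_square algebra_simps)
qed

text \<open>
Jensen's inequality: the difference between the mean square and the square of the mean is a variance.  In the
expectation setting the bounded variance at two points makes the difference square integrable.
\<close>

lemma norm_mean_op_diff_le:
  assumes Q: "admissible_setting Q"
  shows "(norm (mean_op Q x - mean_op Q y))\<^sup>2 \<le> mean_sq_diff Q x y"
proof (cases Q)
  case (Finite_Sum n Fi)
  define d where "d = (\<lambda>i. Fi i x - Fi i y)"
  define m where "m = (1 / real n) *\<^sub>R (\<Sum>i=1..n. d i)"
  have n: "n \<ge> 1" using Q Finite_Sum by simp
  have sum_d: "(\<Sum>i=1..n. d i) = real n *\<^sub>R m" using n by (simp add: m_def)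
  have "0 \<le> (\<Sum>i=1..n. (norm (d i - m))\<^sup>2)" by (intro sum_nonneg) auto
  also have "\<dots> = (\<Sum>i=1..n. (norm (d i))\<^sup>2 + (norm m)\<^sup>2 - 2 * inner m (d i))"
    by (intro sum.cong refl) (simp add: power2_norm_eq_inner inner_diff inner_commute)
  also have "\<dots> = (\<Sum>i=1..n. (norm (d i))\<^sup>2) + real n * (norm m)\<^sup>2 - 2 * inner m (\<Sum>i=1..n. d i)"
    by (simp add: sum.distrib sum_subtractf inner_sum_right sum_distrib_left)
  also have "\<dots> = (\<Sum>i=1..n. (norm (d i))\<^sup>2) - real n * (norm m)\<^sup>2"
    unfolding sum_d by (simp add: power2_norm_eq_inner)
  finally have "(norm m)\<^sup>2 \<le> (1 / real n) * (\<Sum>i=1..n. (norm (d i))\<^sup>2)"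
    using n by (simp add: field_simps)
  then show ?thesis
    by (simp add: Finite_Sum m_def d_def sum_subtractf scaleR_diff_right)
next
  case (Expectation P bF)
  define m where "m = (\<lambda>x. mean_op Q x)"
  define d where "d = (\<lambda>\<xi>. bF x \<xi> - bF y \<xi>)"
  interpret prob_space P using Q Expectation by simp
  have int: "integrable P (bF x)" for x using Q Expectation by simp
  have var: "integrable P (\<lambda>\<xi>. (norm (bF x \<xi> - m x))\<^sup>2)" for x
    using Q Expectation by (auto simp: m_def)
  have meas [measurable]: "bF x \<in> borel_measurable P" for x using int by auto
  have d_sq: "integrable P (\<lambda>\<xi>. (norm (d \<xi>))\<^sup>2)"
  proof (rule Bochner_Integration.integrable_bound)
    show "integrable P (\<lambda>\<xi>. 3 * (norm (bF x \<xi> - m x))\<^sup>2 + 3 * (norm (m x - m y))\<^sup>2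
        + 3 * (norm (bF y \<xi> - m y))\<^sup>2)"
      using var by auto
    have "(norm (d \<xi>))\<^sup>2 \<le> 3 * (norm (bF x \<xi> - m x))\<^sup>2 + 3 * (norm (m x - m y))\<^sup>2
        + 3 * (norm (bF y \<xi> - m y))\<^sup>2" for \<xi>
      using norm_add3_sq_le[of "bF x \<xi> - m x" "m x - m y" "m y - bF y \<xi>"]
      by (simp add: d_def norm_minus_commute)
    then show "AE \<xi> in P. norm ((norm (d \<xi>))\<^sup>2) \<le> norm (3 * (norm (bF x \<xi> - m x))\<^sup>2
        + 3 * (norm (m x - m y))\<^sup>2 + 3 * (norm (bF y \<xi> - m y))\<^sup>2)"
      by auto
  qed (simp add: d_def)
  have d_int: "integrable P d" using int by (auto simp: d_def)
  have md: "m x - m y = (\<integral>\<xi>. d \<xi> \<partial>P)"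
    using int by (simp add: m_def d_def Expectation)
  have "0 \<le> (\<integral>\<xi>. (norm (d \<xi> - (m x - m y)))\<^sup>2 \<partial>P)" by simp
  also have "\<dots> = (\<integral>\<xi>. (norm (d \<xi>))\<^sup>2 + (norm (m x - m y))\<^sup>2 - 2 * inner (m x - m y) (d \<xi>) \<partial>P)"
    by (intro Bochner_Integration.integral_cong refl)
      (simp add: power2_norm_eq_inner inner_diff inner_commute algebra_simps)
  also have "\<dots> = (\<integral>\<xi>. (norm (d \<xi>))\<^sup>2 \<partial>P) + (norm (m x - m y))\<^sup>2 - 2 * inner (m x - m y) (\<integral>\<xi>. d \<xi> \<partial>P)"
    using d_sq d_int by (simp add: prob_space)
  also have "\<dots> = (\<integral>\<xi>. (norm (d \<xi>))\<^sup>2 \<partial>P) - (norm (m x - m y))\<^sup>2"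
    unfolding md[symmetric] by (simp add: power2_norm_eq_inner)
  finally show ?thesis by (simp add: Expectation m_def d_def)
qed

lemma mean_op_co_coercive:
  assumes Q: "admissible_setting Q" and co: "mean_co_coercive L Q" and L: "L > 0"
  shows "(norm (mean_op Q x - mean_op Q y))\<^sup>2 \<le> L * inner (mean_op Q x - mean_op Q y) (x - y)"
    and "mean_sq_diff Q x y \<le> L * inner (mean_op Q x - mean_op Q y) (x - y)"
proof -
  have "mean_sq_diff Q x y / L \<le> inner (mean_op Q x - mean_op Q y) (x - y)"
    using co by (simp add: mean_co_coercive_def)
  then show "mean_sq_diff Q x y \<le> L * inner (mean_op Q x - mean_op Q y) (x - y)"
    using L by (simp add: field_simps)
  with norm_mean_op_diff_le[OF Q, of x y]
  show "(norm (mean_op Q x - mean_op Q y))\<^sup>2 \<le> L * inner (mean_op Q x - mean_op Q y) (x - y)"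
    by linarith
qed

lemma co_coercive_imp_lipschitz:
  fixes F :: "'v::real_inner \<Rightarrow> 'v"
  assumes co: "\<And>x y. (norm (F x - F y))\<^sup>2 \<le> L * inner (F x - F y) (x - y)" and L: "L > 0"
  shows "norm (F x - F y) \<le> L * norm (x - y)"
proof (cases "norm (F x - F y) = 0")
  case False
  have "(norm (F x - F y))\<^sup>2 \<le> L * (norm (F x - F y) * norm (x - y))"
    using co[of x y] norm_cauchy_schwarz[of "F x - F y" "x - y"] L
    by (meson less_imp_le mult_left_mono order_trans)
  with False show ?thesis
    by (simp add: power2_eq_square)
qed (use L in auto)

lemma young_quadratic:
  fixes a b c :: real
  assumes "0 < b" "c\<^sup>2 \<le> 4 * a * b"
  shows "c * s * t \<le> a * s\<^sup>2 + b * t\<^sup>2"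
proof -
  have "0 \<le> (c * s - 2 * b * t)\<^sup>2" by simp
  then have "4 * b * (c * s * t) \<le> c\<^sup>2 * s\<^sup>2 + 4 * b\<^sup>2 * t\<^sup>2"
    by (simp add: power2_eq_square algebra_simps)
  also have "\<dots> \<le> (4 * a * b) * s\<^sup>2 + 4 * b\<^sup>2 * t\<^sup>2"
    using assms by (intro add_right_mono mult_right_mono) auto
  also have "\<dots> = 4 * b * (a * s\<^sup>2 + b * t\<^sup>2)" by (simp add: power2_eq_square algebra_simps)
  finally show ?thesis using assms by simp
qed

lemma young_inner:
  fixes u v :: "'v::real_inner"
  assumes "0 < b" "c\<^sup>2 \<le> 4 * a * b"
  shows "c * inner u v \<le> a * (norm u)\<^sup>2 + b * (norm v)\<^sup>2"
proof -
  have "c * inner u v \<le> \<bar>c\<bar> * \<bar>inner u v\<bar>" by (metis abs_ge_self abs_mult)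
  also have "\<dots> \<le> \<bar>c\<bar> * norm u * norm v"
    using mult_left_mono[OF Cauchy_Schwarz_ineq2, of "\<bar>c\<bar>" u v] by (simp add: mult.assoc)
  also have "\<dots> \<le> a * (norm u)\<^sup>2 + b * (norm v)\<^sup>2"
    by (rule young_quadratic) (use assms in auto)
  finally show ?thesis .
qed

text \<open>
Evaluate co-hypomonotonicity at the resolvent values \<open>x - l G x\<close>, where \<open>G x - F x\<close> is the
corresponding element of \<open>T\<close>.  The indefinite product of \<open>G x - G y\<close> and \<open>F x - F y\<close> is absorbed by the share
\<open>1/L' - \<rho>\<close> of the co-coercivity of \<open>F\<close>; completing the square there produces the constant \<open>bb\<close>.
\<close>

lemma fb_residual_co_coercive:
  fixes T :: "'v::euclidean_space \<Rightarrow> 'v set"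
  assumes T: "maximally_co_hypomonotone \<rho> T" and l: "0 < l" "\<rho> < l" "2 * \<rho> \<le> l"
    and F: "\<And>x y. (norm (F x - F y))\<^sup>2 \<le> L * inner (F x - F y) (x - y)"
    and L: "0 < L" "L < L'" "L' * \<rho> < 1"
    and bb: "bb = (l * (4 - L' * l) - 4 * \<rho>) / (4 * (1 - \<rho> * L'))"
    and Lam: "Lam = (L' - L) / (L * L')"
    and G: "G = fb_residual l F T"
  shows "bb * (norm (G x - G y))\<^sup>2 + Lam * (L * inner (F x - F y) (x - y))
    \<le> inner (G x - G y) (x - y)"
proof -
  define u where "u = (\<lambda>x. the_elem (resolvent l T (x - l *\<^sub>R F x)))"
  have u_eq: "u x = x - l *\<^sub>R G x" for x
    using l by (simp add: u_def G fb_residual_def fb_step_def)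
  have GT: "G x - F x \<in> T (u x)" for x
  proof -
    have "u x \<in> resolvent l T (x - l *\<^sub>R F x)"
      using resolvent_singleton[OF T l] by (auto simp: u_def)
    then obtain v where v: "v \<in> T (u x)" "x - l *\<^sub>R F x = u x + l *\<^sub>R v"
      by (auto simp: resolvent_def)
    from v(2) have "l *\<^sub>R v = l *\<^sub>R (G x - F x)" by (simp add: u_eq algebra_simps)
    then show ?thesis using v(1) l by simp
  qed
  define dF dG dx where "dF = F x - F y" and "dG = G x - G y" and "dx = x - y"
  define ip where "ip = inner dF dx"
  have "- \<rho> * (norm ((G x - F x) - (G y - F y)))\<^sup>2
      \<le> inner ((G x - F x) - (G y - F y)) (u x - u y)"
    using T GT unfolding maximally_co_hypomonotone_def co_hypomonotone_def graph_op_def by blast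
  moreover have "(G x - F x) - (G y - F y) = dG - dF" "u x - u y = dx - l *\<^sub>R dG"
    by (simp_all add: dF_def dG_def dx_def u_eq algebra_simps)
  ultimately have "- \<rho> * (norm (dG - dF))\<^sup>2 \<le> inner (dG - dF) (dx - l *\<^sub>R dG)" by simp
  then have 1: "ip + (l - \<rho>) * (norm dG)\<^sup>2 - (l - 2 * \<rho>) * inner dG dF - \<rho> * (norm dF)\<^sup>2
      \<le> inner dG dx"
    unfolding ip_def power2_norm_eq_inner
    by (simp add: inner_diff inner_commute algebra_simps)
  have "0 < L'" using L by simp
  define c where "c = 1 / L' - \<rho>"
  have c: "c > 0" using L \<open>0 < L'\<close> by (simp add: c_def field_simps)
  define a where "a = (l - 2 * \<rho>)\<^sup>2 / (4 * c)"
  have 2: "(l - 2 * \<rho>) * inner dG dF \<le> a * (norm dG)\<^sup>2 + c * (norm dF)\<^sup>2"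
    by (rule young_inner) (use c in \<open>auto simp: a_def\<close>)
  have c_eq: "1 - \<rho> * L' = L' * c" using \<open>0 < L'\<close> by (simp add: c_def field_simps)
  have bb': "bb = l - \<rho> - a"
  proof -
    have "l * (4 - L' * l) - 4 * \<rho> = 4 * (l - \<rho>) * (1 - \<rho> * L') - L' * (l - 2 * \<rho>)\<^sup>2"
      by (simp add: power2_eq_square algebra_simps)
    then have "bb = (4 * (l - \<rho>) * (L' * c) - L' * (l - 2 * \<rho>)\<^sup>2) / (4 * (L' * c))"
      unfolding bb c_eq[symmetric] by simp
    also have "\<dots> = l - \<rho> - a" using c \<open>0 < L'\<close> by (simp add: a_def field_simps)
    finally show ?thesis .
  qed
  have "(1 / L') * (norm dF)\<^sup>2 + Lam * (L * ip) \<le> ip"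
  proof -
    have "Lam * L = 1 - L / L'" using L \<open>0 < L'\<close> by (simp add: Lam field_simps)
    then have "Lam * (L * ip) = (1 - L / L') * ip" by (simp add: mult.assoc[symmetric])
    moreover have "(norm dF)\<^sup>2 / L' \<le> L * ip / L'"
      using F[of x y] \<open>0 < L'\<close> by (intro divide_right_mono) (auto simp: ip_def dF_def dx_def)
    ultimately show ?thesis by (simp add: algebra_simps)
  qed
  with 1 2 have "bb * (norm dG)\<^sup>2 + Lam * (L * ip) \<le> inner dG dx"
    unfolding bb' c_def by (simp add: algebra_simps)
  then show ?thesis by (simp add: ip_def dG_def dF_def dx_def)
qed

lemma fb_residual_zero:
  fixes T :: "'v::euclidean_space \<Rightarrow> 'v set"
  assumes T: "maximally_co_hypomonotone \<rho> T" and l: "0 < l" "\<rho> < l" "2 * \<rho> \<le> l"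
    and xs: "xs \<in> zer_op (sum_op F T)"
  shows "fb_residual l F T xs = 0"
proof -
  obtain u where "u \<in> T xs" "F xs + u = 0"
    using xs by (auto simp: zer_op_def sum_op_def)
  then have "- F xs \<in> T xs" by (metis add.inverse_unique)
  then have "xs \<in> resolvent l T (xs - l *\<^sub>R F xs)"
    unfolding resolvent_def by force
  then have "the_elem (resolvent l T (xs - l *\<^sub>R F xs)) = xs"
    using resolvent_singleton[OF T l, of "xs - l *\<^sub>R F xs"] by (metis singletonD)
  then show ?thesis by (simp add: fb_residual_def fb_step_def)
qed

lemma fb_step_lipschitz:
  fixes T :: "'v::euclidean_space \<Rightarrow> 'v set"
  assumes T: "maximally_co_hypomonotone \<rho> T" and l: "0 < l" "\<rho> < l" "2 * \<rho> \<le> l"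
  shows "norm (fb_step l T x v - fb_step l T x v') \<le> norm (v - v')"
proof -
  define J where "J = (\<lambda>a. the_elem (resolvent l T a))"
  have "norm (J (x - l *\<^sub>R v') - J (x - l *\<^sub>R v)) \<le> norm ((x - l *\<^sub>R v') - (x - l *\<^sub>R v))"
    using T resolvent_singleton[OF T l]
    by (intro resolvent_nonexpansive[OF _ l(1,3)])
      (auto simp: J_def maximally_co_hypomonotone_def)
  also have "\<dots> = l * norm (v - v')"
  proof -
    have "(x - l *\<^sub>R v') - (x - l *\<^sub>R v) = l *\<^sub>R (v - v')" by (simp add: algebra_simps)
    then show ?thesis using l by simp
  qed
  finally have "norm (J (x - l *\<^sub>R v') - J (x - l *\<^sub>R v)) / l \<le> norm (v - v')"
    using l by (simp add: field_simps)
  moreover have "fb_step l T x v - fb_step l T x v' =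
      (1 / l) *\<^sub>R (J (x - l *\<^sub>R v') - J (x - l *\<^sub>R v))"
    by (simp add: fb_step_def J_def algebra_simps)
  ultimately show ?thesis using l by simp
qed

lemma fb_step_measurable:
  fixes T :: "'v::euclidean_space \<Rightarrow> 'v set"
  assumes T: "maximally_co_hypomonotone \<rho> T" and l: "0 < l" "\<rho> < l" "2 * \<rho> \<le> l"
    and [measurable]: "X \<in> borel_measurable M" "V \<in> borel_measurable M"
  shows "(\<lambda>\<omega>. fb_step l T (X \<omega>) (V \<omega>)) \<in> borel_measurable M"
proof -
  have "norm (the_elem (resolvent l T a) - the_elem (resolvent l T b)) \<le> norm (a - b)" for a b
    using T resolvent_singleton[OF T l]
    by (intro resolvent_nonexpansive[OF _ l(1,3)]) (auto simp: maximally_co_hypomonotone_def)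
  then have "1-lipschitz_on UNIV (\<lambda>a. the_elem (resolvent l T a))"
    by (intro lipschitz_onI) (auto simp: dist_norm)
  then have "continuous_on UNIV (\<lambda>a. the_elem (resolvent l T a))"
    by (rule lipschitz_on_continuous_on)
  then have [measurable]: "(\<lambda>a. the_elem (resolvent l T a)) \<in> borel_measurable borel"
    by (rule borel_measurable_continuous_onI)
  show ?thesis unfolding fb_step_def by measurable
qed

section \<open>Pathwise inequalities of one iteration\<close>

text \<open>
The core of the acceleration.  With \<open>\<delta>\<close> the displacement of the iterate, the choice of \<open>\<eta>\<close> yields
\<open>(t - 1) \<delta> = p' - 2 \<beta> (t - 1) (g + e)\<close>, which is used for the product with the new residual \<open>g'\<close>, while
\<open>\<delta> = p / t - \<eta> (g + e)\<close> is used for the product with \<open>g\<close>.  The surplus of \<open>bb\<close> over \<open>\<beta>\<close> pays for separating the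
noise \<open>e\<close> from \<open>g' - g\<close>.
\<close>

lemma residual_gap_step:
  fixes g g' e p :: "'v::real_inner"
  assumes t: "1 < t" and \<mu>: "0 < \<mu>" "\<mu> < 2 / 3" and \<beta>: "0 < \<beta>"
    and \<nu>: "\<nu> = \<mu> / 2" and \<eta>: "\<eta> = 2 * \<beta> * (t - 1) / (t - \<nu>)"
    and bb: "\<beta> * ((2 + \<mu>) / (2 - \<mu>)) \<le> bb"
    and p': "p' = (1 - 1 / t) *\<^sub>R p + ((1 - \<nu>) * \<eta>) *\<^sub>R (g + e)"
    and co: "bb * (norm (g' - g))\<^sup>2 + D \<le> inner (g' - g) ((1 / t) *\<^sub>R p - \<eta> *\<^sub>R (g + e))"
  shows "\<beta> * (t * (t - 1)) * (norm g')\<^sup>2 - t * inner g' p' \<le> - (t - 1) * inner g p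
    + t * (t - 1) * ((\<eta> - \<beta>) * (norm g)\<^sup>2 - (2 * \<beta> - \<eta>) * inner g e
        + \<beta> * (1 / \<mu> - 1 / 2) * (norm e)\<^sup>2 - D)"
proof -
  define \<delta> where "\<delta> = (1 / t) *\<^sub>R p - \<eta> *\<^sub>R (g + e)"
  define S where "S = t * (t - 1)"
  have S: "S > 0" using t by (simp add: S_def)
  have t\<nu>: "t - \<nu> > 0" using t \<mu> \<nu> by simp
  have \<eta>': "\<eta> * (t - \<nu>) = 2 * \<beta> * (t - 1)" using t\<nu> by (simp add: \<eta>)
  have "(t - 1) *\<^sub>R \<delta> = ((t - 1) / t) *\<^sub>R p - (\<eta> * (t - 1)) *\<^sub>R (g + e)"
    by (simp add: \<delta>_def algebra_simps)
  also have "\<eta> * (t - 1) = 2 * \<beta> * (t - 1) - (1 - \<nu>) * \<eta>"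
    unfolding \<eta>'[symmetric] by (simp add: algebra_simps)
  also have "((t - 1) / t) *\<^sub>R p - (2 * \<beta> * (t - 1) - (1 - \<nu>) * \<eta>) *\<^sub>R (g + e)
      = p' - (2 * \<beta> * (t - 1)) *\<^sub>R (g + e)"
    unfolding p' using t by (simp add: scaleR_diff_left diff_divide_distrib algebra_simps)
  finally have \<delta>': "(t - 1) *\<^sub>R \<delta> = p' - (2 * \<beta> * (t - 1)) *\<^sub>R (g + e)" .
  have "S * inner g' \<delta> = t * inner g' ((t - 1) *\<^sub>R \<delta>)" by (simp add: S_def)
  also have "\<dots> = t * inner g' p' - 2 * \<beta> * S * inner g' (g + e)"
    unfolding \<delta>' by (simp add: S_def inner_diff_right algebra_simps)
  finally have 1: "S * inner g' \<delta> = t * inner g' p' - \<beta> * S * (2 * inner g' (g + e))" by simp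
  have 2: "S * inner g \<delta> = (t - 1) * inner g p - S * \<eta> * ((norm g)\<^sup>2 + inner g e)"
    using t by (simp add: S_def \<delta>_def inner_diff_right inner_add_right power2_norm_eq_inner
        field_simps)
  have 3: "2 * inner g' (g + e) = (norm g')\<^sup>2 + (norm g)\<^sup>2 + 2 * inner g e + (norm e)\<^sup>2
      - (norm (g' - g))\<^sup>2 + 2 * inner (g' - g) e - (norm e)\<^sup>2"
    by (simp add: power2_norm_eq_inner inner_diff inner_add inner_commute algebra_simps)
  have "- 2 * inner (g' - g) e \<le> (2 * \<mu> / (2 - \<mu>)) * (norm (g' - g))\<^sup>2
      + (1 / \<mu> - 1 / 2) * (norm e)\<^sup>2"
    by (rule young_inner) (use \<mu> in \<open>auto simp: field_simps\<close>)
  then have "(norm (g' - g))\<^sup>2 - 2 * inner (g' - g) e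
      \<le> (1 + 2 * \<mu> / (2 - \<mu>)) * (norm (g' - g))\<^sup>2 + (1 / \<mu> - 1 / 2) * (norm e)\<^sup>2"
    by (simp add: algebra_simps)
  also have "1 + 2 * \<mu> / (2 - \<mu>) = (2 + \<mu>) / (2 - \<mu>)" using \<mu> by (simp add: field_simps)
  finally have "\<beta> * ((norm (g' - g))\<^sup>2 - 2 * inner (g' - g) e)
      \<le> \<beta> * ((2 + \<mu>) / (2 - \<mu>) * (norm (g' - g))\<^sup>2 + (1 / \<mu> - 1 / 2) * (norm e)\<^sup>2)"
    using \<beta> by (intro mult_left_mono) auto
  also have "\<dots> \<le> bb * (norm (g' - g))\<^sup>2 + \<beta> * (1 / \<mu> - 1 / 2) * (norm e)\<^sup>2"
    using mult_right_mono[OF bb, of "(norm (g' - g))\<^sup>2"] by (simp add: algebra_simps)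
  finally have 4: "\<beta> * ((norm (g' - g))\<^sup>2 - 2 * inner (g' - g) e)
      \<le> bb * (norm (g' - g))\<^sup>2 + \<beta> * (1 / \<mu> - 1 / 2) * (norm e)\<^sup>2" .
  have 5: "S * (bb * (norm (g' - g))\<^sup>2 + D) \<le> S * inner g' \<delta> - S * inner g \<delta>"
    using mult_left_mono[OF co, of S] S by (simp add: \<delta>_def inner_diff algebra_simps)
  have "S * (\<beta> * (2 * inner g' (g + e))) \<ge> S * (\<beta> * ((norm g')\<^sup>2 + (norm g)\<^sup>2 + 2 * inner g e)
      - bb * (norm (g' - g))\<^sup>2 - \<beta> * (1 / \<mu> - 1 / 2) * (norm e)\<^sup>2)"
    using 4 S unfolding 3 by (intro mult_left_mono) (auto simp: algebra_simps)
  with 1 2 5 show ?thesis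
    unfolding S_def[symmetric] by (simp add: algebra_simps)
qed

text \<open>
The weight of \<open>|p'|\<^sup>2\<close> is the one for which the cross term with \<open>g\<close> has coefficient exactly \<open>\<mu>\<close>.
\<close>

lemma anchor_gap_step:
  fixes g e p :: "'v::real_inner"
  assumes t: "1 < t" and \<beta>: "0 < \<beta>" and \<nu>: "\<nu> < 1"
    and \<eta>: "\<eta> = 2 * \<beta> * (t - 1) / (t - \<nu>)"
    and p': "p' = (1 - 1 / t) *\<^sub>R p + ((1 - \<nu>) * \<eta>) *\<^sub>R (g + e)"
  shows "\<mu> * (t * (t - \<nu>)) / (4 * \<beta> * (1 - \<nu>) * (t - 1)\<^sup>2) * (norm p')\<^sup>2 =
    \<mu> * (t - \<nu>) / (4 * \<beta> * (1 - \<nu>) * t) * (norm p)\<^sup>2 + \<mu> * (inner g p + inner e p)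
    + \<mu> * (1 - \<nu>) * \<beta> * t / (t - \<nu>) * ((norm g)\<^sup>2 + 2 * inner g e + (norm e)\<^sup>2)"
proof -
  define D where "D = \<mu> * (t * (t - \<nu>)) / (4 * \<beta> * (1 - \<nu>) * (t - 1)\<^sup>2)"
  have nz: "t \<noteq> 0" "t - \<nu> \<noteq> 0" "t - 1 \<noteq> 0" "\<beta> \<noteq> 0" "1 - \<nu> \<noteq> 0" using t \<nu> \<beta> by auto
  have s: "1 - 1 / t = (t - 1) / t" using nz by (simp add: field_simps)
  have 1: "D * (1 - 1 / t)\<^sup>2 = \<mu> * (t - \<nu>) / (4 * \<beta> * (1 - \<nu>) * t)"
    unfolding D_def s using nz by (simp add: divide_simps power2_eq_square)
  have 2: "D * (2 * (1 - 1 / t) * ((1 - \<nu>) * \<eta>)) = \<mu>"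
    unfolding D_def s \<eta> using nz
    by (simp add: divide_simps power2_eq_square) (simp add: algebra_simps)
  have 3: "D * ((1 - \<nu>) * \<eta>)\<^sup>2 = \<mu> * (1 - \<nu>) * \<beta> * t / (t - \<nu>)"
    unfolding D_def \<eta> using nz by (simp add: divide_simps power2_eq_square)
  have sq: "(norm (a *\<^sub>R p + b *\<^sub>R (g + e)))\<^sup>2 =
      a\<^sup>2 * (norm p)\<^sup>2 + 2 * a * b * inner (g + e) p + b\<^sup>2 * (norm (g + e))\<^sup>2" for a b
    unfolding power2_norm_eq_inner
    by (simp only: inner_add_left inner_add_right inner_scaleR_left inner_scaleR_right)
      (simp add: inner_commute algebra_simps power2_eq_square)
  have "D * (norm p')\<^sup>2 = (D * (1 - 1 / t)\<^sup>2) * (norm p)\<^sup>2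
      + (D * (2 * (1 - 1 / t) * ((1 - \<nu>) * \<eta>))) * inner (g + e) p
      + (D * ((1 - \<nu>) * \<eta>)\<^sup>2) * (norm (g + e))\<^sup>2"
    unfolding p' sq[of "1 - 1 / t" "(1 - \<nu>) * \<eta>"] by (simp only: distrib_left mult.assoc)
  also have "(norm (g + e))\<^sup>2 = (norm g)\<^sup>2 + 2 * inner g e + (norm e)\<^sup>2"
    by (simp add: power2_norm_eq_inner inner_add inner_commute)
  finally show ?thesis unfolding 1 2 3 by (simp add: D_def inner_add_left)
qed

text \<open>
The weight \<open>1 / (\<mu> \<eta>)\<close> gives the product of \<open>g\<close> and \<open>Z\<close> the coefficient one.  Pairing \<open>e\<close> with the new
vector \<open>Z'\<close> instead of \<open>Z\<close> cancels the products of \<open>g\<close> and \<open>e\<close>.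
\<close>

lemma anchor_distance_step:
  fixes g e Z :: "'v::real_inner"
  assumes \<mu>: "0 < \<mu>" and \<eta>: "0 < \<eta>" and \<nu>: "\<nu> = \<mu> / 2"
    and Z': "Z' = Z - (\<nu> * \<eta>) *\<^sub>R (g + e)"
  shows "1 / (\<mu> * \<eta>) * (norm Z')\<^sup>2 = 1 / (\<mu> * \<eta>) * (norm Z)\<^sup>2
    - inner g Z - inner e Z' + \<nu> * \<eta> / 2 * ((norm g)\<^sup>2 - (norm e)\<^sup>2)"
proof -
  define K where "K = 1 / (\<mu> * \<eta>)"
  have c: "K * (\<nu> * \<eta>) = 1 / 2" using \<mu> \<eta> by (simp add: K_def \<nu>)
  have "K * (norm Z')\<^sup>2 = K * (norm Z)\<^sup>2 - 2 * (K * (\<nu> * \<eta>)) * inner (g + e) Z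
      + (K * (\<nu> * \<eta>)) * (\<nu> * \<eta>) * (norm (g + e))\<^sup>2"
    unfolding Z' power2_norm_eq_inner
    by (simp only: inner_diff_left inner_diff_right inner_scaleR_left inner_scaleR_right)
      (simp add: inner_commute algebra_simps)
  also have "\<dots> = K * (norm Z)\<^sup>2 - inner g Z - inner e Z' + \<nu> * \<eta> / 2 * ((norm g)\<^sup>2 - (norm e)\<^sup>2)"
    unfolding c Z' power2_norm_eq_inner
    by (simp add: inner_add inner_diff_right inner_commute field_simps)
  finally show ?thesis unfolding K_def .
qed

text \<open>
The balance of the coefficients of \<open>|g|\<^sup>2\<close>.  After multiplication with \<open>(t - \<nu>) / \<beta>\<close>, the difference of the
leading terms is \<open>- (2 - 3 \<mu>) t\<^sup>2\<close>, which is where \<open>\<mu> < 2/3\<close> is needed.  Of it, the part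
\<open>- (2 - 3 \<mu>) t (t - 1 - 2 \<mu>)\<close>, zero at the smallest possible \<open>t\<close>, is kept as dissipation, and the rest
compensates the lower-order terms.  The extra \<open>\<beta>\<close> on the left is reserved for the product of \<open>g\<close> and \<open>e\<close>.
\<close>

lemma residual_weight_bound:
  fixes t \<mu> \<beta> :: real
  assumes \<mu>: "0 < \<mu>" "\<mu> < 2 / 3" and t: "1 + 2 * \<mu> \<le> t" and \<beta>: "0 < \<beta>"
    and \<nu>: "\<nu> = \<mu> / 2" and \<eta>: "\<eta> = 2 * \<beta> * (t - 1) / (t - \<nu>)"
  shows "t * (t - 1) * (\<eta> - \<beta>) + \<mu> * (1 - \<nu>) * \<beta> * t / (t - \<nu>) + \<nu> * \<eta> / 2
      + \<beta> * (2 - 3 * \<mu>) * (t * (t - 1 - 2 * \<mu>)) / (t - \<nu>) + \<beta>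
    \<le> \<beta> * ((t - \<mu>) * (t - \<mu> - 1)) + \<beta> * ((2 + \<mu>) / (2 - \<mu>))"
proof -
  have t\<nu>: "t - \<nu> > 0" using t \<mu> \<nu> by simp
  have "1 * (5 / 2 - 3 * \<mu>) \<le> t * (5 / 2 - 3 * \<mu>)" using \<mu> t by (intro mult_right_mono) auto
  moreover have "(1 / 2) * (1 + 2 * \<mu>) \<le> (5 / 2 - 3 * \<mu>) * t" using \<mu> t by (intro mult_mono) auto
  moreover have "\<mu> * \<mu> \<le> 1 * 1" using \<mu> by (intro mult_mono) auto
  ultimately have "t * (- 3 / 2 + 7 / 2 * \<mu>) + (\<mu> * \<mu> + \<mu> - 1) / 2 \<le> (1 + \<mu> / 2) * (t - \<nu>)"
    unfolding \<nu> by (simp add: field_simps)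
  also have "\<dots> \<le> (2 / (2 - \<mu>)) * (t - \<nu>)"
    using t\<nu> \<mu> by (intro mult_right_mono) (auto simp: field_simps)
  finally have "\<mu> * (t * (- 3 / 2 + 7 / 2 * \<mu>) + (\<mu> * \<mu> + \<mu> - 1) / 2) \<le> \<mu> * ((2 / (2 - \<mu>)) * (t - \<nu>))"
    using \<mu> by (intro mult_left_mono) auto
  also have "\<dots> = ((2 + \<mu>) / (2 - \<mu>) - 1) * (t - \<nu>)" using \<mu> by (simp add: field_simps)
  finally have *: "\<mu> * (t * (- 3 / 2 + 7 / 2 * \<mu>) + (\<mu> * \<mu> + \<mu> - 1) / 2)
      \<le> ((2 + \<mu>) / (2 - \<mu>) - 1) * (t - \<nu>)" .
  define b where "b = (2 + \<mu>) / (2 - \<mu>)"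
  have \<eta>\<beta>: "\<eta> - \<beta> = \<beta> * (t - 2 + \<nu>) / (t - \<nu>)" using t\<nu> by (simp add: \<eta> field_simps)
  have \<eta>\<nu>: "\<nu> * \<eta> / 2 = \<beta> * (\<nu> * (t - 1)) / (t - \<nu>)"
    using t\<nu> by (simp add: \<eta> divide_simps)
  have "t * (t - 1) * (\<eta> - \<beta>) + \<mu> * (1 - \<nu>) * \<beta> * t / (t - \<nu>) + \<nu> * \<eta> / 2
      + \<beta> * (2 - 3 * \<mu>) * (t * (t - 1 - 2 * \<mu>)) / (t - \<nu>) =
      \<beta> * (t * (t - 1) * (t - 2 + \<nu>) + \<mu> * (1 - \<nu>) * t + \<nu> * (t - 1)
        + (2 - 3 * \<mu>) * (t * (t - 1 - 2 * \<mu>))) / (t - \<nu>)"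
    unfolding \<eta>\<beta> \<eta>\<nu> by (simp add: add_divide_distrib diff_divide_distrib algebra_simps)
  also have "\<dots> \<le> \<beta> * (((t - \<mu>) * (t - \<mu> - 1) + b - 1) * (t - \<nu>)) / (t - \<nu>)"
  proof (intro divide_right_mono mult_left_mono)
    have "t * (t - 1) * (t - 2 + \<nu>) + \<mu> * (1 - \<nu>) * t + \<nu> * (t - 1)
        + (2 - 3 * \<mu>) * (t * (t - 1 - 2 * \<mu>)) - (t - \<mu>) * (t - \<mu> - 1) * (t - \<nu>)
      = \<mu> * (t * (- 3 / 2 + 7 / 2 * \<mu>) + (\<mu> * \<mu> + \<mu> - 1) / 2)"
      unfolding \<nu> by (simp add: field_simps)
    with * show "t * (t - 1) * (t - 2 + \<nu>) + \<mu> * (1 - \<nu>) * t + \<nu> * (t - 1)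
        + (2 - 3 * \<mu>) * (t * (t - 1 - 2 * \<mu>)) \<le> ((t - \<mu>) * (t - \<mu> - 1) + b - 1) * (t - \<nu>)"
      unfolding b_def by (simp add: algebra_simps)
  qed (use \<beta> t\<nu> in auto)
  also have "\<dots> = \<beta> * ((t - \<mu>) * (t - \<mu> - 1) + b - 1)"
    using t\<nu> by simp
  also have "\<dots> = \<beta> * ((t - \<mu>) * (t - \<mu> - 1)) + \<beta> * b - \<beta>"
    by (simp add: algebra_simps)
  finally show ?thesis unfolding b_def by simp
qed

lemma gap_weight_bound:
  fixes t \<mu> \<beta> :: real
  assumes \<mu>: "0 < \<mu>" "\<mu> < 2 / 3" and t: "1 + 2 * \<mu> \<le> t" and \<beta>: "0 < \<beta>" and \<nu>: "\<nu> = \<mu> / 2"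
  shows "\<mu> * (t - \<nu>) / (4 * \<beta> * (1 - \<nu>) * t) + \<mu> / (2 * \<beta> * (1 - \<nu>) * t)
    \<le> \<mu> * ((t - \<mu>) * (t - \<mu> - \<nu>)) / (4 * \<beta> * (1 - \<nu>) * (t - \<mu> - 1)\<^sup>2)"
proof -
  define s where "s = t - \<mu> - 1"
  have s: "s > 0" "s < t" "t > 0" using t \<mu> by (auto simp: s_def)
  have \<nu>1: "1 - \<nu> > 0" using \<mu> \<nu> by simp
  have "(t - \<nu> + 2) / t = 1 + (2 - \<nu>) / t" using s by (simp add: field_simps)
  also have "\<dots> \<le> 1 + (2 - \<nu>) / s" using s \<nu>1 by (simp add: frac_le)
  also have "\<dots> \<le> 1 + (2 - \<nu>) / s + (1 - \<nu>) / s\<^sup>2" using s \<nu>1 by simp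
  also have "\<dots> = (s + 1) * (s + 1 - \<nu>) / s\<^sup>2" using s by (simp add: field_simps power2_eq_square)
  finally have *: "(t - \<nu> + 2) / t \<le> (s + 1) * (s + 1 - \<nu>) / s\<^sup>2" .
  have "\<mu> / (4 * \<beta> * (1 - \<nu>)) * ((t - \<nu> + 2) / t)
      \<le> \<mu> / (4 * \<beta> * (1 - \<nu>)) * ((s + 1) * (s + 1 - \<nu>) / s\<^sup>2)"
    using * \<mu> \<beta> \<nu>1 by (intro mult_left_mono) auto
  moreover have "s + 1 = t - \<mu>" "s = t - \<mu> - 1" by (simp_all add: s_def)
  moreover have "\<mu> * (t - \<nu>) / (4 * \<beta> * (1 - \<nu>) * t) + \<mu> / (2 * \<beta> * (1 - \<nu>) * t)
      = \<mu> / (4 * \<beta> * (1 - \<nu>)) * ((t - \<nu> + 2) / t)"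
    using s \<beta> \<nu>1 by (simp add: divide_simps) (simp add: algebra_simps)
  ultimately show ?thesis by simp
qed

text \<open>
The argument \<open>s\<close> is the parameter \<open>t\<close> of the preceding iteration, so \<open>s + \<mu>\<close> is the current one; the vectors
are \<open>G x\<close>, \<open>z - x\<close> and \<open>z - x\<^sup>\<star>\<close>.  The last coefficient is \<open>1 / (\<mu> \<eta>)\<close> for the current \<open>\<eta>\<close>.
\<close>

definition potential :: "real \<Rightarrow> real \<Rightarrow> real \<Rightarrow> 'v::real_inner \<Rightarrow> 'v \<Rightarrow> 'v \<Rightarrow> real" where
  "potential \<mu> \<beta> s g p Z =
     \<beta> * (s * (s - 1)) * (norm g)\<^sup>2 - s * inner g p
     + \<mu> * (s * (s - \<mu> / 2)) / (4 * \<beta> * (1 - \<mu> / 2) * (s - 1)\<^sup>2) * (norm p)\<^sup>2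
     + (s + \<mu> - \<mu> / 2) / (2 * \<beta> * \<mu> * (s + \<mu> - 1)) * (norm Z)\<^sup>2"

text \<open>
The products of \<open>g\<close> and \<open>p\<close> cancel: the telescoping part leaves \<open>1 - \<mu>\<close> of them, the
distance to the solution contributes \<open>-1\<close> and the term in \<open>|p|\<^sup>2\<close> contributes \<open>\<mu>\<close>.  Each
remaining product with the noise \<open>e\<close> is then split by Young's inequality, against the reserved multiple of \<open>|g|\<^sup>2\<close>, half of the
dissipation of \<open>|p|\<^sup>2\<close>, and the decrease of the weight of \<open>|Z'|\<^sup>2\<close>; the resulting multiples of
\<open>\<beta> t (t - 1) |e|\<^sup>2\<close> add up to \<open>1/\<mu> + 9/4\<close>, which is below \<open>5 / (2 \<mu>)\<close> exactly for \<open>\<mu> < 2/3\<close>.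
\<close>

lemma potential_step:
  fixes g g' e p Z :: "'v::real_inner"
  assumes \<mu>: "0 < \<mu>" "\<mu> < 2 / 3" and t: "1 + 2 * \<mu> \<le> t" and \<beta>: "0 < \<beta>"
    and \<nu>: "\<nu> = \<mu> / 2" and \<eta>: "\<eta> = 2 * \<beta> * (t - 1) / (t - \<nu>)"
    and bb: "\<beta> * ((2 + \<mu>) / (2 - \<mu>)) \<le> bb"
    and p': "p' = (1 - 1 / t) *\<^sub>R p + ((1 - \<nu>) * \<eta>) *\<^sub>R (g + e)"
    and Z': "Z' = Z - (\<nu> * \<eta>) *\<^sub>R (g + e)"
    and co: "bb * (norm (g' - g))\<^sup>2 + D \<le> inner (g' - g) ((1 / t) *\<^sub>R p - \<eta> *\<^sub>R (g + e))"
    and co0: "bb * (norm g)\<^sup>2 \<le> inner g (Z - p)"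
  shows "potential \<mu> \<beta> t g' p' Z' \<le> potential \<mu> \<beta> (t - \<mu>) g p Z - t * (t - 1) * D
    - \<beta> * (2 - 3 * \<mu>) * (t * (t - 1 - 2 * \<mu>)) / (t - \<nu>) * (norm g)\<^sup>2
    - \<mu> / (4 * \<beta> * (1 - \<nu>) * t) * (norm p)\<^sup>2
    + (1 / \<mu> + 9 / 4) * \<beta> * (t * (t - 1)) * (norm e)\<^sup>2"
proof -
  define S where "S = t * (t - 1)"
  have t1: "1 < t" using t \<mu> by simp
  have S: "S > 0" using t1 by (simp add: S_def)
  have \<nu>1: "0 < \<nu>" "\<nu> < 1 / 3" using \<mu> \<nu> by auto
  have t\<nu>: "t - \<nu> > 0" using t1 \<nu>1 by simp
  have \<eta>_pos: "\<eta> > 0" using \<beta> t1 t\<nu> by (simp add: \<eta>)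
  define c where "c = (t - \<nu>) / (2 * \<beta> * \<mu> * (t - 1))"
  define c' where "c' = (t + \<mu> - \<nu>) / (2 * \<beta> * \<mu> * (t + \<mu> - 1))"
  define gg ee pp ge gp ep where "gg = (norm g)\<^sup>2" and "ee = (norm e)\<^sup>2" and "pp = (norm p)\<^sup>2"
    and "ge = inner g e" and "gp = inner g p" and "ep = inner e p"
  have nonneg: "gg \<ge> 0" "ee \<ge> 0" "pp \<ge> 0" by (simp_all add: gg_def ee_def pp_def)
  define w where "w = (1 - \<nu>) * t / (t - \<nu>)"
  have w: "0 \<le> w" "w \<le> 1" using \<nu>1 t1 t\<nu> by (auto simp: w_def field_simps)
  have gap: "\<beta> * S * (norm g')\<^sup>2 - t * inner g' p' \<le> - (t - 1) * gp
      + S * ((\<eta> - \<beta>) * gg - (2 * \<beta> - \<eta>) * ge + \<beta> * (1 / \<mu> - 1 / 2) * ee - D)"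
    using residual_gap_step[OF t1 \<mu> \<beta> \<nu> \<eta> bb p' co] by (simp add: S_def gg_def ge_def gp_def ee_def)
  have anch: "\<mu> * (t * (t - \<nu>)) / (4 * \<beta> * (1 - \<nu>) * (t - 1)\<^sup>2) * (norm p')\<^sup>2 =
      \<mu> * (t - \<nu>) / (4 * \<beta> * (1 - \<nu>) * t) * pp + \<mu> * (gp + ep)
      + \<mu> * \<beta> * w * (gg + 2 * ge + ee)"
    using anchor_gap_step[OF t1 \<beta> _ \<eta> p', of \<mu>] \<nu>1
    by (simp add: gg_def ge_def gp_def ee_def ep_def pp_def w_def mult_ac)
  have c_eq: "c = 1 / (\<mu> * \<eta>)" using \<beta> \<mu> t1 t\<nu> by (simp add: c_def \<eta> field_simps)
  have dist: "c * (norm Z')\<^sup>2 = c * (norm Z)\<^sup>2 - inner g Z - inner e Z' + \<nu> * \<eta> / 2 * (gg - ee)"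
    unfolding c_eq gg_def ee_def by (rule anchor_distance_step[OF \<mu>(1) \<eta>_pos \<nu> Z'])
  have gZ: "gp + \<beta> * ((2 + \<mu>) / (2 - \<mu>)) * gg \<le> inner g Z"
    using co0 mult_right_mono[OF bb nonneg(1)] by (simp add: gg_def gp_def inner_diff_right)
  have gg_w: "S * (\<eta> - \<beta>) + \<mu> * \<beta> * w + \<nu> * \<eta> / 2
      + \<beta> * (2 - 3 * \<mu>) * (t * (t - 1 - 2 * \<mu>)) / (t - \<nu>) + \<beta>
    \<le> \<beta> * ((t - \<mu>) * (t - \<mu> - 1)) + \<beta> * ((2 + \<mu>) / (2 - \<mu>))"
    using residual_weight_bound[OF \<mu> t \<beta> \<nu> \<eta>] by (simp add: S_def w_def mult_ac)
  \<comment> \<open>Bounds for the contributions of \<open>|g|\<^sup>2\<close>, \<open>|p|\<^sup>2\<close> and of the products with \<open>e\<close>\<close>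
  note gg_b = mult_right_mono[OF gg_w nonneg(1)]
  note pp_b = mult_right_mono[OF gap_weight_bound[OF \<mu> t \<beta> \<nu>] nonneg(3)]
  have ge_b: "(- S * (2 * \<beta> - \<eta>) + 2 * (\<mu> * \<beta> * w)) * ge \<le> \<beta> * gg + \<beta> * S * ee"
    unfolding ge_def gg_def ee_def
  proof (rule young_inner)
    have "2 * \<beta> - \<eta> = 2 * \<beta> * (1 - \<nu>) / (t - \<nu>)" using t\<nu> by (simp add: \<eta> field_simps)
    then have "S * (2 * \<beta> - \<eta>) = 2 * \<beta> * (t - 1) * w" by (simp add: S_def w_def)
    then have "- S * (2 * \<beta> - \<eta>) + 2 * (\<mu> * \<beta> * w) = - (2 * \<beta> * ((t - 1 - \<mu>) * w))"
      by (simp add: algebra_simps)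
    moreover have "((t - 1 - \<mu>) * w)\<^sup>2 \<le> S"
    proof -
      have "(t - 1 - \<mu>) * w \<le> (t - 1) * 1" "0 \<le> (t - 1 - \<mu>) * w"
        using w t \<mu> by (intro mult_mono mult_nonneg_nonneg; simp)+
      then have "((t - 1 - \<mu>) * w)\<^sup>2 \<le> (t - 1)\<^sup>2" by (intro power_mono) auto
      also have "\<dots> \<le> S" using t1 by (simp add: S_def power2_eq_square)
      finally show ?thesis .
    qed
    ultimately show "(- S * (2 * \<beta> - \<eta>) + 2 * (\<mu> * \<beta> * w))\<^sup>2 \<le> 4 * \<beta> * (\<beta> * S)"
      using \<beta> by (simp add: power_mult_distrib) (simp add: power2_eq_square)
  qed (use \<beta> S in simp)
  have ep_b: "\<mu> * ep \<le> \<mu> * \<beta> * (1 - \<nu>) * t * ee + \<mu> / (4 * \<beta> * (1 - \<nu>) * t) * pp"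
    unfolding ep_def ee_def pp_def
    by (rule young_inner) (use \<mu> \<beta> \<nu>1 t1 in \<open>auto simp: power2_eq_square\<close>)
  have eZ_b: "- 1 * inner e Z' \<le> 3 / 4 * \<beta> * S * ee + (c - c') * (norm Z')\<^sup>2"
    unfolding ee_def
  proof (rule young_inner)
    have cc: "c - c' = (1 - \<nu>) / (2 * \<beta> * ((t - 1) * (t - 1 + \<mu>)))"
      using \<beta> \<mu> t1 unfolding c_def c'_def by (simp add: divide_simps) (simp add: algebra_simps)
    show "0 < c - c'" unfolding cc using \<beta> \<mu> t1 \<nu>1 by simp
    have "4 * (3 / 4 * \<beta> * S) * (c - c') = 3 / 2 * (1 - \<nu>) * (t / (t - 1 + \<mu>))"
      unfolding cc S_def using \<beta> t1 \<mu> by (simp add: divide_simps)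
    moreover have "1 * 1 \<le> (3 / 2 * (1 - \<nu>)) * (t / (t - 1 + \<mu>))"
      using \<nu>1 t1 \<mu> by (intro mult_mono) (auto simp: field_simps)
    ultimately show "(- 1)\<^sup>2 \<le> 4 * (3 / 4 * \<beta> * S) * (c - c')" by simp
  qed
  have ee_b: "(\<mu> * \<beta> * (1 - \<nu>) * t + \<mu> * \<beta> * w - \<nu> * \<eta> / 2) * ee \<le> (\<beta> * S) * ee"
  proof (rule mult_right_mono)
    have "\<mu> * ((1 - \<nu>) * t) \<le> S / 2"
    proof -
      have "\<mu> * ((1 - \<nu>) * t) \<le> \<mu> * (1 * t)"
        using \<nu>1 t1 \<mu> by (intro mult_left_mono mult_right_mono) auto
      also have "\<dots> \<le> S / 2" using t t1 by (simp add: S_def)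
      finally show ?thesis .
    qed
    moreover have "\<mu> * w \<le> S / 2"
    proof -
      have "\<mu> * w \<le> \<mu> * 1" using w \<mu> by (intro mult_left_mono) auto
      moreover have "2 * \<mu> * 1 \<le> (t - 1) * t" using t t1 \<mu> by (intro mult_mono) auto
      ultimately show ?thesis by (simp add: S_def mult.commute)
    qed
    ultimately have "\<beta> * (\<mu> * ((1 - \<nu>) * t) + \<mu> * w) \<le> \<beta> * S"
      using \<beta> by (intro mult_left_mono) auto
    moreover have "0 \<le> \<nu> * \<eta> / 2" using \<nu>1 \<eta>_pos by simp
    ultimately show "\<mu> * \<beta> * (1 - \<nu>) * t + \<mu> * \<beta> * w - \<nu> * \<eta> / 2 \<le> \<beta> * S"
      by (simp add: algebra_simps)
  qed (fact nonneg)
  have pot': "potential \<mu> \<beta> t g' p' Z' = \<beta> * S * (norm g')\<^sup>2 - t * inner g' p'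
      + \<mu> * (t * (t - \<nu>)) / (4 * \<beta> * (1 - \<nu>) * (t - 1)\<^sup>2) * (norm p')\<^sup>2 + c' * (norm Z')\<^sup>2"
    by (simp add: potential_def S_def c'_def \<nu>)
  have pot: "potential \<mu> \<beta> (t - \<mu>) g p Z = \<beta> * ((t - \<mu>) * (t - \<mu> - 1)) * gg - (t - \<mu>) * gp
      + \<mu> * ((t - \<mu>) * (t - \<mu> - \<nu>)) / (4 * \<beta> * (1 - \<nu>) * (t - \<mu> - 1)\<^sup>2) * pp + c * (norm Z)\<^sup>2"
    by (simp add: potential_def gg_def gp_def pp_def c_def \<nu>)
  \<comment> \<open>The remaining inequality is linear once the rational coefficients are treated as atoms.\<close>
  define K1 K2 K3 K4 K5 where "K1 = \<mu> * (t - \<nu>) / (4 * \<beta> * (1 - \<nu>) * t)"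
    and "K2 = \<mu> / (2 * \<beta> * (1 - \<nu>) * t)"
    and "K3 = \<mu> * ((t - \<mu>) * (t - \<mu> - \<nu>)) / (4 * \<beta> * (1 - \<nu>) * (t - \<mu> - 1)\<^sup>2)"
    and "K4 = \<beta> * (2 - 3 * \<mu>) * (t * (t - 1 - 2 * \<mu>)) / (t - \<nu>)"
    and "K5 = \<beta> * ((2 + \<mu>) / (2 - \<mu>))"
  have K2: "\<mu> / (4 * \<beta> * (1 - \<nu>) * t) = K2 / 2" by (simp add: K2_def)
  define q where "q = \<mu> * \<beta> * w"
  define m where "m = \<mu> * \<beta> * (1 - \<nu>) * t"
  define zz where "zz = (norm Z')\<^sup>2"
  define h where "h = \<nu> * \<eta> / 2"
  have B: "\<beta> * (1 / \<mu> - 1 / 2) = \<beta> / \<mu> - \<beta> / 2" by (simp add: algebra_simps)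
  define b\<mu> where "b\<mu> = \<beta> / \<mu>"
  show ?thesis
    unfolding pot' anch pot S_def[symmetric] gg_def[symmetric] pp_def[symmetric] ee_def[symmetric]
      K3_def[symmetric] K4_def[symmetric] K2
    using gap dist gZ gg_b pp_b ge_b ep_b eZ_b ee_b
    unfolding K1_def[symmetric] K2_def[symmetric] K3_def[symmetric] K4_def[symmetric]
      K5_def[symmetric] K2 B q_def[symmetric] m_def[symmetric] zz_def[symmetric] h_def[symmetric]
      b\<mu>_def[symmetric]
    by (simp add: algebra_simps b\<mu>_def[symmetric])
qed

text \<open>
Write \<open>- s \<langle>g, p\<rangle> = s \<langle>g, Z - p\<rangle> - s \<langle>g, Z\<rangle>\<close>.  The first product raises the coefficient \<open>\<beta> s (s - 1)\<close> of
\<open>|g|\<^sup>2\<close> to \<open>\<beta> s\<^sup>2\<close>; half of that and the term in \<open>|Z|\<^sup>2\<close>, whose weight is at least \<open>1 / (2 \<beta>)\<close>, absorb the second.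
\<close>

lemma potential_lower_bound:
  fixes g p Z :: "'v::real_inner"
  assumes \<mu>: "0 < \<mu>" "\<mu> < 2 / 3" and s: "1 < s" and \<beta>: "0 < \<beta>"
    and co0: "\<beta> * (norm g)\<^sup>2 \<le> inner g (Z - p)"
  shows "\<beta> / 2 * s\<^sup>2 * (norm g)\<^sup>2 \<le> potential \<mu> \<beta> s g p Z"
proof -
  define d where "d = \<mu> * (s * (s - \<mu> / 2)) / (4 * \<beta> * (1 - \<mu> / 2) * (s - 1)\<^sup>2)"
  have d: "0 \<le> d" unfolding d_def using \<mu> s \<beta> by simp
  define c where "c = (s + \<mu> - \<mu> / 2) / (2 * \<beta> * \<mu> * (s + \<mu> - 1))"
  have "1 / (2 * \<beta>) * 1 \<le> 1 / (2 * \<beta>) * ((s + \<mu> - \<mu> / 2) / (\<mu> * (s + \<mu> - 1)))"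
  proof (rule mult_left_mono)
    have "\<mu> * (s + \<mu> - 1) \<le> 1 * (s + \<mu> - \<mu> / 2)" using \<mu> s by (intro mult_mono) auto
    moreover have "0 < \<mu> * (s + \<mu> - 1)" using \<mu> s by simp
    ultimately show "1 \<le> (s + \<mu> - \<mu> / 2) / (\<mu> * (s + \<mu> - 1))"
      by (subst le_divide_eq_1_pos) auto
  qed (use \<beta> in simp)
  then have c: "1 / (2 * \<beta>) \<le> c" by (simp add: c_def mult_ac)
  have "s * inner g Z \<le> \<beta> / 2 * s\<^sup>2 * (norm g)\<^sup>2 + 1 / (2 * \<beta>) * (norm Z)\<^sup>2"
    by (rule young_inner) (use \<beta> in auto)
  also have "\<dots> \<le> \<beta> / 2 * s\<^sup>2 * (norm g)\<^sup>2 + c * (norm Z)\<^sup>2"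
    using c by (intro add_left_mono mult_right_mono) auto
  finally have 1: "s * inner g Z \<le> \<beta> / 2 * s\<^sup>2 * (norm g)\<^sup>2 + c * (norm Z)\<^sup>2" .
  have 2: "s * (\<beta> * (norm g)\<^sup>2) \<le> s * inner g (Z - p)" using co0 s by (intro mult_left_mono) auto
  have "0 \<le> d * (norm p)\<^sup>2" using d by simp
  with 1 2 show ?thesis
    unfolding potential_def d_def[symmetric] c_def[symmetric]
    by (simp add: inner_diff_right power2_eq_square algebra_simps)
qed

lemma gap_norm_step:
  fixes g e p :: "'v::real_inner"
  assumes t: "1 < t" and \<nu>: "0 \<le> \<nu>" "\<nu> < 1" and \<beta>: "0 < \<beta>"
    and \<eta>: "\<eta> = 2 * \<beta> * (t - 1) / (t - \<nu>)"
    and p': "p' = (1 - 1 / t) *\<^sub>R p + ((1 - \<nu>) * \<eta>) *\<^sub>R (g + e)"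
  shows "(norm p')\<^sup>2 \<le> (norm p)\<^sup>2 + (norm p)\<^sup>2 / t
    + 16 * \<beta>\<^sup>2 * t * ((norm g)\<^sup>2 + (norm e)\<^sup>2)"
proof -
  define m where "m = (1 - \<nu>) * \<eta>"
  have \<eta>b: "0 \<le> \<eta>" "\<eta> \<le> 2 * \<beta>"
    using t \<nu> \<beta> by (auto simp: \<eta> field_simps)
  have m: "0 \<le> m" "m \<le> 2 * \<beta>"
    using mult_mono[of "1 - \<nu>" 1 \<eta> "2 * \<beta>"] \<eta>b \<nu> by (auto simp: m_def)
  have m2: "m\<^sup>2 \<le> 4 * \<beta>\<^sup>2" using power_mono[OF m(2,1), of 2] by (simp add: power_mult_distrib)
  define q where "q = 1 - 1 / t"
  have q: "0 \<le> q" "q \<le> 1" using t by (auto simp: q_def)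
  have "(norm p')\<^sup>2 = q\<^sup>2 * (norm p)\<^sup>2 + 2 * (q * m) * inner p (g + e) + m\<^sup>2 * (norm (g + e))\<^sup>2"
    unfolding p' q_def[symmetric] m_def[symmetric] power2_norm_eq_inner
    by (simp only: inner_add_left inner_add_right inner_scaleR_left inner_scaleR_right)
      (simp add: inner_commute algebra_simps power2_eq_square)
  moreover have "q\<^sup>2 * (norm p)\<^sup>2 \<le> 1 * (norm p)\<^sup>2"
    using power_mono[OF q(2,1), of 2] by (intro mult_right_mono) auto
  moreover have "2 * (q * m) * inner p (g + e) \<le> (1 / t) * (norm p)\<^sup>2 + (t * m\<^sup>2) * (norm (g + e))\<^sup>2
      \<or> m = 0"
  proof (cases "m = 0")
    case False
    have "(q * m)\<^sup>2 \<le> m\<^sup>2"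
      using mult_right_mono[OF power_mono[OF q(2,1), of 2], of "m\<^sup>2"]
      by (simp add: power_mult_distrib)
    then show ?thesis
      using t m False by (intro disjI1 young_inner) (auto simp: power_mult_distrib)
  qed simp
  moreover have "t * m\<^sup>2 * (norm (g + e))\<^sup>2 \<le> t * (4 * \<beta>\<^sup>2) * (norm (g + e))\<^sup>2"
    using m2 t by (intro mult_right_mono mult_left_mono) auto
  moreover have "m\<^sup>2 * (norm (g + e))\<^sup>2 \<le> (t * (4 * \<beta>\<^sup>2)) * (norm (g + e))\<^sup>2"
  proof (rule mult_right_mono)
    have "1 * m\<^sup>2 \<le> t * (4 * \<beta>\<^sup>2)" using m2 t by (intro mult_mono) auto
    then show "m\<^sup>2 \<le> t * (4 * \<beta>\<^sup>2)" by simp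
  qed simp
  moreover have "(t * (4 * \<beta>\<^sup>2)) * (norm (g + e))\<^sup>2 \<le> (t * (4 * \<beta>\<^sup>2)) * (2 * (norm g)\<^sup>2 + 2 * (norm e)\<^sup>2)"
  proof (rule mult_left_mono)
    have "0 \<le> (norm (g - e))\<^sup>2" by simp
    then show "(norm (g + e))\<^sup>2 \<le> 2 * (norm g)\<^sup>2 + 2 * (norm e)\<^sup>2"
      by (simp add: power2_norm_eq_inner inner_add inner_diff inner_commute)
  qed (use t in simp)
  moreover have "0 \<le> (1 / t) * (norm p)\<^sup>2" "0 \<le> t * (4 * \<beta>\<^sup>2) * (norm (g + e))\<^sup>2" using t by auto
  ultimately show ?thesis by (auto simp: algebra_simps)
qed

text \<open>
The part of the potential that telescopes in \<open>residual_gap_step\<close>.  It can be followed without reference to a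
solution, and it controls \<open>|g|\<^sup>2\<close> once \<open>|p|\<^sup>2\<close> is known to be small.
\<close>

definition residual_part :: "real \<Rightarrow> real \<Rightarrow> 'v::real_inner \<Rightarrow> 'v \<Rightarrow> real" where
  "residual_part \<beta> s g p = \<beta> * (s * (s - 1)) * (norm g)\<^sup>2 - s * inner g p"

lemma residual_part_step:
  fixes g g' e p :: "'v::real_inner"
  assumes \<mu>: "0 < \<mu>" "\<mu> < 2 / 3" and t: "1 + 2 * \<mu> \<le> t" and \<beta>: "0 < \<beta>"
    and \<nu>: "\<nu> = \<mu> / 2" and \<eta>: "\<eta> = 2 * \<beta> * (t - 1) / (t - \<nu>)"
    and bb: "\<beta> * ((2 + \<mu>) / (2 - \<mu>)) \<le> bb"
    and p': "p' = (1 - 1 / t) *\<^sub>R p + ((1 - \<nu>) * \<eta>) *\<^sub>R (g + e)"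
    and co: "bb * (norm (g' - g))\<^sup>2 + D \<le> inner (g' - g) ((1 / t) *\<^sub>R p - \<eta> *\<^sub>R (g + e))"
    and D: "0 \<le> D"
  shows "residual_part \<beta> t g' p' \<le> residual_part \<beta> (t - \<mu>) g p
    + (3 * \<beta> + 1) * t * (norm g)\<^sup>2 + (norm p)\<^sup>2 / t + \<beta> * (1 / \<mu> + 1) * t\<^sup>2 * (norm e)\<^sup>2"
proof -
  define S where "S = t * (t - 1)"
  have t1: "1 < t" using t \<mu> by simp
  have S: "S > 0" using t1 by (simp add: S_def)
  have \<nu>1: "0 < \<nu>" "\<nu> < 1 / 3" using \<mu> \<nu> by auto
  have t\<nu>: "t - \<nu> > 0" using t1 \<nu>1 by simp
  have \<eta>_pos: "\<eta> > 0" using \<beta> t1 t\<nu> by (simp add: \<eta>)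
  define w where "w = (1 - \<nu>) * t / (t - \<nu>)"
  have w: "0 \<le> w" "w \<le> 1" using \<nu>1 t1 t\<nu> by (auto simp: w_def field_simps)
  have gap: "\<beta> * S * (norm g')\<^sup>2 - t * inner g' p' \<le> - (t - 1) * inner g p
      + S * ((\<eta> - \<beta>) * (norm g)\<^sup>2 - (2 * \<beta> - \<eta>) * inner g e + \<beta> * (1 / \<mu> - 1 / 2) * (norm e)\<^sup>2 - D)"
    using residual_gap_step[OF t1 \<mu> \<beta> \<nu> \<eta> bb p' co] by (simp add: S_def)
  have "S * (\<eta> - \<beta>) + 0 + 0 + 0 + 0 \<le> S * (\<eta> - \<beta>) + \<mu> * (1 - \<nu>) * \<beta> * t / (t - \<nu>) + \<nu> * \<eta> / 2
      + \<beta> * (2 - 3 * \<mu>) * (t * (t - 1 - 2 * \<mu>)) / (t - \<nu>) + \<beta>"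
    using \<mu> \<nu>1 \<beta> t t1 t\<nu> \<eta>_pos
    by (intro add_mono order_refl divide_nonneg_pos mult_nonneg_nonneg) auto
  also have "\<dots> \<le> \<beta> * ((t - \<mu>) * (t - \<mu> - 1)) + \<beta> * ((2 + \<mu>) / (2 - \<mu>))"
    unfolding S_def by (rule residual_weight_bound[OF \<mu> t \<beta> \<nu> \<eta>])
  also have "\<beta> * ((2 + \<mu>) / (2 - \<mu>)) \<le> \<beta> * 2"
    using \<beta> \<mu> by (intro mult_left_mono) (auto simp: field_simps)
  also have "\<beta> * 2 \<le> 2 * \<beta> * t" using \<beta> t1 by simp
  finally have "S * (\<eta> - \<beta>) \<le> \<beta> * ((t - \<mu>) * (t - \<mu> - 1)) + 2 * \<beta> * t" by simp
  from mult_right_mono[OF this, of "(norm g)\<^sup>2"]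
  have 1: "S * (\<eta> - \<beta>) * (norm g)\<^sup>2 \<le> \<beta> * ((t - \<mu>) * (t - \<mu> - 1)) * (norm g)\<^sup>2 + 2 * \<beta> * t * (norm g)\<^sup>2"
    by (simp add: distrib_right)
  have 2: "(1 - \<mu>) * inner g p \<le> t * (norm g)\<^sup>2 + (1 / t) * (norm p)\<^sup>2"
  proof (rule young_inner)
    have "(1 - \<mu>)\<^sup>2 \<le> 1\<^sup>2" using \<mu> by (intro power_mono) auto
    then show "(1 - \<mu>)\<^sup>2 \<le> 4 * t * (1 / t)" using t1 by simp
  qed (use t1 in simp)
  have 3: "- (S * (2 * \<beta> - \<eta>)) * inner g e \<le> \<beta> * t * (norm g)\<^sup>2 + \<beta> * t\<^sup>2 * (norm e)\<^sup>2"
  proof (rule young_inner)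
    have "2 * \<beta> - \<eta> = 2 * \<beta> * (1 - \<nu>) / (t - \<nu>)" using t\<nu> by (simp add: \<eta> field_simps)
    then have "S * (2 * \<beta> - \<eta>) = 2 * \<beta> * ((t - 1) * w)" by (simp add: S_def w_def)
    moreover have "((t - 1) * w)\<^sup>2 \<le> t\<^sup>2"
    proof (rule power_mono)
      show "(t - 1) * w \<le> t" using mult_mono[of "t - 1" t w 1] w t1 by simp
      show "0 \<le> (t - 1) * w" using w t1 by simp
    qed
    moreover have "1 * t\<^sup>2 \<le> t * t\<^sup>2" using t1 by (intro mult_right_mono) auto
    ultimately have "((t - 1) * w)\<^sup>2 \<le> t * t\<^sup>2" by linarith
    then have "4 * \<beta>\<^sup>2 * ((t - 1) * w)\<^sup>2 \<le> 4 * \<beta>\<^sup>2 * (t * t\<^sup>2)" by (intro mult_left_mono) auto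
    with \<open>S * (2 * \<beta> - \<eta>) = 2 * \<beta> * ((t - 1) * w)\<close>
    show "(- (S * (2 * \<beta> - \<eta>)))\<^sup>2 \<le> 4 * (\<beta> * t) * (\<beta> * t\<^sup>2)"
      by (simp add: power_mult_distrib) (simp add: power2_eq_square algebra_simps)
  qed (use \<beta> t1 in simp)
  have 4: "S * (\<beta> * (1 / \<mu> - 1 / 2) * (norm e)\<^sup>2) \<le> \<beta> * (1 / \<mu>) * t\<^sup>2 * (norm e)\<^sup>2"
  proof -
    have "S * (\<beta> * (1 / \<mu> - 1 / 2)) \<le> t\<^sup>2 * (\<beta> * (1 / \<mu>))"
      using \<beta> \<mu> t1 by (intro mult_mono) (auto simp: S_def power2_eq_square field_simps)
    from mult_right_mono[OF this, of "(norm e)\<^sup>2"] show ?thesis by (simp add: algebra_simps)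
  qed
  have 5: "0 \<le> S * D" using S D by simp
  define i\<mu> where "i\<mu> = 1 / \<mu>"
  from gap 1 2 3 4 5 show ?thesis
    unfolding residual_part_def S_def[symmetric] i\<mu>_def[symmetric] by (simp add: algebra_simps)
qed

lemma residual_part_abs:
  fixes g p :: "'v::real_inner"
  assumes \<beta>: "0 < \<beta>" and s: "1 < s"
  shows "\<bar>residual_part \<beta> s g p\<bar> \<le> (\<beta> + 1) * (s\<^sup>2 * (norm g)\<^sup>2) + (norm p)\<^sup>2"
proof -
  have "s * inner g p \<le> s\<^sup>2 * (norm g)\<^sup>2 + 1 * (norm p)\<^sup>2"
    "- s * inner g p \<le> s\<^sup>2 * (norm g)\<^sup>2 + 1 * (norm p)\<^sup>2"
    by (rule young_inner; simp)+
  moreover have "\<beta> * (s * (s - 1)) * (norm g)\<^sup>2 \<le> \<beta> * s\<^sup>2 * (norm g)\<^sup>2"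
    using \<beta> s by (intro mult_right_mono mult_left_mono) (auto simp: power2_eq_square)
  moreover have "0 \<le> \<beta> * (s * (s - 1)) * (norm g)\<^sup>2" using \<beta> s by simp
  ultimately show ?thesis unfolding residual_part_def by (simp add: algebra_simps)
qed

lemma residual_part_lower_bound:
  fixes g p :: "'v::real_inner"
  assumes \<beta>: "0 < \<beta>" and \<mu>: "0 < \<mu>" and s: "1 + \<mu> \<le> s"
  shows "\<beta> / 2 * (s * (s - 1)) * (norm g)\<^sup>2
    \<le> residual_part \<beta> s g p + (1 + 1 / \<mu>) / (2 * \<beta>) * (norm p)\<^sup>2"
proof -
  have "s * inner g p \<le> \<beta> / 2 * (s * (s - 1)) * (norm g)\<^sup>2 + (1 + 1 / \<mu>) / (2 * \<beta>) * (norm p)\<^sup>2"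
  proof (rule young_inner)
    have "s \<le> (s - 1) * (1 + 1 / \<mu>)" using \<mu> s by (simp add: field_simps)
    then have "s * s \<le> s * ((s - 1) * (1 + 1 / \<mu>))" using s \<mu> by (intro mult_left_mono) auto
    also have "\<dots> = 4 * (\<beta> / 2 * (s * (s - 1))) * ((1 + 1 / \<mu>) / (2 * \<beta>))"
      using \<beta> by (simp add: divide_simps)
    finally show "s\<^sup>2 \<le> 4 * (\<beta> / 2 * (s * (s - 1))) * ((1 + 1 / \<mu>) / (2 * \<beta>))"
      by (simp add: power2_eq_square)
  qed (use \<beta> \<mu> in \<open>simp add: add_pos_pos\<close>)
  moreover have "\<beta> * (s * (s - 1)) * (norm g)\<^sup>2 = 2 * (\<beta> / 2 * (s * (s - 1)) * (norm g)\<^sup>2)" by simp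
  ultimately show ?thesis unfolding residual_part_def by linarith
qed

section \<open>Quasi-decreasing sequences\<close>

lemma quasi_decreasing_convergent:
  fixes f s :: "nat \<Rightarrow> real"
  assumes step: "\<And>k. f (Suc k) \<le> f k + s k" and s: "summable s" and below: "\<And>k. c \<le> f k"
  shows "convergent f"
proof -
  define h where "h = (\<lambda>k. f k - sum s {..<k})"
  have dec: "h (Suc k) \<le> h k" for k using step[of k] by (simp add: h_def)
  have conv: "convergent (\<lambda>k. sum s {..<k})" using s by (simp add: summable_iff_convergent)
  from convergent_imp_Bseq[OF conv] obtain K where "\<And>k. norm (sum s {..<k}) \<le> K"
    by (elim BseqE) blast
  then have K: "sum s {..<k} \<le> K" for k using abs_le_D1[of "sum s {..<k}" K] by simp
  have "decseq h" using dec by (simp add: decseq_SucI)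
  moreover have "c - K \<le> h k" for k using below[of k] K[of k] by (simp add: h_def)
  ultimately obtain l where "h \<longlonglongrightarrow> l" using decseq_convergent[of h "c - K"] by blast
  then have "convergent h" by (rule convergentI)
  from this conv have "convergent (\<lambda>k. h k + sum s {..<k})" by (rule convergent_add)
  then show ?thesis by (simp add: h_def)
qed

lemma summable_of_scaled_bound:
  fixes f w :: "nat \<Rightarrow> real"
  assumes f: "summable f" and c: "0 < c" and w: "\<And>k. 0 \<le> w k" "\<And>k. c * w k \<le> f k"
  shows "summable w"
proof (rule summable_comparison_test')
  show "summable (\<lambda>k. (1 / c) * f k)" by (intro summable_mult f)
  show "norm (w k) \<le> (1 / c) * f k" for k using w[of k] c by (simp add: field_simps)
qed

text \<open>
A nonzero limit would make the sum dominate a multiple of the harmonic series.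
\<close>

lemma limit_zero_of_summable_over_index:
  fixes f :: "nat \<Rightarrow> real"
  assumes "convergent f" and sm: "summable (\<lambda>k. \<bar>f k\<bar> / (real k + 1))"
  shows "f \<longlonglongrightarrow> 0"
proof -
  obtain l where l: "f \<longlonglongrightarrow> l" using assms by (auto simp: convergent_def)
  have "l = 0"
  proof (rule ccontr)
    assume "l \<noteq> 0"
    then have "\<bar>l\<bar> / 2 < \<bar>l\<bar>" by simp
    with tendsto_rabs[OF l] have "\<forall>\<^sub>F k in sequentially. \<bar>l\<bar> / 2 < \<bar>f k\<bar>"
      by (rule order_tendstoD)
    then have "\<forall>\<^sub>F k in sequentially. norm (\<bar>l\<bar> / 2 * (1 / (real k + 1))) \<le> \<bar>f k\<bar> / (real k + 1)"
    proof eventually_elim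
      case (elim k)
      then have "(\<bar>l\<bar> / 2) / (real k + 1) \<le> \<bar>f k\<bar> / (real k + 1)"
        by (intro divide_right_mono) auto
      then show ?case by simp
    qed
    from summable_comparison_test_ev[OF this sm]
    have "summable (\<lambda>k. \<bar>l\<bar> / 2 * (1 / (real k + 1)))" .
    with \<open>l \<noteq> 0\<close> have "summable (\<lambda>k. 1 / (real k + 1))"
      by (subst (asm) summable_cmult_iff) auto
    then have "summable (\<lambda>k. 1 / real (Suc k))" by (simp add: add.commute)
    then have "summable (\<lambda>k. inverse (real k))"
      by (subst (asm) summable_Suc_iff) (simp add: inverse_eq_divide)
    then show False using not_summable_harmonic[where 'a=real] by simp
  qed
  with l show ?thesis by simp
qed

lemma energy_decrease:
  fixes E D s :: "nat \<Rightarrow> real"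
  assumes step: "\<And>k. E (Suc k) + D k \<le> E k + s k"
    and E: "\<And>k. 0 \<le> E k" and D: "\<And>k. 0 \<le> D k" and s: "\<And>k. 0 \<le> s k" "summable s"
  shows "summable D" and "E k \<le> E 0 + suminf s"
proof -
  have sum_le: "E n + sum D {..<n} \<le> E 0 + sum s {..<n}" for n
  proof (induction n)
    case (Suc n) then show ?case using step[of n] by simp
  qed simp
  have s_le: "sum s {..<n} \<le> suminf s" for n using s by (intro sum_le_suminf) auto
  show "summable D"
  proof (rule bounded_imp_summable[OF D])
    show "sum D {..n} \<le> E 0 + suminf s" for n
      using sum_le[of "Suc n"] s_le[of "Suc n"] E[of "Suc n"] by (simp add: lessThan_Suc_atMost)
  qed
  have "0 \<le> sum D {..<k}" using D by (intro sum_nonneg) auto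
  then show "E k \<le> E 0 + suminf s" using sum_le[of k] s_le[of k] by linarith
qed

text \<open>
In the application, \<open>a\<close>, \<open>b\<close> and \<open>c\<close> are the means of \<open>|g|\<^sup>2\<close>, \<open>|p|\<^sup>2\<close> and of the squared estimator error, and
\<open>U\<close> is the mean of \<open>residual_part\<close>.  First \<open>b\<close> converges, necessarily to zero; this bounds \<open>U\<close> from below, so
\<open>U\<close> converges as well, again to zero, and the lower bound on \<open>U\<close> transfers this to \<open>a\<close>.
\<close>

lemma little_o_rates:
  fixes a b c U :: "nat \<Rightarrow> real"
  assumes nonneg: "\<And>k. 0 \<le> a k" "\<And>k. 0 \<le> b k"
    and sa: "summable (\<lambda>k. (real k + 1) * a k)"
    and sb: "summable (\<lambda>k. b k / (real k + 1))"
    and sc: "summable (\<lambda>k. (real k + 1)\<^sup>2 * c k)"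
    and C: "0 \<le> C"
    and b_step: "\<And>k. b (Suc k) \<le> b k
      + C * ((real k + 1) * a k + b k / (real k + 1) + (real k + 1)\<^sup>2 * c k)"
    and U_step: "\<And>k. U (Suc k) \<le> U k
      + C * ((real k + 1) * a k + b k / (real k + 1) + (real k + 1)\<^sup>2 * c k)"
    and U_abs: "\<And>k. \<bar>U k\<bar> \<le> C * ((real k + 1)\<^sup>2 * a k + b k)"
    and U_low: "\<And>k. d * ((real k)\<^sup>2 * a k) \<le> U k + C * b k" and d: "0 < d"
  shows "b \<longlonglongrightarrow> 0" and "(\<lambda>k. (real k)\<^sup>2 * a k) \<longlonglongrightarrow> 0"
proof -
  have s: "summable (\<lambda>k. C * ((real k + 1) * a k + b k / (real k + 1) + (real k + 1)\<^sup>2 * c k))"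
    by (intro summable_mult summable_add sa sb sc)
  have conv: "convergent b" by (rule quasi_decreasing_convergent[OF b_step s nonneg(2)])
  from conv show b0: "b \<longlonglongrightarrow> 0"
    by (rule limit_zero_of_summable_over_index) (use sb nonneg in simp)
  from convergent_imp_Bseq[OF conv] obtain K where "\<And>k. norm (b k) \<le> K"
    by (elim BseqE) blast
  then have K: "\<bar>b k\<bar> \<le> K" for k by simp
  have "- (C * K) \<le> U k" for k
  proof -
    have "C * b k \<le> C * K" using K[of k] C by (intro mult_left_mono) auto
    moreover have "0 \<le> d * ((real k)\<^sup>2 * a k)" using d nonneg by simp
    ultimately show ?thesis using U_low[of k] by linarith
  qed
  then have "convergent U" by (rule quasi_decreasing_convergent[OF U_step s])
  moreover have "summable (\<lambda>k. \<bar>U k\<bar> / (real k + 1))"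
  proof (rule summable_comparison_test')
    show "summable (\<lambda>k. C * ((real k + 1) * a k + b k / (real k + 1)))"
      by (intro summable_mult summable_add sa sb)
    show "norm (\<bar>U k\<bar> / (real k + 1)) \<le> C * ((real k + 1) * a k + b k / (real k + 1))" for k
    proof -
      have "\<bar>U k\<bar> / (real k + 1) \<le> C * ((real k + 1)\<^sup>2 * a k + b k) / (real k + 1)"
        by (intro divide_right_mono U_abs) auto
      also have "\<dots> = C * ((real k + 1) * a k + b k / (real k + 1))"
        by (simp add: power2_eq_square field_simps)
      finally show ?thesis by simp
    qed
  qed
  ultimately have U0: "U \<longlonglongrightarrow> 0" by (rule limit_zero_of_summable_over_index)
  have "(\<lambda>k. (1 / d) * (U k + C * b k)) \<longlonglongrightarrow> (1 / d) * (0 + C * 0)"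
    by (intro tendsto_intros U0 b0)
  then have lim: "(\<lambda>k. (1 / d) * (U k + C * b k)) \<longlonglongrightarrow> 0" by simp
  show "(\<lambda>k. (real k)\<^sup>2 * a k) \<longlonglongrightarrow> 0"
  proof (rule tendsto_sandwich[OF _ _ tendsto_const lim])
    show "\<forall>\<^sub>F k in sequentially. 0 \<le> (real k)\<^sup>2 * a k" using nonneg by simp
    show "\<forall>\<^sub>F k in sequentially. (real k)\<^sup>2 * a k \<le> (1 / d) * (U k + C * b k)"
      using U_low d by (simp add: field_simps)
  qed
qed

section \<open>Energy estimates in expectation\<close>

definition sq_integrable :: "'a measure \<Rightarrow> ('a \<Rightarrow> 'v::euclidean_space) \<Rightarrow> bool" where
  "sq_integrable M f \<longleftrightarrow> f \<in> borel_measurable M \<and> integrable M (\<lambda>\<omega>. (norm (f \<omega>))\<^sup>2)"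

lemma sq_integrable_bound:
  assumes "sq_integrable M g" "f \<in> borel_measurable M"
    and "\<And>\<omega>. \<omega> \<in> space M \<Longrightarrow> norm (f \<omega>) \<le> norm (g \<omega>)"
  shows "sq_integrable M f"
proof -
  have [measurable]: "f \<in> borel_measurable M" by fact
  have "integrable M (\<lambda>\<omega>. (norm (f \<omega>))\<^sup>2)"
    by (rule Bochner_Integration.integrable_bound[of _ "\<lambda>\<omega>. (norm (g \<omega>))\<^sup>2"])
      (use assms in \<open>auto simp: sq_integrable_def intro!: AE_I2 power_mono\<close>)
  then show ?thesis by (simp add: sq_integrable_def)
qed

lemma sq_integrable_add:
  assumes "sq_integrable M f" "sq_integrable M g"
  shows "sq_integrable M (\<lambda>\<omega>. f \<omega> + g \<omega>)"
proof -
  have [measurable]: "f \<in> borel_measurable M" "g \<in> borel_measurable M"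
    and int: "integrable M (\<lambda>\<omega>. (norm (f \<omega>))\<^sup>2)" "integrable M (\<lambda>\<omega>. (norm (g \<omega>))\<^sup>2)"
    using assms by (auto simp: sq_integrable_def)
  have "(norm (u + v))\<^sup>2 \<le> 2 * (norm u)\<^sup>2 + 2 * (norm v)\<^sup>2" for u v :: 'b
  proof -
    have "0 \<le> (norm (u - v))\<^sup>2" by simp
    then show ?thesis by (simp add: power2_norm_eq_inner inner_add inner_diff inner_commute)
  qed
  note bound = this
  have "integrable M (\<lambda>\<omega>. (norm (f \<omega> + g \<omega>))\<^sup>2)"
    by (rule Bochner_Integration.integrable_bound[of _ "\<lambda>\<omega>. 2 * (norm (f \<omega>))\<^sup>2 + 2 * (norm (g \<omega>))\<^sup>2"])
      (use int bound in \<open>auto intro!: AE_I2\<close>)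
  then show ?thesis by (simp add: sq_integrable_def)
qed

lemma sq_integrable_scaleR:
  "sq_integrable M f \<Longrightarrow> sq_integrable M (\<lambda>\<omega>. c *\<^sub>R f \<omega>)"
  by (auto simp: sq_integrable_def power_mult_distrib)

lemma sq_integrable_diff:
  assumes "sq_integrable M f" "sq_integrable M g"
  shows "sq_integrable M (\<lambda>\<omega>. f \<omega> - g \<omega>)"
  using sq_integrable_add[OF assms(1) sq_integrable_scaleR[OF assms(2), of "-1"]] by simp

lemma sq_integrable_inner:
  assumes "sq_integrable M f" "sq_integrable M g"
  shows "integrable M (\<lambda>\<omega>. inner (f \<omega>) (g \<omega>))"
proof -
  have [measurable]: "f \<in> borel_measurable M" "g \<in> borel_measurable M"
    and int: "integrable M (\<lambda>\<omega>. (norm (f \<omega>))\<^sup>2)" "integrable M (\<lambda>\<omega>. (norm (g \<omega>))\<^sup>2)"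
    using assms by (auto simp: sq_integrable_def)
  have "\<bar>inner u v\<bar> \<le> (norm u)\<^sup>2 + (norm v)\<^sup>2" for u v :: 'b
  proof -
    have "1 * inner u v \<le> 1 * (norm u)\<^sup>2 + 1 * (norm v)\<^sup>2"
      "- 1 * inner u v \<le> 1 * (norm u)\<^sup>2 + 1 * (norm v)\<^sup>2"
      by (rule young_inner; simp)+
    then show ?thesis by simp
  qed
  note bound = this
  show ?thesis
    by (rule Bochner_Integration.integrable_bound[of _ "\<lambda>\<omega>. (norm (f \<omega>))\<^sup>2 + (norm (g \<omega>))\<^sup>2"])
      (use int bound in \<open>auto intro!: AE_I2\<close>)
qed

lemma sq_integrable_const: "finite_measure M \<Longrightarrow> sq_integrable M (\<lambda>_. c)"
  by (simp add: sq_integrable_def finite_measure.integrable_const)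

lemma lipschitz_measurable:
  fixes h :: "'v::euclidean_space \<Rightarrow> 'v"
  assumes lip: "\<And>u v. norm (h u - h v) \<le> K * norm (u - v)"
  shows "h \<in> borel_measurable borel"
proof -
  have "norm (h u - h v) \<le> max K 0 * norm (u - v)" for u v
    by (rule order_trans[OF lip]) (intro mult_right_mono, auto)
  then have "(max K 0)-lipschitz_on UNIV h" by (intro lipschitz_onI) (auto simp: dist_norm)
  then show ?thesis
    by (intro borel_measurable_continuous_onI lipschitz_on_continuous_on)
qed

lemma sq_integrable_lipschitz:
  fixes h :: "'v::euclidean_space \<Rightarrow> 'v"
  assumes lip: "\<And>u v. norm (h u - h v) \<le> K * norm (u - v)"
    and f: "sq_integrable M f" and M: "finite_measure M"
  shows "sq_integrable M (\<lambda>\<omega>. h (f \<omega>))"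
proof -
  have [measurable]: "h \<in> borel_measurable borel" by (rule lipschitz_measurable[OF lip])
  have [measurable]: "f \<in> borel_measurable M" using f by (simp add: sq_integrable_def)
  have "sq_integrable M (\<lambda>\<omega>. h (f \<omega>) - h 0)"
  proof (rule sq_integrable_bound[OF sq_integrable_scaleR[OF f, of K]])
    show "norm (h (f \<omega>) - h 0) \<le> norm (K *\<^sub>R f \<omega>)" for \<omega>
      using lip[of "f \<omega>" 0] mult_right_mono[OF abs_ge_self[of K], of "norm (f \<omega>)"] by simp
  qed measurable
  from sq_integrable_add[OF this sq_integrable_const[OF M, of "h 0"]] show ?thesis by simp
qed

context sigma_finite_subalgebra
begin

lemma nn_integral_nn_cond_exp:
  assumes "f \<in> borel_measurable M"
  shows "(\<integral>\<^sup>+ \<omega>. nn_cond_exp M F f \<omega> \<partial>M) = (\<integral>\<^sup>+ \<omega>. f \<omega> \<partial>M)"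
  using nn_cond_exp_intg[of "\<lambda>_. 1" f] assms by simp

text \<open>
A nonnegative function and its conditional expectation have the same integral, so the bound by an integrable \<open>w\<close>
makes the mean of \<open>f\<close> finite.
\<close>

lemma integrable_of_nn_cond_exp_le:
  assumes [measurable]: "f \<in> borel_measurable M" and f0: "AE \<omega> in M. 0 \<le> f \<omega>"
    and w: "integrable M w" and w0: "AE \<omega> in M. 0 \<le> w \<omega>"
    and le: "AE \<omega> in M. nn_cond_exp M F (\<lambda>\<omega>. ennreal (f \<omega>)) \<omega> \<le> ennreal (w \<omega>)"
  shows "integrable M f" and "(\<integral>\<omega>. f \<omega> \<partial>M) \<le> (\<integral>\<omega>. w \<omega> \<partial>M)"
proof -
  have "(\<integral>\<^sup>+ \<omega>. ennreal (f \<omega>) \<partial>M) \<le> (\<integral>\<^sup>+ \<omega>. ennreal (w \<omega>) \<partial>M)"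
    using nn_integral_mono_AE[OF le] by (simp add: nn_integral_nn_cond_exp)
  also have "\<dots> = ennreal (\<integral>\<omega>. w \<omega> \<partial>M)" by (rule nn_integral_eq_integral[OF w w0])
  finally have *: "(\<integral>\<^sup>+ \<omega>. ennreal (f \<omega>) \<partial>M) \<le> ennreal (\<integral>\<omega>. w \<omega> \<partial>M)" .
  then show f: "integrable M f"
    by (intro integrableI_nonneg f0) (auto intro: le_less_trans)
  have "ennreal (\<integral>\<omega>. f \<omega> \<partial>M) \<le> ennreal (\<integral>\<omega>. w \<omega> \<partial>M)"
    using * nn_integral_eq_integral[OF f f0] by simp
  then show "(\<integral>\<omega>. f \<omega> \<partial>M) \<le> (\<integral>\<omega>. w \<omega> \<partial>M)"
    using integral_nonneg_AE[OF w0] by (simp add: ennreal_le_iff)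
qed

lemma integrable_of_nn_cond_exp_le_nn_cond_exp:
  assumes [measurable]: "f \<in> borel_measurable M" and f0: "AE \<omega> in M. 0 \<le> f \<omega>"
    and h: "integrable M h" and h0: "AE \<omega> in M. 0 \<le> h \<omega>"
    and le: "AE \<omega> in M. nn_cond_exp M F (\<lambda>\<omega>. ennreal (f \<omega>)) \<omega> \<le> nn_cond_exp M F (\<lambda>\<omega>. ennreal (h \<omega>)) \<omega>"
  shows "integrable M f" and "(\<integral>\<omega>. f \<omega> \<partial>M) \<le> (\<integral>\<omega>. h \<omega> \<partial>M)"
proof -
  have [measurable]: "h \<in> borel_measurable M" using h by auto
  have "(\<integral>\<^sup>+ \<omega>. ennreal (f \<omega>) \<partial>M) \<le> (\<integral>\<^sup>+ \<omega>. ennreal (h \<omega>) \<partial>M)"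
    using nn_integral_mono_AE[OF le] by (simp add: nn_integral_nn_cond_exp)
  also have "\<dots> = ennreal (\<integral>\<omega>. h \<omega> \<partial>M)" by (rule nn_integral_eq_integral[OF h h0])
  finally have *: "(\<integral>\<^sup>+ \<omega>. ennreal (f \<omega>) \<partial>M) \<le> ennreal (\<integral>\<omega>. h \<omega> \<partial>M)" .
  then show f: "integrable M f"
    by (intro integrableI_nonneg f0) (auto intro: le_less_trans)
  have "ennreal (\<integral>\<omega>. f \<omega> \<partial>M) \<le> ennreal (\<integral>\<omega>. h \<omega> \<partial>M)"
    using * nn_integral_eq_integral[OF f f0] by simp
  then show "(\<integral>\<omega>. f \<omega> \<partial>M) \<le> (\<integral>\<omega>. h \<omega> \<partial>M)"
    using integral_nonneg_AE[OF h0] by (simp add: ennreal_le_iff)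
qed

end

text \<open>
What the energy argument uses of the iteration: the co-coercivity inequalities, the recursions for \<open>x\<close> and
\<open>z\<close> with the step direction \<open>Gt\<close>, and the variance reduction after taking expectations.  In the last one the
mean squared difference is replaced by its upper bound \<open>L \<langle>F x - F y, x - y\<rangle>\<close>, which is measurable because \<open>F\<close>
is Lipschitz continuous.  Integrability is a conclusion of the variance reduction assumption, because it is only known
by induction along the iteration.
\<close>

locale vr_splitting = prob_space M for M :: "'a measure" +
  fixes F G :: "'v::euclidean_space \<Rightarrow> 'v" and x z Ft Gt :: "nat \<Rightarrow> 'a \<Rightarrow> 'v" and x0 :: 'v
    and \<Delta> :: "nat \<Rightarrow> 'a \<Rightarrow> real" and \<kappa> \<Theta> \<sigma> \<Gamma> t \<eta> :: "nat \<Rightarrow> real"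
    and L bb \<Lambda> \<mu> r \<beta> :: real
  assumes L: "0 < L" and \<Lambda>: "0 \<le> \<Lambda>"
    and F_coco: "\<And>u v. (norm (F u - F v))\<^sup>2 \<le> L * inner (F u - F v) (u - v)"
    and G_coco: "\<And>u v. bb * (norm (G u - G v))\<^sup>2 + \<Lambda> * (L * inner (F u - F v) (u - v))
        \<le> inner (G u - G v) (u - v)"
    and \<mu>: "0 < \<mu>" "\<mu> < 2 / 3" and r: "2 + 1 / \<mu> \<le> r" and \<beta>: "0 < \<beta>"
    and bb: "\<beta> * ((2 + \<mu>) / (2 - \<mu>)) \<le> bb"
    and t_eq: "\<And>k. t k = \<mu> * (real k + r)"
    and \<eta>_eq: "\<And>k. \<eta> k = 2 * \<beta> * (t k - 1) / (t k - \<mu> / 2)"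
    and x_0: "\<And>\<omega>. \<omega> \<in> space M \<Longrightarrow> x 0 \<omega> = x0" and z_0: "\<And>\<omega>. \<omega> \<in> space M \<Longrightarrow> z 0 \<omega> = x0"
    and x_Suc: "\<And>k \<omega>. \<omega> \<in> space M \<Longrightarrow>
        x (Suc k) \<omega> = x k \<omega> + (1 / t k) *\<^sub>R (z k \<omega> - x k \<omega>) - \<eta> k *\<^sub>R Gt k \<omega>"
    and z_Suc: "\<And>k \<omega>. \<omega> \<in> space M \<Longrightarrow> z (Suc k) \<omega> = z k \<omega> - (\<mu> / 2 * \<eta> k) *\<^sub>R Gt k \<omega>"
    and x_meas: "\<And>k. x k \<in> borel_measurable M" and z_meas: "\<And>k. z k \<in> borel_measurable M"
    and Ft_meas: "\<And>k. Ft k \<in> borel_measurable M" and Gt_meas: "\<And>k. Gt k \<in> borel_measurable M"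
    and Gt_err: "\<And>k \<omega>. \<omega> \<in> space M \<Longrightarrow>
        norm (Gt k \<omega> - G (x k \<omega>)) \<le> norm (Ft k \<omega> - F (x k \<omega>))"
    and VR: "\<And>k. integrable M (if k = 0 then (\<lambda>_. 0) else \<Delta> (k - 1)) \<Longrightarrow>
        integrable M (\<lambda>\<omega>. inner (F (x k \<omega>) - F (x (k - 1) \<omega>)) (x k \<omega> - x (k - 1) \<omega>)) \<Longrightarrow>
        integrable M (\<lambda>\<omega>. (norm (Ft k \<omega> - F (x k \<omega>)))\<^sup>2) \<and> integrable M (\<Delta> k) \<and>
        (\<integral>\<omega>. (norm (Ft k \<omega> - F (x k \<omega>)))\<^sup>2 \<partial>M) \<le> (\<integral>\<omega>. \<Delta> k \<omega> \<partial>M) \<and>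
        (\<integral>\<omega>. \<Delta> k \<omega> \<partial>M) \<le> (1 - \<kappa> k) * (if k = 0 then 0 else \<integral>\<omega>. \<Delta> (k - 1) \<omega> \<partial>M)
          + \<Theta> k * (L * (\<integral>\<omega>. inner (F (x k \<omega>) - F (x (k - 1) \<omega>)) (x k \<omega> - x (k - 1) \<omega>) \<partial>M))
          + (\<sigma> k)\<^sup>2"
    and \<Theta>: "\<And>k. 0 < \<Theta> k" and \<Gamma>: "\<And>k. 0 < \<Gamma> k" and \<Gamma>\<Theta>: "\<And>k. \<Gamma> k * \<Theta> k \<le> 2 * \<Lambda>"
    and \<kappa>_ge: "\<And>k. 1 - \<Gamma> k * (t k - \<mu>) * (t k - \<mu> - 1) / (\<Gamma> (Suc k) * t k * (t k - 1))
        + 5 * \<beta> / (\<mu> * \<Gamma> (Suc k)) \<le> \<kappa> (Suc k)"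
begin

lemma r_pos: "0 < r"
proof -
  have "0 < 1 / \<mu>" using \<mu> by simp
  then show ?thesis using r by linarith
qed

lemma t_ge: "\<mu> * real k + 2 * \<mu> + 1 \<le> t k"
proof -
  have "\<mu> * (2 + 1 / \<mu>) \<le> \<mu> * r" using r \<mu> by (intro mult_left_mono) auto
  then show ?thesis using \<mu> by (simp add: t_eq algebra_simps)
qed

lemma t_Suc: "t (Suc k) = t k + \<mu>" by (simp add: t_eq algebra_simps)

lemma t_le: "t k \<le> \<mu> * r * (real k + 1)"
proof -
  have "0 < 1 / \<mu>" using \<mu> by simp
  then have "1 \<le> r" using r by linarith
  then have "\<mu> * real k * 1 \<le> \<mu> * real k * r" using \<mu> by (intro mult_left_mono) auto
  then show ?thesis by (simp add: t_eq algebra_simps)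
qed

lemma t_basic: "1 + 2 * \<mu> \<le> t k" "1 < t k" "0 < t k"
proof -
  have "0 \<le> \<mu> * real k" using \<mu> by simp
  then show "1 + 2 * \<mu> \<le> t k" using t_ge[of k] by linarith
  then show "1 < t k" "0 < t k" using \<mu> by auto
qed

lemma bb_ge: "\<beta> \<le> bb" and bb_pos: "0 < bb"
proof -
  have "\<beta> * 1 \<le> \<beta> * ((2 + \<mu>) / (2 - \<mu>))" using \<mu> \<beta> by (intro mult_left_mono) auto
  then show "\<beta> \<le> bb" using bb by simp
  then show "0 < bb" using \<beta> by simp
qed

lemma \<eta>_bounds: "0 < \<eta> k" "\<eta> k \<le> 2 * \<beta>"
  using t_basic[of k] \<mu> \<beta> by (auto simp: \<eta>_eq field_simps)

lemma F_mono: "0 \<le> L * inner (F u - F v) (u - v)"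
  by (rule order_trans[OF zero_le_power2 F_coco])

lemma F_lipschitz: "norm (F u - F v) \<le> L * norm (u - v)"
  by (rule co_coercive_imp_lipschitz[OF F_coco L])

lemma G_lipschitz: "norm (G u - G v) \<le> (1 / bb) * norm (u - v)"
proof (rule co_coercive_imp_lipschitz)
  fix u v
  have "bb * (norm (G u - G v))\<^sup>2 \<le> inner (G u - G v) (u - v)"
    using G_coco[of u v] mult_nonneg_nonneg[OF \<Lambda> F_mono[of u v]] by linarith
  then show "(norm (G u - G v))\<^sup>2 \<le> (1 / bb) * inner (G u - G v) (u - v)"
    using bb_pos by (simp add: field_simps)
qed (use bb_pos in simp)

text \<open>
Square integrability of the iterates at steps \<open>k\<close> and \<open>k - 1\<close> makes the two premises of the variance
reduction hold at \<open>k\<close>; this bounds the estimator error, hence the step direction and the next iterates.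
\<close>

lemma sq_integrable_iterates:
  "sq_integrable M (x k) \<and> sq_integrable M (z k) \<and> sq_integrable M (x (k - 1)) \<and>
   integrable M (if k = 0 then (\<lambda>_. 0) else \<Delta> (k - 1))"
proof (induction k)
  case 0
  have "sq_integrable M (x 0)" "sq_integrable M (z 0)"
    by (rule sq_integrable_bound[OF sq_integrable_const[OF finite_measure_axioms, of x0]],
        use x_meas z_meas x_0 z_0 in auto)+
  then show ?case by simp
next
  case (Suc k)
  note Fx = sq_integrable_lipschitz[OF F_lipschitz _ finite_measure_axioms]
  note Gx = sq_integrable_lipschitz[OF G_lipschitz _ finite_measure_axioms]
  have "integrable M (\<lambda>\<omega>. inner (F (x k \<omega>) - F (x (k - 1) \<omega>)) (x k \<omega> - x (k - 1) \<omega>))"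
    using Suc by (intro sq_integrable_inner sq_integrable_diff Fx) auto
  with VR[of k] Suc have vr: "integrable M (\<lambda>\<omega>. (norm (Ft k \<omega> - F (x k \<omega>)))\<^sup>2)" "integrable M (\<Delta> k)"
    by auto
  have [measurable]: "F \<in> borel_measurable borel" "G \<in> borel_measurable borel"
    using lipschitz_measurable[OF F_lipschitz] lipschitz_measurable[OF G_lipschitz] by auto
  note [measurable] = x_meas z_meas Ft_meas Gt_meas
  have "sq_integrable M (\<lambda>\<omega>. Ft k \<omega> - F (x k \<omega>))"
    using vr by (simp add: sq_integrable_def)
  then have "sq_integrable M (\<lambda>\<omega>. Gt k \<omega> - G (x k \<omega>))"
    by (rule sq_integrable_bound) (use Gt_err in auto)
  from sq_integrable_add[OF this Gx[of "x k"]] Suc have Gt: "sq_integrable M (Gt k)" by simp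
  have "sq_integrable M (\<lambda>\<omega>. x k \<omega> + (1 / t k) *\<^sub>R (z k \<omega> - x k \<omega>) - \<eta> k *\<^sub>R Gt k \<omega>)"
    using Suc Gt by (intro sq_integrable_add sq_integrable_diff sq_integrable_scaleR) auto
  then have "sq_integrable M (x (Suc k))"
    by (rule sq_integrable_bound) (use x_Suc in \<open>auto simp: x_meas\<close>)
  moreover have "sq_integrable M (\<lambda>\<omega>. z k \<omega> - (\<mu> / 2 * \<eta> k) *\<^sub>R Gt k \<omega>)"
    using Suc Gt by (intro sq_integrable_diff sq_integrable_scaleR) auto
  then have "sq_integrable M (z (Suc k))"
    by (rule sq_integrable_bound) (use z_Suc in \<open>auto simp: z_meas\<close>)
  ultimately show ?case using Suc vr by simp
qed

lemma sq_integrable_x: "sq_integrable M (x k)" and sq_integrable_z: "sq_integrable M (z k)"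
  using sq_integrable_iterates by auto

lemma sq_integrable_G: "sq_integrable M (\<lambda>\<omega>. G (x k \<omega>))"
  by (rule sq_integrable_lipschitz[OF G_lipschitz sq_integrable_x finite_measure_axioms])

lemma sq_integrable_gap: "sq_integrable M (\<lambda>\<omega>. z k \<omega> - x k \<omega>)"
  by (intro sq_integrable_diff sq_integrable_x sq_integrable_z)

definition F_gap :: "nat \<Rightarrow> 'a \<Rightarrow> real" where
  "F_gap k \<omega> = L * inner (F (x k \<omega>) - F (x (k - 1) \<omega>)) (x k \<omega> - x (k - 1) \<omega>)"

lemma integrable_F_gap: "integrable M (F_gap k)"
  unfolding F_gap_def
  by (intro integrable_mult_right sq_integrable_inner sq_integrable_diff sq_integrable_x
      sq_integrable_lipschitz[OF F_lipschitz _ finite_measure_axioms])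

lemma estimator_error:
  shows integrable_error: "integrable M (\<lambda>\<omega>. (norm (Ft k \<omega> - F (x k \<omega>)))\<^sup>2)"
    and error_le: "(\<integral>\<omega>. (norm (Ft k \<omega> - F (x k \<omega>)))\<^sup>2 \<partial>M) \<le> (\<integral>\<omega>. \<Delta> k \<omega> \<partial>M)"
    and \<Delta>_step: "(\<integral>\<omega>. \<Delta> k \<omega> \<partial>M) \<le> (1 - \<kappa> k) * (if k = 0 then 0 else \<integral>\<omega>. \<Delta> (k - 1) \<omega> \<partial>M)
          + \<Theta> k * (\<integral>\<omega>. F_gap k \<omega> \<partial>M) + (\<sigma> k)\<^sup>2"
proof -
  have "integrable M (\<lambda>\<omega>. inner (F (x k \<omega>) - F (x (k - 1) \<omega>)) (x k \<omega> - x (k - 1) \<omega>))"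
    by (intro sq_integrable_inner sq_integrable_diff sq_integrable_x
        sq_integrable_lipschitz[OF F_lipschitz _ finite_measure_axioms])
  moreover have "integrable M (if k = 0 then (\<lambda>_. 0) else \<Delta> (k - 1))"
    using sq_integrable_iterates[of k] by blast
  ultimately show "integrable M (\<lambda>\<omega>. (norm (Ft k \<omega> - F (x k \<omega>)))\<^sup>2)"
    "(\<integral>\<omega>. (norm (Ft k \<omega> - F (x k \<omega>)))\<^sup>2 \<partial>M) \<le> (\<integral>\<omega>. \<Delta> k \<omega> \<partial>M)"
    "(\<integral>\<omega>. \<Delta> k \<omega> \<partial>M) \<le> (1 - \<kappa> k) * (if k = 0 then 0 else \<integral>\<omega>. \<Delta> (k - 1) \<omega> \<partial>M)
          + \<Theta> k * (\<integral>\<omega>. F_gap k \<omega> \<partial>M) + (\<sigma> k)\<^sup>2"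
    using VR[of k] by (auto simp: F_gap_def)
qed

lemma error_nonneg: "0 \<le> (\<integral>\<omega>. \<Delta> k \<omega> \<partial>M)"
  by (rule order_trans[OF Bochner_Integration.integral_nonneg error_le]) simp

lemma gap_Suc:
  assumes "\<omega> \<in> space M"
  shows "z (Suc k) \<omega> - x (Suc k) \<omega> = (1 - 1 / t k) *\<^sub>R (z k \<omega> - x k \<omega>)
    + ((1 - \<mu> / 2) * \<eta> k) *\<^sub>R (G (x k \<omega>) + (Gt k \<omega> - G (x k \<omega>)))"
  using x_Suc[OF assms, of k] z_Suc[OF assms, of k] by (simp add: algebra_simps)

lemma step_co_coercive:
  assumes "\<omega> \<in> space M"
  shows "bb * (norm (G (x (Suc k) \<omega>) - G (x k \<omega>)))\<^sup>2 + \<Lambda> * F_gap (Suc k) \<omega>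
    \<le> inner (G (x (Suc k) \<omega>) - G (x k \<omega>))
        ((1 / t k) *\<^sub>R (z k \<omega> - x k \<omega>) - \<eta> k *\<^sub>R (G (x k \<omega>) + (Gt k \<omega> - G (x k \<omega>))))"
proof -
  have "x (Suc k) \<omega> - x k \<omega> =
      (1 / t k) *\<^sub>R (z k \<omega> - x k \<omega>) - \<eta> k *\<^sub>R (G (x k \<omega>) + (Gt k \<omega> - G (x k \<omega>)))"
    using x_Suc[OF assms, of k] by (simp add: algebra_simps)
  then show ?thesis using G_coco[of "x (Suc k) \<omega>" "x k \<omega>"] by (simp add: F_gap_def)
qed

definition V :: "'v \<Rightarrow> nat \<Rightarrow> 'a \<Rightarrow> real" where
  "V xs k \<omega> = potential \<mu> \<beta> (t k - \<mu>) (G (x k \<omega>)) (z k \<omega> - x k \<omega>) (z k \<omega> - xs)"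

lemma integrable_V: "integrable M (V xs k)"
proof -
  have "sq_integrable M (\<lambda>\<omega>. z k \<omega> - xs)"
    by (intro sq_integrable_diff sq_integrable_z sq_integrable_const finite_measure_axioms)
  moreover have "integrable M (\<lambda>\<omega>. inner (G (x k \<omega>)) (z k \<omega> - x k \<omega>))"
    by (intro sq_integrable_inner sq_integrable_G sq_integrable_gap)
  ultimately show ?thesis
    unfolding V_def potential_def using sq_integrable_G[of k] sq_integrable_gap[of k]
    unfolding sq_integrable_def by (intro Bochner_Integration.integrable_add
        Bochner_Integration.integrable_diff integrable_mult_right) auto
qed

lemma zero_co_coercive:
  assumes "G xs = 0"
  shows "bb * (norm (G u))\<^sup>2 \<le> inner (G u) (u - xs)"
  using G_coco[of u xs] mult_nonneg_nonneg[OF \<Lambda> F_mono[of u xs]] assms by simp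

text \<open>
The error of the step direction is replaced by the error of the estimator, to which the variance reduction applies.
\<close>

lemma V_step:
  assumes xs: "G xs = 0" and \<omega>: "\<omega> \<in> space M"
  shows "V xs (Suc k) \<omega> \<le> V xs k \<omega> - (t k * (t k - 1) * \<Lambda>) * F_gap (Suc k) \<omega>
    - \<beta> * (2 - 3 * \<mu>) * (t k * (t k - 1 - 2 * \<mu>)) / (t k - \<mu> / 2) * (norm (G (x k \<omega>)))\<^sup>2
    - \<mu> / (4 * \<beta> * (1 - \<mu> / 2) * t k) * (norm (z k \<omega> - x k \<omega>))\<^sup>2
    + (1 / \<mu> + 9 / 4) * \<beta> * (t k * (t k - 1)) * (norm (Ft k \<omega> - F (x k \<omega>)))\<^sup>2"
proof -
  have "bb * (norm (G (x k \<omega>)))\<^sup>2 \<le> inner (G (x k \<omega>)) ((z k \<omega> - xs) - (z k \<omega> - x k \<omega>))"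
    using zero_co_coercive[OF xs, of "x k \<omega>"] by simp
  moreover have "z (Suc k) \<omega> - xs =
      (z k \<omega> - xs) - (\<mu> / 2 * \<eta> k) *\<^sub>R (G (x k \<omega>) + (Gt k \<omega> - G (x k \<omega>)))"
    using z_Suc[OF \<omega>, of k] by (simp add: algebra_simps)
  ultimately have "V xs (Suc k) \<omega> \<le> V xs k \<omega> - t k * (t k - 1) * (\<Lambda> * F_gap (Suc k) \<omega>)
    - \<beta> * (2 - 3 * \<mu>) * (t k * (t k - 1 - 2 * \<mu>)) / (t k - \<mu> / 2) * (norm (G (x k \<omega>)))\<^sup>2
    - \<mu> / (4 * \<beta> * (1 - \<mu> / 2) * t k) * (norm (z k \<omega> - x k \<omega>))\<^sup>2
    + (1 / \<mu> + 9 / 4) * \<beta> * (t k * (t k - 1)) * (norm (Gt k \<omega> - G (x k \<omega>)))\<^sup>2"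
    unfolding V_def t_Suc add_diff_cancel_right'
    by (intro potential_step[OF \<mu> t_basic(1) \<beta> refl \<eta>_eq bb gap_Suc[OF \<omega>] _ step_co_coercive[OF \<omega>]])
  also have "(1 / \<mu> + 9 / 4) * \<beta> * (t k * (t k - 1)) * (norm (Gt k \<omega> - G (x k \<omega>)))\<^sup>2
      \<le> (1 / \<mu> + 9 / 4) * \<beta> * (t k * (t k - 1)) * (norm (Ft k \<omega> - F (x k \<omega>)))\<^sup>2"
    using \<mu> \<beta> t_basic[of k] by (intro mult_left_mono power_mono Gt_err \<omega>) auto
  finally show ?thesis by (simp add: mult.assoc)
qed

lemma V_ge:
  assumes xs: "G xs = 0"
  shows "\<beta> / 2 * (t k - \<mu>)\<^sup>2 * (norm (G (x k \<omega>)))\<^sup>2 \<le> V xs k \<omega>"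
  unfolding V_def
proof (rule potential_lower_bound[OF \<mu> _ \<beta>])
  show "1 < t k - \<mu>" using t_basic(1)[of k] \<mu> by simp
  have "\<beta> * (norm (G (x k \<omega>)))\<^sup>2 \<le> bb * (norm (G (x k \<omega>)))\<^sup>2"
    using bb_ge by (intro mult_right_mono) auto
  then show "\<beta> * (norm (G (x k \<omega>)))\<^sup>2 \<le> inner (G (x k \<omega>)) (z k \<omega> - xs - (z k \<omega> - x k \<omega>))"
    using zero_co_coercive[OF xs, of "x k \<omega>"] by simp
qed

abbreviation "Gsq k \<equiv> (\<integral>\<omega>. (norm (G (x k \<omega>)))\<^sup>2 \<partial>M)"
abbreviation "gapsq k \<equiv> (\<integral>\<omega>. (norm (z k \<omega> - x k \<omega>))\<^sup>2 \<partial>M)"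
abbreviation "errsq k \<equiv> (\<integral>\<omega>. (norm (Ft k \<omega> - F (x k \<omega>)))\<^sup>2 \<partial>M)"
abbreviation "\<Delta>m k \<equiv> (\<integral>\<omega>. \<Delta> k \<omega> \<partial>M)"

definition energy :: "'v \<Rightarrow> nat \<Rightarrow> real" where
  "energy xs k = (\<integral>\<omega>. V xs k \<omega> \<partial>M) + \<Gamma> k / 2 * ((t k - \<mu>) * (t k - \<mu> - 1)) * \<Delta>m k"

text \<open>
The last coefficient is what \<open>5 \<beta> / (2 \<mu>)\<close>, provided by the lower bound on \<open>\<kappa>\<close>, exceeds the noise
coefficient \<open>(1/\<mu> + 9/4) \<beta>\<close> of \<open>V_step\<close> by.
\<close>

definition dissipation :: "nat \<Rightarrow> real" where
  "dissipation k =
    \<beta> * (2 - 3 * \<mu>) * (t k * (t k - 1 - 2 * \<mu>)) / (t k - \<mu> / 2) * Gsq k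
    + \<mu> / (4 * \<beta> * (1 - \<mu> / 2) * t k) * gapsq k
    + (3 / (2 * \<mu>) - 9 / 4) * \<beta> * (t k * (t k - 1)) * \<Delta>m k"

definition noise :: "nat \<Rightarrow> real" where
  "noise k = \<Lambda> * (t k * (t k - 1)) * ((\<sigma> (Suc k))\<^sup>2 / \<Theta> (Suc k))"

text \<open>
Multiply the recursion for the mean of \<open>\<Delta>\<close> by \<open>\<Gamma> (Suc k) t k (t k - 1) / 2\<close>.  The lower bound on \<open>\<kappa>\<close> turns the
contraction factor into the preceding weight minus a multiple that absorbs the estimator error, and the
term with \<open>F_gap\<close> is cancelled by the one gained in \<open>V_step\<close>.
\<close>

lemma energy_step:
  assumes xs: "G xs = 0"
  shows "energy xs (Suc k) + dissipation k \<le> energy xs k + noise k"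
proof -
  define S where "S = t k * (t k - 1)"
  have S: "0 < S" using t_basic[of k] by (simp add: S_def)
  define c1 c2 where "c1 = \<beta> * (2 - 3 * \<mu>) * (t k * (t k - 1 - 2 * \<mu>)) / (t k - \<mu> / 2)"
    and "c2 = \<mu> / (4 * \<beta> * (1 - \<mu> / 2) * t k)"
  define c3 where "c3 = (1 / \<mu> + 9 / 4) * \<beta> * S"
  note [simp] = integrable_V integrable_F_gap integrable_error
    sq_integrable_G[unfolded sq_integrable_def, THEN conjunct2]
    sq_integrable_gap[unfolded sq_integrable_def, THEN conjunct2]
  have "(\<integral>\<omega>. V xs (Suc k) \<omega> \<partial>M) \<le> (\<integral>\<omega>. V xs k \<omega> - (S * \<Lambda>) * F_gap (Suc k) \<omega>
      - c1 * (norm (G (x k \<omega>)))\<^sup>2 - c2 * (norm (z k \<omega> - x k \<omega>))\<^sup>2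
      + c3 * (norm (Ft k \<omega> - F (x k \<omega>)))\<^sup>2 \<partial>M)"
    using V_step[OF xs] unfolding S_def c1_def c2_def c3_def
    by (intro integral_mono) auto
  also have "\<dots> = (\<integral>\<omega>. V xs k \<omega> \<partial>M) - (S * \<Lambda>) * (\<integral>\<omega>. F_gap (Suc k) \<omega> \<partial>M)
      - c1 * Gsq k - c2 * gapsq k + c3 * errsq k"
    by simp
  finally have 1: "(\<integral>\<omega>. V xs (Suc k) \<omega> \<partial>M) \<le> (\<integral>\<omega>. V xs k \<omega> \<partial>M)
      - (S * \<Lambda>) * (\<integral>\<omega>. F_gap (Suc k) \<omega> \<partial>M) - c1 * Gsq k - c2 * gapsq k + c3 * errsq k" .
  have 2: "c3 * errsq k \<le> c3 * \<Delta>m k"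
    using \<mu> \<beta> S by (intro mult_left_mono error_le) (auto simp: c3_def)
  define A where "A = (t k - \<mu>) * (t k - \<mu> - 1)"
  define \<gamma> where "\<gamma> = \<Gamma> (Suc k)"
  have \<gamma>: "0 < \<gamma>" using \<Gamma> by (simp add: \<gamma>_def)
  have "\<Gamma> k * (t k - \<mu>) * (t k - \<mu> - 1) / (\<Gamma> (Suc k) * t k * (t k - 1)) = \<Gamma> k * A / (\<gamma> * S)"
    by (simp add: A_def S_def \<gamma>_def mult_ac)
  then have "1 - \<kappa> (Suc k) \<le> \<Gamma> k * A / (\<gamma> * S) - 5 * \<beta> / (\<mu> * \<gamma>)"
    using \<kappa>_ge[of k] unfolding \<gamma>_def by simp
  then have "\<gamma> * S / 2 * (1 - \<kappa> (Suc k)) \<le> \<gamma> * S / 2 * (\<Gamma> k * A / (\<gamma> * S) - 5 * \<beta> / (\<mu> * \<gamma>))"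
    using \<gamma> S by (intro mult_left_mono) auto
  also have "\<dots> = \<Gamma> k / 2 * A - 5 / (2 * \<mu>) * \<beta> * S"
    using \<gamma> S \<mu> by (simp add: field_simps)
  finally have "\<gamma> * S / 2 * (1 - \<kappa> (Suc k)) * \<Delta>m k \<le> (\<Gamma> k / 2 * A - 5 / (2 * \<mu>) * \<beta> * S) * \<Delta>m k"
    by (rule mult_right_mono) (rule error_nonneg)
  moreover have "\<gamma> * S / 2 * \<Delta>m (Suc k) \<le> \<gamma> * S / 2 * ((1 - \<kappa> (Suc k)) * \<Delta>m k
      + \<Theta> (Suc k) * (\<integral>\<omega>. F_gap (Suc k) \<omega> \<partial>M) + (\<sigma> (Suc k))\<^sup>2)"
    using \<Delta>_step[of "Suc k"] \<gamma> S by (intro mult_left_mono) auto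
  moreover have "S * (\<gamma> * \<Theta> (Suc k)) / 2 * (\<integral>\<omega>. F_gap (Suc k) \<omega> \<partial>M)
      \<le> S * (2 * \<Lambda>) / 2 * (\<integral>\<omega>. F_gap (Suc k) \<omega> \<partial>M)"
    using \<Gamma>\<Theta>[of "Suc k"] S F_mono
    by (intro mult_right_mono divide_right_mono mult_left_mono integral_nonneg_AE)
      (auto simp: \<gamma>_def F_gap_def)
  moreover have "\<gamma> * S / 2 * (\<sigma> (Suc k))\<^sup>2 \<le> noise k"
  proof -
    have "\<gamma> / 2 \<le> \<Lambda> / \<Theta> (Suc k)"
      using \<Gamma>\<Theta>[of "Suc k"] \<Theta>[of "Suc k"] by (simp add: \<gamma>_def field_simps)
    then have "\<gamma> / 2 * (S * (\<sigma> (Suc k))\<^sup>2) \<le> \<Lambda> / \<Theta> (Suc k) * (S * (\<sigma> (Suc k))\<^sup>2)"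
      using S by (intro mult_right_mono) auto
    then show ?thesis by (simp add: noise_def S_def mult_ac)
  qed
  ultimately have 3: "\<gamma> * S / 2 * \<Delta>m (Suc k) \<le> (\<Gamma> k / 2 * A - 5 / (2 * \<mu>) * \<beta> * S) * \<Delta>m k
      + (S * \<Lambda>) * (\<integral>\<omega>. F_gap (Suc k) \<omega> \<partial>M) + noise k"
    by (simp add: distrib_left mult_ac)
  have E: "energy xs (Suc k) = (\<integral>\<omega>. V xs (Suc k) \<omega> \<partial>M) + \<gamma> * S / 2 * \<Delta>m (Suc k)"
    by (simp add: energy_def \<gamma>_def S_def t_Suc)
  have E': "energy xs k = (\<integral>\<omega>. V xs k \<omega> \<partial>M) + \<Gamma> k / 2 * A * \<Delta>m k"
    by (simp add: energy_def A_def)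
  have D: "dissipation k = c1 * Gsq k + c2 * gapsq k + (5 / (2 * \<mu>) * \<beta> * S - c3) * \<Delta>m k"
    unfolding dissipation_def c1_def[symmetric] c2_def[symmetric] S_def[symmetric] c3_def
    using \<mu> by (simp add: field_simps)
  have "(\<Gamma> k / 2 * A - 5 / (2 * \<mu>) * \<beta> * S) * \<Delta>m k =
      \<Gamma> k / 2 * A * \<Delta>m k - (5 / (2 * \<mu>) * \<beta> * S - c3) * \<Delta>m k - c3 * \<Delta>m k"
    by (simp add: left_diff_distrib)
  with 1 2 3 show ?thesis unfolding E E' D by linarith
qed

lemma V_0:
  assumes "\<omega> \<in> space M"
  shows "V xs 0 \<omega> = \<beta> * ((\<mu> * r - \<mu>) * (\<mu> * r - \<mu> - 1)) * (norm (G x0))\<^sup>2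
    + \<beta> * ((2 * r - 1) / (4 * \<beta>\<^sup>2 * (\<mu> * r - 1)) * (norm (x0 - xs))\<^sup>2)"
proof -
  have t0: "t 0 = \<mu> * r" by (simp add: t_eq)
  have nz: "\<mu> * r - 1 \<noteq> 0" using t_basic(2)[of 0] by (simp add: t0)
  have "(\<mu> * r - \<mu> + \<mu> - \<mu> / 2) / (2 * \<beta> * \<mu> * (\<mu> * r - \<mu> + \<mu> - 1)) =
      (\<mu> * (2 * r - 1)) / (\<mu> * (4 * \<beta> * (\<mu> * r - 1)))"
    using nz \<mu> \<beta> by (simp add: divide_simps) (simp add: algebra_simps)
  also have "\<dots> = \<beta> * ((2 * r - 1) / (4 * \<beta>\<^sup>2 * (\<mu> * r - 1)))"
    using nz \<mu> \<beta> by (simp add: power2_eq_square)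
  finally show ?thesis
    using assms by (simp add: V_def potential_def x_0 z_0 t0 mult.assoc)
qed

lemma energy_0:
  "energy xs 0 \<le> \<beta> * (\<mu>\<^sup>2 * r\<^sup>2 * Gsq 0 + (2 * r - 1) / (4 * \<beta>\<^sup>2 * (\<mu> * r - 1)) * (norm (x0 - xs))\<^sup>2)
    + \<Gamma> 0 * \<mu>\<^sup>2 * r\<^sup>2 / 2 * (\<sigma> 0)\<^sup>2"
proof -
  define D where "D = (2 * r - 1) / (4 * \<beta>\<^sup>2 * (\<mu> * r - 1)) * (norm (x0 - xs))\<^sup>2"
  have t0: "t 0 = \<mu> * r" by (simp add: t_eq)
  have s: "1 + \<mu> \<le> \<mu> * r - \<mu>" using t_basic(1)[of 0] by (simp add: t0)
  have A: "(\<mu> * r - \<mu>) * (\<mu> * r - \<mu> - 1) \<le> \<mu>\<^sup>2 * r\<^sup>2"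
  proof -
    have "(\<mu> * r - \<mu>) * (\<mu> * r - \<mu> - 1) \<le> (\<mu> * r) * (\<mu> * r)"
      using s \<mu> by (intro mult_mono) auto
    then show ?thesis by (simp add: power2_eq_square mult_ac)
  qed
  have G0: "Gsq 0 = (norm (G x0))\<^sup>2"
  proof -
    have "Gsq 0 = (\<integral>\<omega>. (norm (G x0))\<^sup>2 \<partial>M)"
      by (intro Bochner_Integration.integral_cong) (auto simp: x_0)
    then show ?thesis by (simp add: prob_space)
  qed
  have "(\<integral>\<omega>. V xs 0 \<omega> \<partial>M) =
      (\<integral>\<omega>. \<beta> * ((\<mu> * r - \<mu>) * (\<mu> * r - \<mu> - 1)) * (norm (G x0))\<^sup>2 + \<beta> * D \<partial>M)"
    unfolding D_def by (intro Bochner_Integration.integral_cong refl V_0)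
  also have "\<dots> = \<beta> * ((\<mu> * r - \<mu>) * (\<mu> * r - \<mu> - 1)) * Gsq 0 + \<beta> * D"
    by (simp add: prob_space G0)
  also have "\<beta> * ((\<mu> * r - \<mu>) * (\<mu> * r - \<mu> - 1)) * Gsq 0 \<le> \<beta> * (\<mu>\<^sup>2 * r\<^sup>2) * Gsq 0"
    using A \<beta> by (intro mult_right_mono mult_left_mono) (auto simp: G0)
  finally have V: "(\<integral>\<omega>. V xs 0 \<omega> \<partial>M) \<le> \<beta> * (\<mu>\<^sup>2 * r\<^sup>2 * Gsq 0 + D)"
    by (simp add: algebra_simps)
  have "F_gap 0 = (\<lambda>\<omega>. 0)" by (simp add: F_gap_def fun_eq_iff)
  then have dm: "\<Delta>m 0 \<le> (\<sigma> 0)\<^sup>2" using \<Delta>_step[of 0] by simp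
  have "\<Gamma> 0 / 2 * ((\<mu> * r - \<mu>) * (\<mu> * r - \<mu> - 1)) * \<Delta>m 0 \<le> \<Gamma> 0 / 2 * (\<mu>\<^sup>2 * r\<^sup>2) * (\<sigma> 0)\<^sup>2"
    by (rule mult_mono[OF mult_left_mono[OF A] dm _ error_nonneg]) (use \<Gamma>[of 0] in auto)
  with V show ?thesis unfolding energy_def t0 D_def by simp
qed

lemma integral_V_ge:
  assumes xs: "G xs = 0"
  shows "\<beta> / 2 * (t k - \<mu>)\<^sup>2 * Gsq k \<le> (\<integral>\<omega>. V xs k \<omega> \<partial>M)"
proof -
  have "(\<integral>\<omega>. \<beta> / 2 * (t k - \<mu>)\<^sup>2 * (norm (G (x k \<omega>)))\<^sup>2 \<partial>M) \<le> (\<integral>\<omega>. V xs k \<omega> \<partial>M)"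
    using sq_integrable_G[of k] integrable_V V_ge[OF xs]
    by (intro integral_mono) (auto simp: sq_integrable_def)
  then show ?thesis by simp
qed

lemma energy_ge:
  assumes xs: "G xs = 0"
  shows "\<beta> / 2 * (t k - \<mu>)\<^sup>2 * Gsq k \<le> energy xs k"
proof -
  have "0 \<le> \<Gamma> k / 2 * ((t k - \<mu>) * (t k - \<mu> - 1)) * \<Delta>m k"
    using \<Gamma>[of k] t_basic(1)[of k] \<mu> error_nonneg
    by (intro mult_nonneg_nonneg) auto
  with integral_V_ge[OF xs, of k] show ?thesis by (simp add: energy_def)
qed

lemma noise_nonneg: "0 \<le> noise k"
  using \<Lambda> t_basic[of k] \<Theta>[of "Suc k"] by (simp add: noise_def)

lemma Gsq_nonneg: "0 \<le> Gsq k" and gapsq_nonneg: "0 \<le> gapsq k" and errsq_nonneg: "0 \<le> errsq k"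
  by (simp_all add: Bochner_Integration.integral_nonneg)

lemma dissipation_lower_bounds:
  shows "\<beta> * (2 - 3 * \<mu>) * \<mu> * (real k * Gsq k) \<le> dissipation k"
    and "1 / (4 * \<beta> * (1 - \<mu> / 2) * r) * (gapsq k / (real k + 1)) \<le> dissipation k"
    and "(3 / (2 * \<mu>) - 9 / 4) * \<beta> * \<mu>\<^sup>2 * ((real k + 1)\<^sup>2 * errsq k) \<le> dissipation k"
    and "0 \<le> dissipation k"
proof -
  define a b c where "a = \<beta> * (2 - 3 * \<mu>) * (t k * (t k - 1 - 2 * \<mu>)) / (t k - \<mu> / 2) * Gsq k"
    and "b = \<mu> / (4 * \<beta> * (1 - \<mu> / 2) * t k) * gapsq k"
    and "c = (3 / (2 * \<mu>) - 9 / 4) * \<beta> * (t k * (t k - 1)) * \<Delta>m k"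
  have D: "dissipation k = a + b + c" by (simp add: dissipation_def a_def b_def c_def)
  have \<mu>c: "0 < 3 / (2 * \<mu>) - 9 / 4" using \<mu> by (simp add: field_simps)
  note t = t_basic[of k]
  have nonneg: "0 \<le> a" "0 \<le> b" "0 \<le> c"
    using t \<mu> \<beta> \<mu>c Gsq_nonneg gapsq_nonneg error_nonneg unfolding a_def b_def c_def
    by (intro mult_nonneg_nonneg divide_nonneg_pos; simp)+
  then show "0 \<le> dissipation k" by (simp add: D)
  have "\<mu> * real k \<le> t k * (t k - 1 - 2 * \<mu>) / (t k - \<mu> / 2)"
  proof -
    have "\<mu> * real k * (t k - \<mu> / 2) \<le> (t k - 1 - 2 * \<mu>) * t k"
      using t t_ge[of k] \<mu> by (intro mult_mono) auto
    then show ?thesis using t \<mu> by (simp add: pos_le_divide_eq mult.commute)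
  qed
  then have "\<beta> * (2 - 3 * \<mu>) * (\<mu> * real k) * Gsq k
      \<le> \<beta> * (2 - 3 * \<mu>) * (t k * (t k - 1 - 2 * \<mu>) / (t k - \<mu> / 2)) * Gsq k"
    using \<beta> \<mu> Gsq_nonneg by (intro mult_right_mono mult_left_mono) auto
  then have "\<beta> * (2 - 3 * \<mu>) * \<mu> * (real k * Gsq k) \<le> a" by (simp add: a_def mult_ac)
  with nonneg show "\<beta> * (2 - 3 * \<mu>) * \<mu> * (real k * Gsq k) \<le> dissipation k" by (simp add: D)
  have "1 / (r * (real k + 1)) \<le> \<mu> / t k"
  proof -
    have "1 / (r * (real k + 1)) = \<mu> / (\<mu> * r * (real k + 1))" using \<mu> by simp
    also have "\<dots> \<le> \<mu> / t k"
      using t_le[of k] t r_pos \<mu> by (intro divide_left_mono mult_pos_pos) auto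
    finally show ?thesis .
  qed
  then have "1 / (4 * \<beta> * (1 - \<mu> / 2)) * (1 / (r * (real k + 1))) * gapsq k
      \<le> 1 / (4 * \<beta> * (1 - \<mu> / 2)) * (\<mu> / t k) * gapsq k"
    using \<beta> \<mu> gapsq_nonneg by (intro mult_right_mono mult_left_mono) auto
  then have "1 / (4 * \<beta> * (1 - \<mu> / 2) * r) * (gapsq k / (real k + 1)) \<le> b"
    by (simp add: b_def mult_ac)
  with nonneg show "1 / (4 * \<beta> * (1 - \<mu> / 2) * r) * (gapsq k / (real k + 1)) \<le> dissipation k"
    by (simp add: D)
  have tk: "\<mu> * (real k + 1) \<le> t k - 1" using t_ge[of k] \<mu> by (simp add: algebra_simps)
  have "(\<mu> * (real k + 1)) * (\<mu> * (real k + 1)) \<le> t k * (t k - 1)"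
    using tk \<mu> t by (intro mult_mono) auto
  then have tt: "\<mu>\<^sup>2 * (real k + 1)\<^sup>2 \<le> t k * (t k - 1)" by (simp add: power2_eq_square mult_ac)
  have "(3 / (2 * \<mu>) - 9 / 4) * \<beta> * (\<mu>\<^sup>2 * (real k + 1)\<^sup>2) * errsq k \<le> c"
    unfolding c_def
    by (rule mult_mono[OF mult_left_mono[OF tt] error_le _ errsq_nonneg]) (use \<mu>c \<beta> t in auto)
  then have "(3 / (2 * \<mu>) - 9 / 4) * \<beta> * \<mu>\<^sup>2 * ((real k + 1)\<^sup>2 * errsq k) \<le> c" by (simp add: mult_ac)
  with nonneg show "(3 / (2 * \<mu>) - 9 / 4) * \<beta> * \<mu>\<^sup>2 * ((real k + 1)\<^sup>2 * errsq k) \<le> dissipation k"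
    by (simp add: D)
qed

lemma energy_bounded:
  assumes xs: "G xs = 0" and sn: "summable noise"
  shows "energy xs k \<le> energy xs 0 + suminf noise" and "summable dissipation"
proof -
  have nonneg: "0 \<le> energy xs k" for k
  proof (rule order_trans[OF _ energy_ge[OF xs]])
    show "0 \<le> \<beta> / 2 * (t k - \<mu>)\<^sup>2 * Gsq k" using \<beta> Gsq_nonneg by simp
  qed
  note decrease = energy_decrease[OF energy_step[OF xs] nonneg dissipation_lower_bounds(4)
      noise_nonneg sn]
  show "energy xs k \<le> energy xs 0 + suminf noise" by (rule decrease(2))
  show "summable dissipation" by (rule decrease(1))
qed

lemma residual_rate:
  assumes xs: "G xs = 0" and sn: "summable noise"
  shows "Gsq k \<le> 2 * (energy xs 0 + suminf noise) / (\<beta> * (t k - \<mu>)\<^sup>2)"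
proof -
  have "0 < (t k - \<mu>)\<^sup>2" using t_basic(1)[of k] \<mu> by simp
  moreover have "\<beta> / 2 * (t k - \<mu>)\<^sup>2 * Gsq k \<le> energy xs 0 + suminf noise"
    using energy_ge[OF xs, of k] energy_bounded(1)[OF xs sn, of k] by linarith
  ultimately show ?thesis using \<beta> by (simp add: field_simps)
qed

definition mean_residual_part :: "nat \<Rightarrow> real" where
  "mean_residual_part k = (\<integral>\<omega>. residual_part \<beta> (t k - \<mu>) (G (x k \<omega>)) (z k \<omega> - x k \<omega>) \<partial>M)"

lemma integrable_residual_part:
  "integrable M (\<lambda>\<omega>. residual_part \<beta> s (G (x k \<omega>)) (z k \<omega> - x k \<omega>))"
  using sq_integrable_G[of k] sq_integrable_inner[OF sq_integrable_G[of k] sq_integrable_gap[of k]]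
  unfolding residual_part_def sq_integrable_def
  by (intro Bochner_Integration.integrable_diff integrable_mult_right) auto

lemma integrable_norm_sq [simp]:
  "integrable M (\<lambda>\<omega>. (norm (G (x k \<omega>)))\<^sup>2)" "integrable M (\<lambda>\<omega>. (norm (z k \<omega> - x k \<omega>))\<^sup>2)"
  "integrable M (\<lambda>\<omega>. (norm (Ft k \<omega> - F (x k \<omega>)))\<^sup>2)"
  using sq_integrable_G[of k] sq_integrable_gap[of k] integrable_error
  by (auto simp: sq_integrable_def)

lemma gapsq_step: "gapsq (Suc k) \<le> gapsq k + gapsq k / t k + 16 * \<beta>\<^sup>2 * t k * (Gsq k + errsq k)"
proof -
  have "gapsq (Suc k) \<le> (\<integral>\<omega>. (norm (z k \<omega> - x k \<omega>))\<^sup>2 + (norm (z k \<omega> - x k \<omega>))\<^sup>2 / t k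
      + 16 * \<beta>\<^sup>2 * t k * ((norm (G (x k \<omega>)))\<^sup>2 + (norm (Ft k \<omega> - F (x k \<omega>)))\<^sup>2) \<partial>M)"
  proof (rule integral_mono)
    fix \<omega> assume \<omega>: "\<omega> \<in> space M"
    have "(norm (z (Suc k) \<omega> - x (Suc k) \<omega>))\<^sup>2 \<le> (norm (z k \<omega> - x k \<omega>))\<^sup>2
        + (norm (z k \<omega> - x k \<omega>))\<^sup>2 / t k
        + 16 * \<beta>\<^sup>2 * t k * ((norm (G (x k \<omega>)))\<^sup>2 + (norm (Gt k \<omega> - G (x k \<omega>)))\<^sup>2)"
      using \<mu> by (intro gap_norm_step[OF t_basic(2) _ _ \<beta> \<eta>_eq gap_Suc[OF \<omega>]]) auto
    also have "\<dots> \<le> (norm (z k \<omega> - x k \<omega>))\<^sup>2 + (norm (z k \<omega> - x k \<omega>))\<^sup>2 / t k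
        + 16 * \<beta>\<^sup>2 * t k * ((norm (G (x k \<omega>)))\<^sup>2 + (norm (Ft k \<omega> - F (x k \<omega>)))\<^sup>2)"
      using t_basic(3)[of k]
      by (intro add_left_mono mult_left_mono power_mono Gt_err[OF \<omega>]) auto
    finally show "(norm (z (Suc k) \<omega> - x (Suc k) \<omega>))\<^sup>2 \<le> \<dots>" .
  qed auto
  then show ?thesis by simp
qed

lemma mean_residual_part_step: "mean_residual_part (Suc k) \<le> mean_residual_part k + (3 * \<beta> + 1) * t k * Gsq k + gapsq k / t k
    + \<beta> * (1 / \<mu> + 1) * (t k)\<^sup>2 * errsq k"
proof -
  have "mean_residual_part (Suc k) \<le> (\<integral>\<omega>. residual_part \<beta> (t k - \<mu>) (G (x k \<omega>)) (z k \<omega> - x k \<omega>)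
      + (3 * \<beta> + 1) * t k * (norm (G (x k \<omega>)))\<^sup>2 + (norm (z k \<omega> - x k \<omega>))\<^sup>2 / t k
      + \<beta> * (1 / \<mu> + 1) * (t k)\<^sup>2 * (norm (Ft k \<omega> - F (x k \<omega>)))\<^sup>2 \<partial>M)"
    unfolding mean_residual_part_def t_Suc add_diff_cancel_right'
  proof (rule integral_mono)
    fix \<omega> assume \<omega>: "\<omega> \<in> space M"
    have "0 \<le> \<Lambda> * F_gap (Suc k) \<omega>" using \<Lambda> F_mono by (simp add: F_gap_def)
    then have "residual_part \<beta> (t k) (G (x (Suc k) \<omega>)) (z (Suc k) \<omega> - x (Suc k) \<omega>)
      \<le> residual_part \<beta> (t k - \<mu>) (G (x k \<omega>)) (z k \<omega> - x k \<omega>)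
      + (3 * \<beta> + 1) * t k * (norm (G (x k \<omega>)))\<^sup>2 + (norm (z k \<omega> - x k \<omega>))\<^sup>2 / t k
      + \<beta> * (1 / \<mu> + 1) * (t k)\<^sup>2 * (norm (Gt k \<omega> - G (x k \<omega>)))\<^sup>2"
      by (rule residual_part_step[OF \<mu> t_basic(1) \<beta> refl \<eta>_eq bb gap_Suc[OF \<omega>] step_co_coercive[OF \<omega>]])
    also have "\<dots> \<le> residual_part \<beta> (t k - \<mu>) (G (x k \<omega>)) (z k \<omega> - x k \<omega>)
      + (3 * \<beta> + 1) * t k * (norm (G (x k \<omega>)))\<^sup>2 + (norm (z k \<omega> - x k \<omega>))\<^sup>2 / t k
      + \<beta> * (1 / \<mu> + 1) * (t k)\<^sup>2 * (norm (Ft k \<omega> - F (x k \<omega>)))\<^sup>2"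
      using \<mu> \<beta> by (intro add_left_mono mult_left_mono power_mono Gt_err[OF \<omega>]) auto
    finally show "residual_part \<beta> (t k) (G (x (Suc k) \<omega>)) (z (Suc k) \<omega> - x (Suc k) \<omega>) \<le> \<dots>" .
  qed (use integrable_residual_part in \<open>auto intro!: Bochner_Integration.integrable_add\<close>)
  then show ?thesis using integrable_residual_part by (simp add: mean_residual_part_def)
qed

lemma mean_residual_part_abs: "\<bar>mean_residual_part k\<bar> \<le> (\<beta> + 1) * ((t k)\<^sup>2 * Gsq k) + gapsq k"
proof -
  define s where "s = t k - \<mu>"
  have s: "1 < s" "s \<le> t k" using t_basic(1)[of k] \<mu> by (auto simp: s_def)
  have "\<bar>mean_residual_part k\<bar> \<le> (\<integral>\<omega>. \<bar>residual_part \<beta> s (G (x k \<omega>)) (z k \<omega> - x k \<omega>)\<bar> \<partial>M)"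
    unfolding mean_residual_part_def s_def by (rule integral_abs_bound)
  also have "\<dots> \<le> (\<integral>\<omega>. (\<beta> + 1) * (s\<^sup>2 * (norm (G (x k \<omega>)))\<^sup>2) + (norm (z k \<omega> - x k \<omega>))\<^sup>2 \<partial>M)"
    using integrable_residual_part residual_part_abs[OF \<beta> s(1)] by (intro integral_mono) auto
  also have "\<dots> = (\<beta> + 1) * (s\<^sup>2 * Gsq k) + gapsq k" by simp
  also have "\<dots> \<le> (\<beta> + 1) * ((t k)\<^sup>2 * Gsq k) + gapsq k"
    using s \<beta> Gsq_nonneg by (intro add_right_mono mult_left_mono mult_right_mono power_mono) auto
  finally show ?thesis .
qed

lemma mean_residual_part_low: "\<beta> / 2 * \<mu>\<^sup>2 * ((real k)\<^sup>2 * Gsq k) \<le> mean_residual_part k + (1 + 1 / \<mu>) / (2 * \<beta>) * gapsq k"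
proof -
  define s where "s = t k - \<mu>"
  have s: "1 + \<mu> \<le> s" "\<mu> * real k \<le> s - 1"
    using t_basic(1)[of k] t_ge[of k] \<mu> by (auto simp: s_def)
  have "(\<mu> * real k) * (\<mu> * real k) \<le> s * (s - 1)" using s \<mu> by (intro mult_mono) auto
  then have "\<mu>\<^sup>2 * (real k)\<^sup>2 \<le> s * (s - 1)" by (simp add: power2_eq_square mult_ac)
  then have "\<beta> / 2 * (\<mu>\<^sup>2 * (real k)\<^sup>2) * Gsq k \<le> \<beta> / 2 * (s * (s - 1)) * Gsq k"
    using \<beta> Gsq_nonneg by (intro mult_right_mono mult_left_mono) auto
  also have "\<dots> = (\<integral>\<omega>. \<beta> / 2 * (s * (s - 1)) * (norm (G (x k \<omega>)))\<^sup>2 \<partial>M)" by simp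
  also have "\<dots> \<le> (\<integral>\<omega>. residual_part \<beta> s (G (x k \<omega>)) (z k \<omega> - x k \<omega>)
      + (1 + 1 / \<mu>) / (2 * \<beta>) * (norm (z k \<omega> - x k \<omega>))\<^sup>2 \<partial>M)"
    using integrable_residual_part residual_part_lower_bound[OF \<beta> \<mu>(1) s(1)]
    by (intro integral_mono) auto
  also have "\<dots> = mean_residual_part k + (1 + 1 / \<mu>) / (2 * \<beta>) * gapsq k"
    using integrable_residual_part by (simp add: mean_residual_part_def s_def)
  finally show ?thesis by (simp add: mult_ac)
qed

abbreviation "stepsq k \<equiv> (\<integral>\<omega>. (norm (x (Suc k) \<omega> - x k \<omega>))\<^sup>2 \<partial>M)"

lemma stepsq_le:
  "stepsq k \<le> (3 / \<mu>\<^sup>2) * (gapsq k / (real k + 1)\<^sup>2) + 12 * \<beta>\<^sup>2 * (Gsq k + errsq k)"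
proof -
  have \<eta>2: "(\<eta> k)\<^sup>2 \<le> 4 * \<beta>\<^sup>2"
    using power_mono[of "\<eta> k" "2 * \<beta>" 2] \<eta>_bounds[of k] by (simp add: power_mult_distrib)
  have t2: "(1 / t k)\<^sup>2 \<le> 1 / (\<mu>\<^sup>2 * (real k + 1)\<^sup>2)"
  proof -
    have "\<mu> * (real k + 1) \<le> t k" using t_ge[of k] \<mu> by (simp add: algebra_simps)
    then have "(\<mu> * (real k + 1))\<^sup>2 \<le> (t k)\<^sup>2" using \<mu> by (intro power_mono) auto
    then show ?thesis
      using \<mu> t_basic(3)[of k] by (simp add: power_mult_distrib power_divide frac_le)
  qed
  have "stepsq k \<le> (\<integral>\<omega>. (3 / \<mu>\<^sup>2) * ((norm (z k \<omega> - x k \<omega>))\<^sup>2 / (real k + 1)\<^sup>2)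
      + 12 * \<beta>\<^sup>2 * ((norm (G (x k \<omega>)))\<^sup>2 + (norm (Ft k \<omega> - F (x k \<omega>)))\<^sup>2) \<partial>M)"
  proof (rule integral_mono)
    show "integrable M (\<lambda>\<omega>. (norm (x (Suc k) \<omega> - x k \<omega>))\<^sup>2)"
      using sq_integrable_diff[OF sq_integrable_x sq_integrable_x] by (simp add: sq_integrable_def)
  next
    fix \<omega> assume \<omega>: "\<omega> \<in> space M"
    let ?e = "Gt k \<omega> - G (x k \<omega>)"
    have "x (Suc k) \<omega> - x k \<omega> = (1 / t k) *\<^sub>R (z k \<omega> - x k \<omega>) + (- \<eta> k) *\<^sub>R G (x k \<omega>) + (- \<eta> k) *\<^sub>R ?e"
      using x_Suc[OF \<omega>, of k] by (simp add: algebra_simps)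
    then have "(norm (x (Suc k) \<omega> - x k \<omega>))\<^sup>2 \<le> 3 * ((1 / t k)\<^sup>2 * (norm (z k \<omega> - x k \<omega>))\<^sup>2)
        + 3 * ((\<eta> k)\<^sup>2 * (norm (G (x k \<omega>)))\<^sup>2) + 3 * ((\<eta> k)\<^sup>2 * (norm ?e)\<^sup>2)"
      using norm_add3_sq_le[of "(1 / t k) *\<^sub>R (z k \<omega> - x k \<omega>)" "(- \<eta> k) *\<^sub>R G (x k \<omega>)" "(- \<eta> k) *\<^sub>R ?e"]
      by (simp only: norm_scaleR power_mult_distrib power2_abs power2_minus)
    also have "\<dots> \<le> 3 * (1 / (\<mu>\<^sup>2 * (real k + 1)\<^sup>2) * (norm (z k \<omega> - x k \<omega>))\<^sup>2)
        + 3 * (4 * \<beta>\<^sup>2 * (norm (G (x k \<omega>)))\<^sup>2) + 3 * (4 * \<beta>\<^sup>2 * (norm (Ft k \<omega> - F (x k \<omega>)))\<^sup>2)"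
      using t2 \<eta>2 Gt_err[OF \<omega>, of k]
      by (intro add_mono mult_left_mono mult_mono power_mono) auto
    also have "\<dots> = (3 / \<mu>\<^sup>2) * ((norm (z k \<omega> - x k \<omega>))\<^sup>2 / (real k + 1)\<^sup>2)
      + 12 * \<beta>\<^sup>2 * ((norm (G (x k \<omega>)))\<^sup>2 + (norm (Ft k \<omega> - F (x k \<omega>)))\<^sup>2)"
      by (simp add: algebra_simps)
    finally show "(norm (x (Suc k) \<omega> - x k \<omega>))\<^sup>2 \<le> \<dots>" .
  qed auto
  then show ?thesis by simp
qed

context
  fixes xs assumes xs: "G xs = 0" and sn: "summable noise"
begin

lemma summable_Gsq: "summable (\<lambda>k. (real k + 1) * Gsq k)"
proof -
  have "summable (\<lambda>k. real k * Gsq k)"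
    by (rule summable_of_scaled_bound[OF energy_bounded(2)[OF xs sn] _ _ dissipation_lower_bounds(1)])
      (use \<beta> \<mu> Gsq_nonneg in auto)
  then have "summable (\<lambda>k. 2 * (real k * Gsq k))" by (rule summable_mult)
  then show ?thesis
  proof (rule summable_comparison_test_ev[rotated])
    show "\<forall>\<^sub>F k in sequentially. norm ((real k + 1) * Gsq k) \<le> 2 * (real k * Gsq k)"
      using eventually_ge_at_top[of 1]
    proof eventually_elim
      case (elim k)
      then have "(real k + 1) * Gsq k \<le> (2 * real k) * Gsq k"
        using Gsq_nonneg by (intro mult_right_mono) auto
      then show ?case using Gsq_nonneg[of k] by (simp add: abs_mult)
    qed
  qed
qed

lemma summable_gapsq: "summable (\<lambda>k. gapsq k / (real k + 1))"
  by (rule summable_of_scaled_bound[OF energy_bounded(2)[OF xs sn] _ _ dissipation_lower_bounds(2)])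
    (use \<beta> \<mu> r_pos gapsq_nonneg in auto)

lemma summable_errsq: "summable (\<lambda>k. (real k + 1)\<^sup>2 * errsq k)"
proof (rule summable_of_scaled_bound[OF energy_bounded(2)[OF xs sn] _ _ dissipation_lower_bounds(3)])
  have "0 < 3 / (2 * \<mu>) - 9 / 4" using \<mu> by (simp add: field_simps)
  then show "0 < (3 / (2 * \<mu>) - 9 / 4) * \<beta> * \<mu>\<^sup>2" using \<beta> \<mu> by simp
qed (use errsq_nonneg in auto)

lemma gap_and_residual_vanish:
  "gapsq \<longlonglongrightarrow> 0" "(\<lambda>k. (real k)\<^sup>2 * Gsq k) \<longlonglongrightarrow> 0"
proof -
  define m where "m = \<mu> * r"
  have m: "0 < m" using \<mu> r_pos by (simp add: m_def)
  define C1 C2 C3 C4 C5 where "C1 = 16 * \<beta>\<^sup>2 * m" and "C2 = (3 * \<beta> + 1) * m"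
    and "C3 = \<beta> * (1 / \<mu> + 1) * m\<^sup>2" and "C4 = (\<beta> + 1) * m\<^sup>2 + 1"
    and "C5 = (1 + 1 / \<mu>) / (2 * \<beta>)"
  define C where "C = 1 / \<mu> + C1 + C2 + C3 + C4 + C5"
  have pos: "0 \<le> 1 / \<mu>" "0 \<le> C1" "0 \<le> C2" "0 \<le> C3" "1 \<le> C4" "0 \<le> C5"
    using \<mu> \<beta> m by (auto simp: C1_def C2_def C3_def C4_def C5_def)
  then have C: "0 \<le> C" "1 / \<mu> \<le> C" "C1 \<le> C" "C2 \<le> C" "C3 \<le> C" "C4 \<le> C" "C5 \<le> C" by (auto simp: C_def)
  have tm: "t k \<le> m * (real k + 1)" for k using t_le[of k] by (simp add: m_def)
  have gt: "gapsq k / t k \<le> C * (gapsq k / (real k + 1))" for k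
  proof -
    have "\<mu> * (real k + 1) \<le> t k" using t_ge[of k] \<mu> by (simp add: algebra_simps)
    then have "gapsq k / t k \<le> gapsq k / (\<mu> * (real k + 1))"
      using \<mu> gapsq_nonneg by (intro divide_left_mono) (auto intro!: mult_pos_pos t_basic)
    also have "\<dots> = (1 / \<mu>) * (gapsq k / (real k + 1))" by simp
    also have "\<dots> \<le> C * (gapsq k / (real k + 1))"
      using C gapsq_nonneg by (intro mult_right_mono) auto
    finally show ?thesis .
  qed
  have tG: "q * t k * Gsq k \<le> C * ((real k + 1) * Gsq k)" if "0 \<le> q" "q * m \<le> C" for q k
  proof -
    have "q * t k * Gsq k \<le> q * (m * (real k + 1)) * Gsq k"
      using that tm Gsq_nonneg by (intro mult_right_mono mult_left_mono) auto
    also have "\<dots> = (q * m) * ((real k + 1) * Gsq k)" by simp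
    also have "\<dots> \<le> C * ((real k + 1) * Gsq k)"
      using that Gsq_nonneg by (intro mult_right_mono) auto
    finally show ?thesis .
  qed
  have te: "q * t k * errsq k \<le> C * ((real k + 1)\<^sup>2 * errsq k)" if "0 \<le> q" "q * m \<le> C" for q k
  proof -
    have "q * t k * errsq k \<le> q * (m * (real k + 1)) * errsq k"
      using that tm errsq_nonneg by (intro mult_right_mono mult_left_mono) auto
    also have "\<dots> = (q * m) * ((real k + 1) * errsq k)" by simp
    also have "\<dots> \<le> C * ((real k + 1) * errsq k)"
      using that errsq_nonneg by (intro mult_right_mono) auto
    also have "\<dots> \<le> C * ((real k + 1)\<^sup>2 * errsq k)"
      using C errsq_nonneg by (intro mult_left_mono mult_right_mono) (auto simp: power2_eq_square)
    finally show ?thesis .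
  qed
  have tsq: "(t k)\<^sup>2 \<le> m\<^sup>2 * (real k + 1)\<^sup>2" for k
    using power_mono[OF tm, of k 2] t_basic(3)[of k] by (simp add: power_mult_distrib)
  have te2: "\<beta> * (1 / \<mu> + 1) * (t k)\<^sup>2 * errsq k \<le> C * ((real k + 1)\<^sup>2 * errsq k)" for k
  proof -
    have "\<beta> * (1 / \<mu> + 1) * (t k)\<^sup>2 * errsq k
        \<le> \<beta> * (1 / \<mu> + 1) * (m\<^sup>2 * (real k + 1)\<^sup>2) * errsq k"
      using \<beta> \<mu> tsq errsq_nonneg by (intro mult_right_mono mult_left_mono) auto
    also have "\<dots> = C3 * ((real k + 1)\<^sup>2 * errsq k)" by (simp add: C3_def)
    also have "\<dots> \<le> C * ((real k + 1)\<^sup>2 * errsq k)"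
      using C errsq_nonneg by (intro mult_right_mono) auto
    finally show ?thesis .
  qed
  have b_step: "gapsq (Suc k) \<le> gapsq k
      + C * ((real k + 1) * Gsq k + gapsq k / (real k + 1) + (real k + 1)\<^sup>2 * errsq k)" for k
    using gapsq_step[of k] gt[of k] tG[of "16 * \<beta>\<^sup>2" k] te[of "16 * \<beta>\<^sup>2" k] C \<beta>
    by (simp add: C1_def distrib_left)
  have u_step: "mean_residual_part (Suc k) \<le> mean_residual_part k
      + C * ((real k + 1) * Gsq k + gapsq k / (real k + 1) + (real k + 1)\<^sup>2 * errsq k)" for k
    using mean_residual_part_step[of k] gt[of k] tG[of "3 * \<beta> + 1" k] te2[of k] C \<beta>
    by (simp add: C2_def distrib_left)
  have u_abs: "\<bar>mean_residual_part k\<bar> \<le> C * ((real k + 1)\<^sup>2 * Gsq k + gapsq k)" for k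
  proof -
    have "(\<beta> + 1) * ((t k)\<^sup>2 * Gsq k) \<le> (\<beta> + 1) * ((m\<^sup>2 * (real k + 1)\<^sup>2) * Gsq k)"
      using \<beta> tsq Gsq_nonneg by (intro mult_right_mono mult_left_mono) auto
    also have "\<dots> = ((\<beta> + 1) * m\<^sup>2) * ((real k + 1)\<^sup>2 * Gsq k)" by simp
    also have "\<dots> \<le> C * ((real k + 1)\<^sup>2 * Gsq k)"
      using C Gsq_nonneg by (intro mult_right_mono) (auto simp: C4_def)
    finally have "(\<beta> + 1) * ((t k)\<^sup>2 * Gsq k) \<le> C * ((real k + 1)\<^sup>2 * Gsq k)" .
    moreover have "1 * gapsq k \<le> C * gapsq k"
      using C pos gapsq_nonneg by (intro mult_right_mono) auto
    ultimately show ?thesis using mean_residual_part_abs[of k] by (simp add: distrib_left)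
  qed
  have u_low: "\<beta> / 2 * \<mu>\<^sup>2 * ((real k)\<^sup>2 * Gsq k) \<le> mean_residual_part k + C * gapsq k" for k
    using mean_residual_part_low[of k] mult_right_mono[OF C(7) gapsq_nonneg[of k]]
    unfolding C5_def[symmetric] by linarith
  have d: "0 < \<beta> / 2 * \<mu>\<^sup>2" using \<beta> \<mu> by simp
  note rates = little_o_rates[where a=Gsq and b=gapsq and c=errsq and U=mean_residual_part, OF Gsq_nonneg gapsq_nonneg
      summable_Gsq summable_gapsq summable_errsq C(1) b_step u_step u_abs u_low d]
  show "gapsq \<longlonglongrightarrow> 0" by (rule rates(1))
  show "(\<lambda>k. (real k)\<^sup>2 * Gsq k) \<longlonglongrightarrow> 0" by (rule rates(2))
qed

lemma summable_stepsq: "summable (\<lambda>k. (real k + 1) * stepsq k)"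
proof (rule summable_comparison_test')
  show "summable (\<lambda>k. (3 / \<mu>\<^sup>2) * (gapsq k / (real k + 1))
      + 12 * \<beta>\<^sup>2 * ((real k + 1) * Gsq k + (real k + 1)\<^sup>2 * errsq k))"
    by (intro summable_add summable_mult summable_Gsq summable_gapsq summable_errsq)
  have scale: "w * (A * (b / w\<^sup>2) + B * (a + e)) = A * (b / w) + B * (w * a + w * e)"
    if "w \<noteq> 0" for w A b B a e :: real
    using that by (simp add: field_simps power2_eq_square)
  show "norm ((real k + 1) * stepsq k) \<le> (3 / \<mu>\<^sup>2) * (gapsq k / (real k + 1))
      + 12 * \<beta>\<^sup>2 * ((real k + 1) * Gsq k + (real k + 1)\<^sup>2 * errsq k)" for k
  proof -
    have "(real k + 1) * stepsq k \<le> (real k + 1) *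
        ((3 / \<mu>\<^sup>2) * (gapsq k / (real k + 1)\<^sup>2) + 12 * \<beta>\<^sup>2 * (Gsq k + errsq k))"
      by (intro mult_left_mono stepsq_le) auto
    also have "\<dots> = (3 / \<mu>\<^sup>2) * (gapsq k / (real k + 1))
        + 12 * \<beta>\<^sup>2 * ((real k + 1) * Gsq k + (real k + 1) * errsq k)"
      by (rule scale) simp
    also have "\<dots> \<le> (3 / \<mu>\<^sup>2) * (gapsq k / (real k + 1))
      + 12 * \<beta>\<^sup>2 * ((real k + 1) * Gsq k + (real k + 1)\<^sup>2 * errsq k)"
      using errsq_nonneg
      by (intro add_left_mono mult_left_mono mult_right_mono) (auto simp: power2_eq_square)
    finally show ?thesis by (simp add: Bochner_Integration.integral_nonneg)
  qed
qed

lemma stepsq_vanish: "(\<lambda>k. (real k)\<^sup>2 * stepsq k) \<longlonglongrightarrow> 0"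
proof -
  have "(\<lambda>k. (3 / \<mu>\<^sup>2) * gapsq k + 12 * \<beta>\<^sup>2 * ((real k)\<^sup>2 * Gsq k + (real k + 1)\<^sup>2 * errsq k))
      \<longlonglongrightarrow> (3 / \<mu>\<^sup>2) * 0 + 12 * \<beta>\<^sup>2 * (0 + 0)"
    by (intro tendsto_intros gap_and_residual_vanish summable_LIMSEQ_zero summable_errsq)
  then have lim: "(\<lambda>k. (3 / \<mu>\<^sup>2) * gapsq k
      + 12 * \<beta>\<^sup>2 * ((real k)\<^sup>2 * Gsq k + (real k + 1)\<^sup>2 * errsq k)) \<longlonglongrightarrow> 0" by simp
  show ?thesis
  proof (rule tendsto_sandwich[OF _ _ tendsto_const lim])
    show "\<forall>\<^sub>F k in sequentially. 0 \<le> (real k)\<^sup>2 * stepsq k"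
      by (simp add: Bochner_Integration.integral_nonneg)
    have "(real k)\<^sup>2 * stepsq k \<le> (3 / \<mu>\<^sup>2) * gapsq k
      + 12 * \<beta>\<^sup>2 * ((real k)\<^sup>2 * Gsq k + (real k + 1)\<^sup>2 * errsq k)" for k
    proof -
      have "(real k)\<^sup>2 * stepsq k \<le> (real k)\<^sup>2 *
          ((3 / \<mu>\<^sup>2) * (gapsq k / (real k + 1)\<^sup>2) + 12 * \<beta>\<^sup>2 * (Gsq k + errsq k))"
        by (intro mult_left_mono stepsq_le) auto
      also have "\<dots> = (3 / \<mu>\<^sup>2) * (gapsq k * ((real k)\<^sup>2 / (real k + 1)\<^sup>2))
          + 12 * \<beta>\<^sup>2 * ((real k)\<^sup>2 * Gsq k + (real k)\<^sup>2 * errsq k)"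
        by (simp add: distrib_left)
      also have "\<dots> \<le> (3 / \<mu>\<^sup>2) * (gapsq k * 1)
          + 12 * \<beta>\<^sup>2 * ((real k)\<^sup>2 * Gsq k + (real k + 1)\<^sup>2 * errsq k)"
        using errsq_nonneg gapsq_nonneg
        by (intro add_mono add_left_mono mult_left_mono mult_right_mono) (auto intro!: power_mono)
      finally show ?thesis by simp
    qed
    then show "\<forall>\<^sub>F k in sequentially. (real k)\<^sup>2 * stepsq k \<le> (3 / \<mu>\<^sup>2) * gapsq k
      + 12 * \<beta>\<^sup>2 * ((real k)\<^sup>2 * Gsq k + (real k + 1)\<^sup>2 * errsq k)"
      by simp
  qed
qed

end

end

section \<open>From conditional variance reduction to the rates\<close>

lemma history_subalgebra:
  assumes "\<And>k. \<zeta> k \<in> measurable M (N k)"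
  shows "subalgebra M (history M N \<zeta> k)"
proof -
  have "(\<Union>j\<in>{..<k}. {\<zeta> j -` A \<inter> space M | A. A \<in> sets (N j)}) \<subseteq> sets M"
    using assms by (auto intro: measurable_sets)
  then show ?thesis
    unfolding subalgebra_def history_def
    by (auto simp: space_measure_of_conv sets_measure_of_conv intro!: sets.sigma_sets_subset
        dest: sets.sets_into_space)
qed

text \<open>
Integrating the conditional inequalities.  The mean squared difference between the iterates is bounded before
integration by the co-coercivity of \<open>F\<close>.
\<close>

lemma VR_property_integrated:
  fixes x Ft :: "nat \<Rightarrow> 'a \<Rightarrow> 'v::euclidean_space"
  assumes M: "prob_space M" and sub: "\<And>k. subalgebra M (\<F> k)"
    and Q: "admissible_setting Q" "mean_co_coercive L Q" "0 < L"
    and VR: "VR_property M \<F> Q x Ft \<Delta> \<kappa> \<Theta> \<sigma>"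
    and meas: "(\<lambda>\<omega>. Ft k \<omega> - mean_op Q (x k \<omega>)) \<in> borel_measurable M"
    and prev: "integrable M (if k = 0 then (\<lambda>_. 0) else \<Delta> (k - 1))"
    and gap: "integrable M (\<lambda>\<omega>. inner (mean_op Q (x k \<omega>) - mean_op Q (x (k - 1) \<omega>)) (x k \<omega> - x (k - 1) \<omega>))"
  shows "integrable M (\<lambda>\<omega>. (norm (Ft k \<omega> - mean_op Q (x k \<omega>)))\<^sup>2) \<and> integrable M (\<Delta> k) \<and>
    (\<integral>\<omega>. (norm (Ft k \<omega> - mean_op Q (x k \<omega>)))\<^sup>2 \<partial>M) \<le> (\<integral>\<omega>. \<Delta> k \<omega> \<partial>M) \<and>
    (\<integral>\<omega>. \<Delta> k \<omega> \<partial>M) \<le> (1 - \<kappa> k) * (if k = 0 then 0 else \<integral>\<omega>. \<Delta> (k - 1) \<omega> \<partial>M)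
      + \<Theta> k * (L * (\<integral>\<omega>. inner (mean_op Q (x k \<omega>) - mean_op Q (x (k - 1) \<omega>)) (x k \<omega> - x (k - 1) \<omega>) \<partial>M))
      + (\<sigma> k)\<^sup>2"
proof -
  interpret prob_space M by (rule M)
  interpret finite_measure_subalgebra M "\<F> k"
    by unfold_locales (rule sub)
  define p where "p = (if k = 0 then (\<lambda>_. 0) else \<Delta> (k - 1))"
  define g where "g = (\<lambda>\<omega>. inner (mean_op Q (x k \<omega>) - mean_op Q (x (k - 1) \<omega>)) (x k \<omega> - x (k - 1) \<omega>))"
  define w where "w = (\<lambda>\<omega>. (1 - \<kappa> k) * p \<omega> + \<Theta> k * (L * g \<omega>) + (\<sigma> k)\<^sup>2)"
  have par: "\<kappa> k \<le> 1" "0 \<le> \<Theta> k" and [measurable]: "\<Delta> k \<in> borel_measurable M"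
    using VR by (auto simp: VR_property_def)
  have ae: "AE \<omega> in M. \<forall>k. 0 \<le> \<Delta> k \<omega> \<and>
      nn_cond_exp M (\<F> k) (\<lambda>\<omega>. ennreal ((norm (Ft k \<omega> - mean_op Q (x k \<omega>)))\<^sup>2)) \<omega>
        \<le> nn_cond_exp M (\<F> k) (\<lambda>\<omega>. ennreal (\<Delta> k \<omega>)) \<omega> \<and>
      nn_cond_exp M (\<F> k) (\<lambda>\<omega>. ennreal (\<Delta> k \<omega>)) \<omega>
        \<le> ennreal ((1 - \<kappa> k) * (if k = 0 then 0 else \<Delta> (k - 1) \<omega>)
                   + \<Theta> k * mean_sq_diff Q (x k \<omega>) (x (k - 1) \<omega>) + (\<sigma> k)\<^sup>2)"
    using VR unfolding VR_property_def by blast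
  have \<Delta>0: "AE \<omega> in M. 0 \<le> \<Delta> k \<omega>" using ae by eventually_elim blast
  have g: "mean_sq_diff Q (x k \<omega>) (x (k - 1) \<omega>) \<le> L * g \<omega>" for \<omega>
    unfolding g_def by (rule mean_op_co_coercive(2)[OF Q])
  have g0: "0 \<le> L * g \<omega>" for \<omega>
    unfolding g_def by (rule order_trans[OF zero_le_power2 mean_op_co_coercive(1)[OF Q]])
  have p_int: "integrable M p" using prev by (simp only: p_def)
  have g_int: "integrable M g" using gap by (simp only: g_def)
  have w: "integrable M w" unfolding w_def using p_int g_int by simp
  have p0: "AE \<omega> in M. 0 \<le> p \<omega>" using ae by eventually_elim (simp add: p_def)
  then have w0: "AE \<omega> in M. 0 \<le> w \<omega>"
    by eventually_elim (use par g0 in \<open>simp add: w_def\<close>)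
  have le_w: "AE \<omega> in M. nn_cond_exp M (\<F> k) (\<lambda>\<omega>. ennreal (\<Delta> k \<omega>)) \<omega> \<le> ennreal (w \<omega>)"
    using ae
  proof eventually_elim
    case (elim \<omega>)
    have p_eq: "p \<omega> = (if k = 0 then 0 else \<Delta> (k - 1) \<omega>)" by (simp add: p_def)
    have "nn_cond_exp M (\<F> k) (\<lambda>\<omega>. ennreal (\<Delta> k \<omega>)) \<omega>
        \<le> ennreal ((1 - \<kappa> k) * p \<omega> + \<Theta> k * mean_sq_diff Q (x k \<omega>) (x (k - 1) \<omega>) + (\<sigma> k)\<^sup>2)"
      unfolding p_eq using spec[OF elim, of k] by blast
    also have "\<dots> \<le> ennreal (w \<omega>)"
      unfolding w_def using par g by (intro ennreal_leI add_mono mult_left_mono order_refl) auto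
    finally show ?case .
  qed
  have \<Delta>: "integrable M (\<Delta> k)" "(\<integral>\<omega>. \<Delta> k \<omega> \<partial>M) \<le> (\<integral>\<omega>. w \<omega> \<partial>M)"
    using integrable_of_nn_cond_exp_le[OF _ \<Delta>0 w w0 le_w] by auto
  have "AE \<omega> in M. nn_cond_exp M (\<F> k) (\<lambda>\<omega>. ennreal ((norm (Ft k \<omega> - mean_op Q (x k \<omega>)))\<^sup>2)) \<omega>
        \<le> nn_cond_exp M (\<F> k) (\<lambda>\<omega>. ennreal (\<Delta> k \<omega>)) \<omega>"
    using ae by eventually_elim blast
  from integrable_of_nn_cond_exp_le_nn_cond_exp[OF _ _ \<Delta>(1) \<Delta>0 this] meas
  have err: "integrable M (\<lambda>\<omega>. (norm (Ft k \<omega> - mean_op Q (x k \<omega>)))\<^sup>2)"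
    "(\<integral>\<omega>. (norm (Ft k \<omega> - mean_op Q (x k \<omega>)))\<^sup>2 \<partial>M) \<le> (\<integral>\<omega>. \<Delta> k \<omega> \<partial>M)"
    by auto
  have "(\<integral>\<omega>. w \<omega> \<partial>M) = (1 - \<kappa> k) * (\<integral>\<omega>. p \<omega> \<partial>M) + \<Theta> k * (L * (\<integral>\<omega>. g \<omega> \<partial>M)) + (\<sigma> k)\<^sup>2"
    unfolding w_def using p_int g_int by (simp add: prob_space)
  moreover have "(\<integral>\<omega>. p \<omega> \<partial>M) = (if k = 0 then 0 else \<integral>\<omega>. \<Delta> (k - 1) \<omega> \<partial>M)"
    by (simp add: p_def)
  ultimately show ?thesis using \<Delta> err by (simp add: g_def)
qed

theorem theorem13:
  fixes M :: "'a measure"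
    and N :: "nat \<Rightarrow> 'b measure"
    and \<zeta> :: "nat \<Rightarrow> 'a \<Rightarrow> 'b"
    and Q :: "(real ^ 'p, 's) setting"
    and F :: "real ^ 'p \<Rightarrow> real ^ 'p"
    and T \<Phi> :: "real ^ 'p \<Rightarrow> (real ^ 'p) set"
    and x0 :: "real ^ 'p"
    and x y z Ft :: "nat \<Rightarrow> 'a \<Rightarrow> real ^ 'p"
    and G :: "real ^ 'p \<Rightarrow> real ^ 'p"
    and \<Delta> :: "nat \<Rightarrow> 'a \<Rightarrow> real"
    and \<kappa> \<Theta> \<sigma> \<eta> :: "nat \<Rightarrow> real"
    and \<Gamma> t :: "int \<Rightarrow> real"
    and L Lhat \<rho> lam \<mu> r \<nu> \<beta> \<beta>bar \<Lambda> B :: real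
    and \<Psi>0sq :: "real ^ 'p \<Rightarrow> real"
    and E0sq :: real
  assumes prob: "prob_space M"
    and samples: "\<And>k. \<zeta> k \<in> measurable M (N k)"
    and setting: "admissible_setting Q"
    and F_eq: "F = mean_op Q"
    and \<Phi>_eq: "\<Phi> = sum_op F T"
    and zer_nonempty: "zer_op \<Phi> \<noteq> {}"
    and \<rho>_nonneg: "\<rho> \<ge> 0"
    and T_max: "maximally_co_hypomonotone \<rho> T"
    and L_pos: "L > 0"
    and F_coco: "mean_co_coercive L Q"
    and L\<rho>: "L * \<rho> < 1"
    and Lhat: "Lhat > L" "Lhat * \<rho> < 1"
    and lam_pos: "lam > 0"
    and G_eq: "G = fb_residual lam F T"
    and \<beta>bar_eq: "\<beta>bar = (lam * (4 - Lhat * lam) - 4 * \<rho>) / (4 * (1 - \<rho> * Lhat))"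
    and \<Lambda>_eq: "\<Lambda> = (Lhat - L) / (L * Lhat)"
    and x0_dom: "x0 \<in> dom_op \<Phi>"
    and iteration: "VFOSA_plus M lam T t \<eta> \<nu> Ft x0 x y z"
    and estimator: "\<And>k. Ft k \<in> borel_measurable (history M N \<zeta> (Suc k))"
    and VR: "VR_property M (history M N \<zeta>) Q x Ft \<Delta> \<kappa> \<Theta> \<sigma>"
    and \<Theta>_pos: "\<And>k. \<Theta> k > 0"
    and lam_range: "2 * \<rho> \<le> lam" "lam < 2 * (1 + sqrt (1 - Lhat * \<rho>)) / Lhat"
    and \<mu>_range: "0 < \<mu>" "\<mu> < 2 / 3"
    and r_ge: "r \<ge> 2 + 1 / \<mu>"
    and \<nu>_eq: "\<nu> = \<mu> / 2"
    and \<beta>_range: "0 < \<beta>" "\<beta> \<le> (2 - \<mu>) * \<beta>bar / (2 + \<mu>)"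
    and t_eq: "\<And>k. t k = \<mu> * (of_int k + r)"
    and \<eta>_eq: "\<And>k. \<eta> k = 2 * \<beta> * (t (int k) - 1) / (t (int k) - \<nu>)"
    and \<Gamma>_pos: "\<And>k. k \<ge> -1 \<Longrightarrow> \<Gamma> k > 0"
    and \<kappa>_ge: "\<And>k. \<kappa> k \<ge> 1
        - (\<Gamma> (int k - 1) * t (int k - 2) * (t (int k - 2) - 1))
            / (\<Gamma> (int k) * t (int k - 1) * (t (int k - 1) - 1))
        + 5 * \<beta> / (\<mu> * \<Gamma> (int k))"
    and \<Gamma>\<Theta>: "\<And>k. \<Gamma> (int k) * \<Theta> k \<le> 2 * \<Lambda>"
    and B_finite: "summable (\<lambda>k. t (int k - 1) * (t (int k - 1) - 1) * ((\<sigma> k)\<^sup>2 / \<Theta> k))"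
    and B_eq: "B = \<Lambda> / \<beta> * (\<Sum>k. t (int k - 1) * (t (int k - 1) - 1) * ((\<sigma> k)\<^sup>2 / \<Theta> k))"
    and \<Psi>0sq_eq: "\<And>xs. \<Psi>0sq xs =
        \<mu>\<^sup>2 * r\<^sup>2 * (\<integral>\<omega>. (norm (G (x 0 \<omega>)))\<^sup>2 \<partial>M)
        + (2 * r - 1) / (4 * \<beta>\<^sup>2 * (\<mu> * r - 1)) * (norm (x0 - xs))\<^sup>2"
    and E0sq_eq: "E0sq = \<mu> * r\<^sup>2 * (\<Gamma> 0 * \<mu> + \<beta>) / (2 * \<beta>) * (\<sigma> 0)\<^sup>2"
  shows "(\<forall>k. integrable M (\<lambda>\<omega>. (norm (G (x k \<omega>)))\<^sup>2)) \<and>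
    (\<forall>k. integrable M (\<lambda>\<omega>. (norm (Ft k \<omega> - F (x k \<omega>)))\<^sup>2)) \<and>
    (\<forall>k. integrable M (\<lambda>\<omega>. (norm (x (k + 1) \<omega> - x k \<omega>))\<^sup>2)) \<and>
    (\<forall>xs \<in> zer_op \<Phi>. \<forall>k.
       (\<integral>\<omega>. (norm (G (x k \<omega>)))\<^sup>2 \<partial>M)
         \<le> 2 * (\<Psi>0sq xs + E0sq + B) / (\<mu>\<^sup>2 * (real k + r - 1)\<^sup>2)) \<and>
    summable (\<lambda>k. (real k + 1) * (\<integral>\<omega>. (norm (G (x k \<omega>)))\<^sup>2 \<partial>M)) \<and>
    summable (\<lambda>k. (real k + 1)\<^sup>2 * (\<integral>\<omega>. (norm (Ft k \<omega> - F (x k \<omega>)))\<^sup>2 \<partial>M)) \<and>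
    summable (\<lambda>k. (real k + 1) * (\<integral>\<omega>. (norm (x (k + 1) \<omega> - x k \<omega>))\<^sup>2 \<partial>M)) \<and>
    (\<lambda>k. (real k)\<^sup>2 * (\<integral>\<omega>. (norm (x (k + 1) \<omega> - x k \<omega>))\<^sup>2 \<partial>M)) \<longlonglongrightarrow> 0 \<and>
    (\<lambda>k. (real k)\<^sup>2 * (\<integral>\<omega>. (norm (G (x k \<omega>)))\<^sup>2 \<partial>M)) \<longlonglongrightarrow> 0"
proof -
  interpret prob_space M by (rule prob)
  define tn where "tn = (\<lambda>k. t (int k))"
  define Gn where "Gn = (\<lambda>k. \<Gamma> (int k))"
  define Gt where "Gt = (\<lambda>k \<omega>. fb_step lam T (x k \<omega>) (Ft k \<omega>))"
  have rl: "0 < lam" "\<rho> < lam" "2 * \<rho> \<le> lam" using lam_pos lam_range \<rho>_nonneg by auto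
  note res = T_max rl
  have tn_eq: "tn k = \<mu> * (real k + r)" for k by (simp add: tn_def t_eq)
  have t_minus_1: "t (- 1) = tn 0 - \<mu>" by (simp add: tn_def t_eq algebra_simps)
  have tn_pos: "0 < tn k" for k
  proof -
    have "0 < 1 / \<mu>" using \<mu>_range by simp
    then have "0 < real k + r" using r_ge by linarith
    then show ?thesis using \<mu>_range by (simp add: tn_eq)
  qed
  have F_coco': "(norm (F u - F v))\<^sup>2 \<le> L * inner (F u - F v) (u - v)" for u v
    unfolding F_eq by (rule mean_op_co_coercive(1)[OF setting F_coco L_pos])
  have G_coco: "\<beta>bar * (norm (G u - G v))\<^sup>2 + \<Lambda> * (L * inner (F u - F v) (u - v))
      \<le> inner (G u - G v) (u - v)" for u v
    by (rule fb_residual_co_coercive[OF res F_coco' L_pos Lhat \<beta>bar_eq \<Lambda>_eq G_eq])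
  have \<Lambda>0: "0 \<le> \<Lambda>" using Lhat L_pos by (simp add: \<Lambda>_eq)
  have bb: "\<beta> * ((2 + \<mu>) / (2 - \<mu>)) \<le> \<beta>bar"
    using \<beta>_range \<mu>_range by (simp add: field_simps)
  have sub: "subalgebra M (history M N \<zeta> k)" for k
    by (rule history_subalgebra[OF samples])
  have Ft_meas: "Ft k \<in> borel_measurable M" for k
    by (rule measurable_from_subalg[OF sub estimator])
  have it: "x 0 \<omega> = x0" "z 0 \<omega> = x0"
    "y k \<omega> = ((tn k - 1) / tn k) *\<^sub>R x k \<omega> + (1 / tn k) *\<^sub>R z k \<omega>"
    "x (Suc k) \<omega> = y k \<omega> - \<eta> k *\<^sub>R Gt k \<omega>"
    "z (Suc k) \<omega> = z k \<omega> + \<nu> *\<^sub>R (x (Suc k) \<omega> - y k \<omega>)"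
    if "\<omega> \<in> space M" for k \<omega>
    using iteration that unfolding VFOSA_plus_def Gt_def tn_def by blast+
  have x_Suc: "x (Suc k) \<omega> = x k \<omega> + (1 / tn k) *\<^sub>R (z k \<omega> - x k \<omega>) - \<eta> k *\<^sub>R Gt k \<omega>"
    if "\<omega> \<in> space M" for k \<omega>
  proof -
    have "y k \<omega> = x k \<omega> + (1 / tn k) *\<^sub>R (z k \<omega> - x k \<omega>)"
      using it(3)[OF that, of k] tn_pos[of k] by (simp add: diff_divide_distrib algebra_simps)
    then show ?thesis using it(4)[OF that, of k] by simp
  qed
  have z_Suc: "z (Suc k) \<omega> = z k \<omega> - (\<mu> / 2 * \<eta> k) *\<^sub>R Gt k \<omega>" if "\<omega> \<in> space M" for k \<omega>
    using it(4,5)[OF that, of k] by (simp add: \<nu>_eq)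
  have meas: "x k \<in> borel_measurable M \<and> z k \<in> borel_measurable M" for k
  proof (induction k)
    case 0
    have "x 0 \<in> borel_measurable M \<longleftrightarrow> (\<lambda>_. x0) \<in> borel_measurable M"
      "z 0 \<in> borel_measurable M \<longleftrightarrow> (\<lambda>_. x0) \<in> borel_measurable M"
      by (rule measurable_cong; simp add: it)+
    then show ?case by simp
  next
    case (Suc k)
    then have [measurable]: "x k \<in> borel_measurable M" "z k \<in> borel_measurable M" by auto
    have [measurable]: "Gt k \<in> borel_measurable M"
      unfolding Gt_def by (intro fb_step_measurable[OF res] Ft_meas) measurable
    have "x (Suc k) \<in> borel_measurable M \<longleftrightarrow>
        (\<lambda>\<omega>. x k \<omega> + (1 / tn k) *\<^sub>R (z k \<omega> - x k \<omega>) - \<eta> k *\<^sub>R Gt k \<omega>) \<in> borel_measurable M"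
      by (rule measurable_cong) (rule x_Suc)
    moreover have "z (Suc k) \<in> borel_measurable M \<longleftrightarrow>
        (\<lambda>\<omega>. z k \<omega> - (\<mu> / 2 * \<eta> k) *\<^sub>R Gt k \<omega>) \<in> borel_measurable M"
      by (rule measurable_cong) (rule z_Suc)
    ultimately show ?case by simp
  qed
  have Gt_meas: "Gt k \<in> borel_measurable M" for k
    unfolding Gt_def using meas by (intro fb_step_measurable[OF res] Ft_meas) auto
  have F_meas [measurable]: "F \<in> borel_measurable borel"
    by (rule lipschitz_measurable[OF co_coercive_imp_lipschitz[OF F_coco' L_pos]])
  have VR_int: "integrable M (\<lambda>\<omega>. (norm (Ft k \<omega> - F (x k \<omega>)))\<^sup>2) \<and> integrable M (\<Delta> k) \<and>
      (\<integral>\<omega>. (norm (Ft k \<omega> - F (x k \<omega>)))\<^sup>2 \<partial>M) \<le> (\<integral>\<omega>. \<Delta> k \<omega> \<partial>M) \<and>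
      (\<integral>\<omega>. \<Delta> k \<omega> \<partial>M) \<le> (1 - \<kappa> k) * (if k = 0 then 0 else \<integral>\<omega>. \<Delta> (k - 1) \<omega> \<partial>M)
        + \<Theta> k * (L * (\<integral>\<omega>. inner (F (x k \<omega>) - F (x (k - 1) \<omega>)) (x k \<omega> - x (k - 1) \<omega>) \<partial>M))
        + (\<sigma> k)\<^sup>2"
    if "integrable M (if k = 0 then (\<lambda>_. 0) else \<Delta> (k - 1))"
      "integrable M (\<lambda>\<omega>. inner (F (x k \<omega>) - F (x (k - 1) \<omega>)) (x k \<omega> - x (k - 1) \<omega>))" for k
  proof -
    note [measurable] = Ft_meas meas[THEN conjunct1]
    have "(\<lambda>\<omega>. Ft k \<omega> - F (x k \<omega>)) \<in> borel_measurable M" by measurable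
    with that show ?thesis
      unfolding F_eq by (intro VR_property_integrated[OF prob sub setting F_coco L_pos VR])
  qed
  have \<kappa>': "1 - Gn k * (tn k - \<mu>) * (tn k - \<mu> - 1) / (Gn (Suc k) * tn k * (tn k - 1))
      + 5 * \<beta> / (\<mu> * Gn (Suc k)) \<le> \<kappa> (Suc k)" for k
  proof -
    have e: "int (Suc k) - 1 = int k" "t (int (Suc k) - 1) = tn k" "t (int (Suc k) - 2) = tn k - \<mu>"
      by (simp_all add: tn_def t_eq algebra_simps)
    show ?thesis using \<kappa>_ge[of "Suc k"] unfolding e Gn_def by (simp add: tn_def)
  qed
  have Gt_err: "norm (Gt k \<omega> - G (x k \<omega>)) \<le> norm (Ft k \<omega> - F (x k \<omega>))"
    if "\<omega> \<in> space M" for k \<omega>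
    unfolding G_eq fb_residual_def Gt_def by (rule fb_step_lipschitz[OF res])
  have \<eta>': "\<eta> k = 2 * \<beta> * (tn k - 1) / (tn k - \<mu> / 2)" for k
    by (simp add: \<eta>_eq tn_def \<nu>_eq)
  have \<Gamma>': "0 < Gn k" and \<Gamma>\<Theta>': "Gn k * \<Theta> k \<le> 2 * \<Lambda>" for k
    by (simp_all add: Gn_def \<Gamma>_pos \<Gamma>\<Theta>)
  interpret vr_splitting M F G x z Ft Gt x0 \<Delta> \<kappa> \<Theta> \<sigma> Gn tn \<eta> L \<beta>bar \<Lambda> \<mu> r \<beta>
    by unfold_locales
      (fact L_pos \<Lambda>0 F_coco' G_coco \<mu>_range r_ge \<beta>_range(1) bb tn_eq \<eta>' it(1) it(2) x_Suc z_Suc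
        meas[THEN conjunct1] meas[THEN conjunct2] Ft_meas Gt_meas Gt_err VR_int \<Theta>_pos \<Gamma>' \<Gamma>\<Theta>' \<kappa>')+
  \<comment> \<open>The energy at index zero already contains \<open>\<sigma> 0\<close>, so \<open>noise\<close> is the series defining \<open>B\<close>
      without its first term.\<close>
  define Bs where "Bs = (\<lambda>k. t (int k - 1) * (t (int k - 1) - 1) * ((\<sigma> k)\<^sup>2 / \<Theta> k))"
  have Bs_summable: "summable Bs" using B_finite by (simp add: Bs_def)
  have noise_Bs: "noise = (\<lambda>k. \<Lambda> * Bs (Suc k))"
    unfolding fun_eq_iff noise_def by (simp add: Bs_def tn_def mult.assoc)
  have sn: "summable noise"
    unfolding noise_Bs using Bs_summable by (intro summable_mult) (simp add: summable_Suc_iff)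
  have "suminf noise = \<Lambda> * (suminf Bs - Bs 0)"
    unfolding noise_Bs using Bs_summable
    by (simp add: suminf_mult summable_Suc_iff suminf_split_head)
  moreover have "0 \<le> \<Lambda> * Bs 0"
  proof -
    have "1 \<le> t (- 1)" using t_basic(1)[of 0] \<mu>_range by (simp add: t_minus_1)
    then show ?thesis using \<Lambda>0 \<Theta>_pos[of 0] by (simp add: Bs_def)
  qed
  ultimately have noise_le: "suminf noise \<le> \<beta> * B"
    using \<beta>_range by (simp add: B_eq Bs_def right_diff_distrib)
  have zero: "G xs = 0" if "xs \<in> zer_op \<Phi>" for xs
    unfolding G_eq by (rule fb_residual_zero[OF res]) (use that \<Phi>_eq in simp)
  have rate: "(\<integral>\<omega>. (norm (G (x k \<omega>)))\<^sup>2 \<partial>M)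
      \<le> 2 * (\<Psi>0sq xs + E0sq + B) / (\<mu>\<^sup>2 * (real k + r - 1)\<^sup>2)" if "xs \<in> zer_op \<Phi>" for xs k
  proof -
    have "Gn 0 * \<mu>\<^sup>2 * r\<^sup>2 / 2 * (\<sigma> 0)\<^sup>2 \<le> \<beta> * E0sq"
    proof -
      have "\<beta> * E0sq = Gn 0 * \<mu>\<^sup>2 * r\<^sup>2 / 2 * (\<sigma> 0)\<^sup>2 + \<beta> * \<mu> * r\<^sup>2 / 2 * (\<sigma> 0)\<^sup>2"
        using \<beta>_range by (simp add: E0sq_eq Gn_def field_simps power2_eq_square)
      moreover have "0 \<le> \<beta> * \<mu> * r\<^sup>2 / 2 * (\<sigma> 0)\<^sup>2" using \<beta>_range \<mu>_range by simp
      ultimately show ?thesis by linarith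
    qed
    then have le: "energy xs 0 + suminf noise \<le> \<beta> * (\<Psi>0sq xs + E0sq + B)"
      using energy_0[of xs] noise_le by (simp add: \<Psi>0sq_eq distrib_left)
    have tk: "tn k - \<mu> = \<mu> * (real k + r - 1)" by (simp add: tn_eq algebra_simps)
    have "0 < tn k - \<mu>" using t_basic(1)[of k] \<mu>_range by simp
    have "(\<integral>\<omega>. (norm (G (x k \<omega>)))\<^sup>2 \<partial>M) \<le> 2 * (energy xs 0 + suminf noise) / (\<beta> * (tn k - \<mu>)\<^sup>2)"
      by (rule residual_rate[OF zero[OF that] sn])
    also have "\<dots> \<le> 2 * (\<beta> * (\<Psi>0sq xs + E0sq + B)) / (\<beta> * (tn k - \<mu>)\<^sup>2)"
      using le \<beta>_range by (intro divide_right_mono mult_left_mono) auto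
    also have "\<dots> = 2 * (\<Psi>0sq xs + E0sq + B) / (\<mu>\<^sup>2 * (real k + r - 1)\<^sup>2)"
      unfolding tk using \<beta>_range by (simp add: power_mult_distrib)
    finally show ?thesis .
  qed
  obtain xs where "xs \<in> zer_op \<Phi>" using zer_nonempty by blast
  note xs = zero[OF this]
  have step: "integrable M (\<lambda>\<omega>. (norm (x (Suc k) \<omega> - x k \<omega>))\<^sup>2)" for k
    using sq_integrable_diff[OF sq_integrable_x sq_integrable_x] by (simp add: sq_integrable_def)
  show ?thesis
    using rate step sq_integrable_G integrable_error summable_Gsq[OF xs sn] summable_errsq[OF xs sn]
      summable_stepsq[OF xs sn] stepsq_vanish[OF xs sn] gap_and_residual_vanish(2)[OF xs sn]
    unfolding sq_integrable_def by simp
qed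

end
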